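(* Let $\lambda,\mu,\nu,\alpha,\gamma$ be partitions such that $|\lambda|\cdot|\mu|=|\nu|$ and $a_{d\alpha,\mu}^{d\gamma}=1$ for all integers $d\geq 1$. Then the sequence $\left(a_{\lambda+d\alpha,\mu}^{\nu+d\gamma}\right)_{d\in\mathbb{N}}$ is non-decreasing and is constant for $d$ large enough.
   Context: For partitions $\lambda,\mu,\nu$, the plethysm coefficient $a_{\lambda,\mu}^\nu$ is the multiplicity of the irreducible $\mathrm{GL}(V)$-representation $\mathbb{S}^\nu(V)$ in $\mathbb{S}^\lambda(\mathbb{S}^\mu(V))$, where $\mathbb{S}$ denotes the Schur functor and $V$ is any complex vector space with $\dim V\geq\max(\ell(\mu),\ell(\nu))$ (this multiplicity does not depend on such a choice; it is the coefficient of the Schur function $s_\nu$ in the plethysm $s_\lambda[s_\mu]$). Partitions are added componentwise (with $\lambda_i=0$ for $i>\ell(\lambda)$) and $d\alpha=(d\alpha_1,d\alpha_2,\dots)$. *)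

theory Defs
  imports "HOL-Combinatorics.Permutations"
begin

text \<open>Partitions are encoded as weakly decreasing functions nat => nat with finite support
  (part i = the (i+1)-th part, 0 beyond the length).  Sum and scalar multiple of
  partitions are then pointwise.\<close>

definition is_partition :: "(nat \<Rightarrow> nat) \<Rightarrow> bool" where
  "is_partition p \<longleftrightarrow> (\<forall>i j. i \<le> j \<longrightarrow> p j \<le> p i) \<and> finite {i. p i \<noteq> 0}"

definition psize :: "(nat \<Rightarrow> nat) \<Rightarrow> nat" where
  "psize p = (\<Sum>i\<in>{i. p i \<noteq> 0}. p i)"

definition plength :: "(nat \<Rightarrow> nat) \<Rightarrow> nat" where
  "plength p = card {i. p i \<noteq> 0}"

definition cells :: "(nat \<Rightarrow> nat) \<Rightarrow> (nat \<times> nat) set" where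
  "cells p = {(i, j). j < p i}"

definition ssyt :: "(nat \<Rightarrow> nat) \<Rightarrow> nat \<Rightarrow> (nat \<times> nat \<Rightarrow> nat) set" where
  "ssyt p n = {T. (\<forall>c\<in>cells p. T c < n) \<and> (\<forall>c. c \<notin> cells p \<longrightarrow> T c = 0)
      \<and> (\<forall>i j. Suc j < p i \<longrightarrow> T (i, j) \<le> T (i, Suc j))
      \<and> (\<forall>i j. j < p (Suc i) \<longrightarrow> T (i, j) < T (Suc i, j))}"

definition content :: "(nat \<Rightarrow> nat) \<Rightarrow> (nat \<times> nat \<Rightarrow> nat) \<Rightarrow> nat \<Rightarrow> nat" where
  "content p T k = card {c \<in> cells p. T c = k}"

text \<open>A fixed total order on tableaux of a given shape (lexicographic on row reading words),
  used to order the monomials of s_mu when substituting them into s_lambda.\<close>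
definition reading_word :: "(nat \<Rightarrow> nat) \<Rightarrow> (nat \<times> nat \<Rightarrow> nat) \<Rightarrow> nat list" where
  "reading_word p T = concat (map (\<lambda>i. map (\<lambda>j. T (i, j)) [0..<p i]) [0..<plength p])"

definition tab_less :: "(nat \<Rightarrow> nat) \<Rightarrow> (nat \<times> nat \<Rightarrow> nat) \<Rightarrow> (nat \<times> nat \<Rightarrow> nat) \<Rightarrow> bool" where
  "tab_less p T U \<longleftrightarrow> (reading_word p T, reading_word p U) \<in> lexord {(a, b). a < b}"

definition tab_le :: "(nat \<Rightarrow> nat) \<Rightarrow> (nat \<times> nat \<Rightarrow> nat) \<Rightarrow> (nat \<times> nat \<Rightarrow> nat) \<Rightarrow> bool" where
  "tab_le p T U \<longleftrightarrow> T = U \<or> tab_less p T U"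

text \<open>Plethystic tableaux: SSYT of shape lam whose entries are SSYT of shape mu (entries < n),
  ordered by tab_le.  They index the monomials of s_lam[s_mu](x_0,...,x_{n-1}).\<close>
definition pleth_tableaux :: "(nat \<Rightarrow> nat) \<Rightarrow> (nat \<Rightarrow> nat) \<Rightarrow> nat
    \<Rightarrow> (nat \<times> nat \<Rightarrow> (nat \<times> nat \<Rightarrow> nat)) set" where
  "pleth_tableaux lam mu n = {F. (\<forall>c\<in>cells lam. F c \<in> ssyt mu n)
      \<and> (\<forall>c. c \<notin> cells lam \<longrightarrow> F c = (\<lambda>_. 0))
      \<and> (\<forall>i j. Suc j < lam i \<longrightarrow> tab_le mu (F (i, j)) (F (i, Suc j)))
      \<and> (\<forall>i j. j < lam (Suc i) \<longrightarrow> tab_less mu (F (i, j)) (F (Suc i, j)))}"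

definition pweight :: "(nat \<Rightarrow> nat) \<Rightarrow> (nat \<Rightarrow> nat)
    \<Rightarrow> (nat \<times> nat \<Rightarrow> (nat \<times> nat \<Rightarrow> nat)) \<Rightarrow> nat \<Rightarrow> nat" where
  "pweight lam mu F k = (\<Sum>c\<in>cells lam. content mu (F c) k)"

definition staircase :: "nat \<Rightarrow> nat \<Rightarrow> nat" where
  "staircase n i = (if i < n then n - 1 - i else 0)"

text \<open>Plethysm coefficient a^nu_{lam,mu}: the coefficient of s_nu in s_lam[s_mu], computed in
  n = max(l(mu), l(nu)) variables as the coefficient of x^(nu+delta) in
  a_delta * s_lam[s_mu](x_0,...,x_{n-1}), where a_delta = sum_w sign(w) prod_i x_i^(delta_(w i)).\<close>
definition pleth_coeff :: "(nat \<Rightarrow> nat) \<Rightarrow> (nat \<Rightarrow> nat) \<Rightarrow> (nat \<Rightarrow> nat) \<Rightarrow> int" where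
  "pleth_coeff lam mu nu =
     (let n = max (plength mu) (plength nu) in
      \<Sum>w\<in>{w. w permutes {0..<n}}.
        sign w * int (card {F \<in> pleth_tableaux lam mu n.
            \<forall>i. pweight lam mu F i + staircase n (w i) = nu i + staircase n i}))"

end

theory Submission
  imports Defs Complex_Main "HOL-Library.Poly_Mapping" "HOL-Library.Product_Lexorder" "HOL-Library.FuncSet"
begin

text \<open>
  The coefficient \<open>a\<close> attached to \<open>(\<lambda>, \<mu>, \<nu>)\<close> is the dimension of the \<open>gl\<^sub>n\<close>-invariants in
  \<open>S\<^sup>\<lambda>(S\<^sup>\<mu>(V)) \<otimes> S\<^sup>\<nu>(V)\<^sup>*\<close>. Schur modules are realized as spaces of highest weight polynomials for the
  row action on a matrix of variables, with a basis found from leading monomials; so the modules of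
  all \<open>(\<lambda>, \<nu>)\<close> sit inside one polynomial ring, as the graded pieces of a ring without zero divisors.
  A nonzero invariant of degree \<open>(\<alpha>, \<gamma>)\<close> therefore acts injectively by multiplication, which gives
  monotonicity. For boundedness, the leading monomials of the pieces of degree \<open>(\<lambda> + d \<alpha>, \<nu> + d \<gamma>)\<close>
  satisfy Dickson's lemma, and the orthogonal projection onto invariants (a Reynolds operator) makes
  the invariants of all these degrees generated by finitely many of them with invariant coefficients
  of degrees \<open>d (\<alpha>, \<gamma>)\<close>, where by hypothesis only a line of invariants exists.

  With \<open>Z\<close> a pseudo-inverse of the Casimir operator \<open>C\<close>, the projection onto invariants is \<open>1 - C Z\<close>.
  In the sum of its weight space traces over the weights \<open>w(\<rho>) - \<rho>\<close> with signs, the contribution of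
  \<open>C Z\<close> cancels, so the dimension of the invariants is an alternating sum of weight multiplicities.
  The weights are those of pairs of tableaux, and straightening the sum along the tableau of shape \<open>\<nu>\<close>
  leaves the defining alternating sum of the plethysm coefficient.
\<close>

text \<open>Complete reducibility and a character formula are needed for modules that are merely
  spaces of real polynomials, and both come from positivity. For the apolar inner product,
  \<open>X u * pd v\<close> and \<open>X v * pd u\<close> are adjoint; hence \<open>E i j\<close>
  and \<open>E j i\<close> are adjoint, the Casimir operator is a sum of operators times their
  adjoints, and its kernel is exactly the space of invariants. Rows and columns of the matrix of
  variables have different tasks. Rows carry the highest weight conditions and the degrees, so
  adding partitions is adding row degrees. Columns carry \<open>gl_n\<close>: a first block of
  columns is a basis of the Schur module of shape \<open>mu\<close>, a second block is the dual of
  V. The obstacle to Hilbert's finiteness argument is that the base ring consists of highest weight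
  polynomials, whose leading monomials form only a cone cut out by interlacing inequalities. Its
  points are Gelfand-Tsetlin patterns, so the same cone indexes the bases, governs division, and
  yields the tableaux of the coefficient. A bounded monotone sequence of dimensions is finally
  constant.\<close>

abbreviation "lookup \<equiv> Poly_Mapping.lookup"
abbreviation "keys \<equiv> Poly_Mapping.keys"
abbreviation "single \<equiv> Poly_Mapping.single"

section \<open>Finitely supported functions as a real vector space and algebra\<close>

instantiation poly_mapping :: (type, real_vector) real_vector
begin

lift_definition scaleR_poly_mapping :: "real \<Rightarrow> ('a \<Rightarrow>\<^sub>0 'b) \<Rightarrow> ('a \<Rightarrow>\<^sub>0 'b)"
  is "\<lambda>c f k. c *\<^sub>R f k"
proof -
  fix c :: real and f :: "'a \<Rightarrow> 'b"
  assume "finite {k. f k \<noteq> 0}"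
  then show "finite {k. c *\<^sub>R f k \<noteq> 0}" by (rule rev_finite_subset) auto
qed

instance
  by standard (transfer; simp add: scaleR_add_right scaleR_add_left fun_eq_iff)+

end

lemma lookup_scaleR [simp]: "lookup (c *\<^sub>R f) k = c *\<^sub>R lookup f k"
  by transfer simp

lemma scaleR_single: "c *\<^sub>R single k a = single k (c *\<^sub>R a)"
  by (rule poly_mapping_eqI) (simp add: lookup_single when_def scaleR_zero_right)

lemma mpol_induct [case_names single add]:
  assumes "\<And>t c. P (single t c)" and "\<And>f g. P f \<Longrightarrow> P g \<Longrightarrow> P (f + g)"
  shows "P (f :: 'a \<Rightarrow>\<^sub>0 'b::comm_monoid_add)"
proof -
  have "P (\<Sum>t\<in>A. single t (lookup f t))" if "finite A" for A
    using that
  proof induction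
    case empty
    show ?case using assms(1)[of undefined 0] by simp
  next
    case (insert x F)
    then show ?case using assms by simp
  qed
  moreover have "f = (\<Sum>t\<in>keys f. single t (lookup f t))"
    by (rule poly_mapping_eqI)
      (auto simp: lookup_sum lookup_single when_def sum.delta' in_keys_iff)
  ultimately show ?thesis by (metis finite_keys)
qed

lemma scaleR_conv_single_mult:
  fixes f :: "'a::monoid_add \<Rightarrow>\<^sub>0 'b::real_algebra_1"
  shows "c *\<^sub>R f = single 0 (of_real c) * f"
  by (induction f rule: mpol_induct)
    (simp_all add: scaleR_single mult_single scaleR_conv_of_real scaleR_add_right distrib_left)

instance poly_mapping :: (comm_monoid_add, real_field) real_algebra
proof
  fix c :: real and f g :: "'a \<Rightarrow>\<^sub>0 'b"
  show "c *\<^sub>R f * g = c *\<^sub>R (f * g)"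
    by (simp add: scaleR_conv_single_mult mult.assoc)
  show "f * c *\<^sub>R g = c *\<^sub>R (f * g)"
    by (simp add: scaleR_conv_single_mult mult.left_commute)
qed

lemma keys_scaleR: "keys (c *\<^sub>R f) \<subseteq> keys f"
  by (auto simp: in_keys_iff)

section \<open>Real polynomials and their derivations\<close>

type_synonym 'v mpol = "('v \<Rightarrow>\<^sub>0 nat) \<Rightarrow>\<^sub>0 real"

definition X :: "'v \<Rightarrow> 'v mpol" where
  "X v = single (single v 1) 1"

text \<open>The partial derivative, read off coefficientwise: only the monomial one step above
  \<open>t\<close> in direction \<open>v\<close> contributes to the coefficient at
  \<open>t\<close>.\<close>

lift_definition pd :: "'v \<Rightarrow> 'v mpol \<Rightarrow> 'v mpol"
  is "\<lambda>v f t. real (lookup t v + 1) * f (t + single v 1)"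
proof -
  fix v :: 'v and f :: "('v \<Rightarrow>\<^sub>0 nat) \<Rightarrow> real"
  assume "finite {t. f t \<noteq> 0}"
  then have "finite ((\<lambda>t. t - single v 1) ` {t. f t \<noteq> 0})" by simp
  then show "finite {t. real (lookup t v + 1) * f (t + single v 1) \<noteq> 0}"
    by (rule rev_finite_subset)
      (auto intro!: image_eqI[where x = "_ + single v 1"])
qed

lemma lookup_pd: "lookup (pd v f) t = real (lookup t v + 1) * lookup f (t + single v 1)"
  by transfer simp

lemma linear_pd: "linear (pd v)"
  by (rule linearI; rule poly_mapping_eqI) (simp_all add: lookup_pd lookup_add algebra_simps)

lemma single_minus_add: "lookup t v > 0 \<Longrightarrow> t - single v 1 + single v (1::nat) = t"
  by (rule poly_mapping_eqI) (auto simp: lookup_add lookup_minus lookup_single when_def)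

lemma single_minus_add': "lookup t v > 0 \<Longrightarrow> t - single v (Suc 0) + single v (Suc 0) = t"
  using single_minus_add[of t v] by simp

lemma single_minus_add'': "lookup t v > 0 \<Longrightarrow> single v (Suc 0) + (t - single v (Suc 0)) = t"
  using single_minus_add[of t v] by (simp add: add.commute)

lemma pd_single:
  "pd v (single t c) = (if lookup t v = 0 then 0 else single (t - single v 1) (real (lookup t v) * c))"
proof (rule poly_mapping_eqI)
  fix s
  show "lookup (pd v (single t c)) s
      = lookup (if lookup t v = 0 then 0 else single (t - single v 1) (real (lookup t v) * c)) s"
  proof (cases "t = s + single v 1")
    case True
    then have "lookup t v = lookup s v + 1" "t - single v 1 = s"
      by (auto simp: lookup_add)
    then show ?thesis using True by (simp add: lookup_pd)
  next
    case False
    then have "lookup t v \<noteq> 0 \<Longrightarrow> t - single v 1 \<noteq> s" using single_minus_add[of t v] by auto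
    then show ?thesis using False by (auto simp: lookup_pd lookup_single when_def)
  qed
qed

lemma monomial_induct [case_names zero add]:
  assumes "P 0" and "\<And>t v. P t \<Longrightarrow> P (t + single v 1)"
  shows "P (t :: 'v \<Rightarrow>\<^sub>0 nat)"
proof (induction "\<Sum>v\<in>keys t. lookup t v" arbitrary: t rule: less_induct)
  case less
  show ?case
  proof (cases "t = 0")
    case True
    then show ?thesis using assms by simp
  next
    case False
    then obtain v where v: "lookup t v > 0"
      by (metis gr0I poly_mapping_eqI lookup_zero)
    let ?s = "t - single v 1"
    have ts: "t = ?s + single v 1" using single_minus_add[OF v] by simp
    have sub: "keys ?s \<subseteq> keys t" by (auto simp: in_keys_iff lookup_minus)
    have "(\<Sum>u\<in>keys ?s. lookup ?s u) = (\<Sum>u\<in>keys t. lookup ?s u)"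
      by (rule sum.mono_neutral_left) (use sub in \<open>auto simp: in_keys_iff\<close>)
    also have "\<dots> < (\<Sum>u\<in>keys t. lookup t u)"
      by (rule sum_strict_mono_ex1)
        (use v in \<open>auto simp: lookup_minus lookup_single when_def in_keys_iff intro!: bexI[of _ v]\<close>)
    finally have "P ?s" by (rule less)
    then show ?thesis using assms(2) ts by metis
  qed
qed

definition derivation :: "('v mpol \<Rightarrow> 'v mpol) \<Rightarrow> bool" where
  "derivation D \<longleftrightarrow> linear D \<and> (\<forall>f g. D (f * g) = D f * g + f * D g)"

lemma derivation_linear: "derivation D \<Longrightarrow> linear D"
  and derivation_mult: "derivation D \<Longrightarrow> D (f * g) = D f * g + f * D g"
  by (simp_all add: derivation_def)

lemma derivation_pd: "derivation (pd v)"
proof -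
  have lin: "pd v (f + g) = pd v f + pd v g" for f g :: "'a mpol"
    using linear_pd by (rule linear_add)
  have mono: "pd v (single s a * single t b) = pd v (single s a) * single t b + single s a * pd v (single t b)"
    for s t :: "'a \<Rightarrow>\<^sub>0 nat" and a b
  proof -
    have 1: "s + t - single v 1 = (s - single v 1) + t" if "lookup s v > 0"
      by (rule poly_mapping_eqI) (use that in \<open>auto simp: lookup_add lookup_minus lookup_single when_def\<close>)
    have 2: "s + t - single v 1 = s + (t - single v 1)" if "lookup t v > 0"
      by (rule poly_mapping_eqI) (use that in \<open>auto simp: lookup_add lookup_minus lookup_single when_def\<close>)
    show ?thesis
      using 1 2 by (auto simp: pd_single mult_single lookup_add algebra_simps single_add[symmetric])
  qed
  have "pd v (f * g) = pd v f * g + f * pd v g" for f g :: "'a mpol"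
  proof (induction f rule: mpol_induct)
    case (single t c)
    show ?case
      by (induction g rule: mpol_induct) (simp_all add: mono lin algebra_simps)
  qed (simp add: lin algebra_simps)
  then show ?thesis by (simp add: derivation_def linear_pd)
qed

lemma derivation_one: "derivation D \<Longrightarrow> D 1 = 0"
  using derivation_mult[of D 1 1] by simp

lemma single_eq_scaleR: "single t c = c *\<^sub>R single t (1::real)"
  by (simp add: scaleR_single)

text \<open>The Leibniz rule propagates values from variables to monomials. The commutation
  relations of the row and column operators are proved through it: both sides are derivations, so
  only variables have to be compared.\<close>

lemma derivation_ext:
  assumes "derivation D" "derivation D'" and "\<And>v. D (X v) = D' (X v)"
  shows "D f = D' f"
proof -
  have "D (single t 1) = D' (single t 1)" for t
  proof (induction t rule: monomial_induct)
    case zero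
    show ?case using derivation_one[OF assms(1)] derivation_one[OF assms(2)] by simp
  next
    case (add t v)
    have "single (t + single v 1) (1::real) = single t 1 * X v" by (simp add: X_def mult_single)
    then show ?case using assms add by (simp add: derivation_mult)
  qed
  then have single: "D (single t c) = D' (single t c)" for t c
    using assms(1,2) by (subst (1 2) single_eq_scaleR) (simp add: derivation_linear linear_scale)
  have "linear D" "linear D'" using assms by (simp_all add: derivation_linear)
  then show ?thesis
    by (induction f rule: mpol_induct) (simp_all add: single linear_add)
qed

lemma derivation_mult_left: "derivation D \<Longrightarrow> derivation (\<lambda>f. g * D f)"
  unfolding derivation_def by (auto simp: linear_iff algebra_simps)

lemma derivation_scaleR: "derivation D \<Longrightarrow> derivation (\<lambda>f. c *\<^sub>R D f)"
  unfolding derivation_def by (auto simp: linear_iff algebra_simps)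

lemma derivation_sum:
  assumes "\<And>i. i \<in> I \<Longrightarrow> derivation (D i)"
  shows "derivation (\<lambda>f. \<Sum>i\<in>I. D i f)"
  using assms
  by (induction I rule: infinite_finite_induct)
     (auto simp: derivation_def linear_iff algebra_simps)

lemma derivation_diff: "derivation D \<Longrightarrow> derivation D' \<Longrightarrow> derivation (\<lambda>f. D f - D' f)"
  unfolding derivation_def by (auto simp: linear_iff algebra_simps)

lemma derivation_commutator:
  assumes "derivation D" "derivation D'"
  shows "derivation (\<lambda>f. D (D' f) - D' (D f))"
  using assms unfolding derivation_def
  by (auto simp: linear_iff algebra_simps)

lemma derivation_prod:
  assumes "derivation D" "finite A"
  shows "D (\<Prod>i\<in>A. f i) = (\<Sum>i\<in>A. D (f i) * (\<Prod>j\<in>A - {i}. f j))"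
  using assms(2)
proof induction
  case empty
  show ?case using assms(1) by (simp add: derivation_one)
next
  case (insert x F)
  have "(\<Sum>i\<in>F. D (f i) * (\<Prod>j\<in>insert x F - {i}. f j)) = (\<Sum>i\<in>F. f x * (D (f i) * (\<Prod>j\<in>F - {i}. f j)))"
  proof (rule sum.cong[OF refl])
    fix i assume "i \<in> F"
    then have "insert x F - {i} = insert x (F - {i})" using insert by auto
    then show "D (f i) * (\<Prod>j\<in>insert x F - {i}. f j) = f x * (D (f i) * (\<Prod>j\<in>F - {i}. f j))"
      using insert by simp
  qed
  then show ?case
    using insert assms(1) by (simp add: derivation_mult sum_distrib_left algebra_simps)
qed

lemma pd_X: "pd v (X u) = (if u = v then 1 else 0)"
  by (auto simp: X_def pd_single lookup_single when_def)

lemma lookup_X_mult: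
  "lookup (X v * f) t = (if lookup t v = 0 then 0 else lookup f (t - single v 1))"
proof (induction f rule: mpol_induct)
  case (single s c)
  have *: "single v 1 + s = t \<longleftrightarrow> lookup t v \<noteq> 0 \<and> s = t - single v 1"
  proof
    assume "single v 1 + s = t"
    then show "lookup t v \<noteq> 0 \<and> s = t - single v 1" by (auto simp: lookup_add)
  next
    assume "lookup t v \<noteq> 0 \<and> s = t - single v 1"
    then show "single v 1 + s = t" using single_minus_add''[of t v] by simp
  qed
  show ?case
    unfolding X_def mult_single lookup_single when_def * by simp
qed (auto simp: algebra_simps lookup_add)

lemma keys_X_mult: "keys (X v * f) = (\<lambda>t. t + single v 1) ` keys f"
proof
  show "keys (X v * f) \<subseteq> (\<lambda>t. t + single v 1) ` keys f"
  proof
    fix t assume "t \<in> keys (X v * f)"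
    then have "lookup t v > 0" "t - single v 1 \<in> keys f"
      by (auto simp: in_keys_iff lookup_X_mult split: if_splits)
    then show "t \<in> (\<lambda>t. t + single v 1) ` keys f"
      using single_minus_add[of t v] by (metis image_eqI)
  qed
  show "(\<lambda>t. t + single v 1) ` keys f \<subseteq> keys (X v * f)"
    by (auto simp: in_keys_iff lookup_X_mult lookup_add)
qed

lemma keys_pd: "t \<in> keys (pd v f) \<Longrightarrow> t + single v 1 \<in> keys f"
  by (simp add: in_keys_iff lookup_pd)

lemma keys_X_pd:
  assumes "t \<in> keys (X u * pd v f)"
  obtains s where "s \<in> keys f" "lookup s v > 0" "t = s - single v 1 + single u 1"
proof -
  obtain q where q: "q \<in> keys (pd v f)" "t = q + single u 1"
    using assms by (auto simp: keys_X_mult)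
  show ?thesis
    by (rule that[of "q + single v 1"]) (use q keys_pd[of q v f] in \<open>simp_all add: lookup_add\<close>)
qed

lemma lookup_X_pd_same: "lookup (X v * pd v f) t = real (lookup t v) * lookup f t"
  using single_minus_add'[of t v] by (simp add: lookup_X_mult lookup_pd lookup_minus)

section \<open>The apolar inner product\<close>

text \<open>The squared norm of the monomial \<open>t\<close> in the apolar (Fischer) inner product
  \<open>ip\<close>.\<close>

definition mfact :: "('v \<Rightarrow>\<^sub>0 nat) \<Rightarrow> real" where
  "mfact t = (\<Prod>v\<in>keys t. fact (lookup t v))"

lemma mfact_superset: "finite A \<Longrightarrow> keys t \<subseteq> A \<Longrightarrow> mfact t = (\<Prod>v\<in>A. fact (lookup t v))"
  unfolding mfact_def by (rule prod.mono_neutral_left) (auto simp: in_keys_iff)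

lemma mfact_pos: "mfact t > 0"
  unfolding mfact_def by (rule prod_pos) auto

lemma mfact_add_single: "mfact (t + single v 1) = real (lookup t v + 1) * mfact t"
proof -
  let ?A = "insert v (keys t)"
  have sub: "keys (t + single v 1) \<subseteq> ?A"
    by (auto simp: in_keys_iff lookup_add lookup_single when_def split: if_splits)
  have "mfact (t + single v 1) = (\<Prod>u\<in>?A. fact (lookup (t + single v 1) u))"
    by (rule mfact_superset) (use sub in auto)
  also have "\<dots> = fact (Suc (lookup t v)) * (\<Prod>u\<in>?A - {v}. fact (lookup (t + single v 1) u))"
    by (subst prod.remove[of _ v]) (auto simp: lookup_add)
  also have "(\<Prod>u\<in>?A - {v}. fact (lookup (t + single v 1) u)) = (\<Prod>u\<in>?A - {v}. fact (lookup t u) :: real)"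
    by (rule prod.cong) (auto simp: lookup_add lookup_single when_def)
  also have "fact (Suc (lookup t v)) * \<dots> = real (lookup t v + 1) * (fact (lookup t v) * \<dots>)"
    by simp
  also have "fact (lookup t v) * (\<Prod>u\<in>?A - {v}. fact (lookup t u)) = (\<Prod>u\<in>?A. fact (lookup t u) :: real)"
    by (subst prod.remove[of ?A v]) auto
  also have "\<dots> = mfact t" by (rule mfact_superset[symmetric]) auto
  finally show ?thesis .
qed

definition ip :: "'v mpol \<Rightarrow> 'v mpol \<Rightarrow> real" where
  "ip f g = (\<Sum>t\<in>keys f. lookup f t * lookup g t * mfact t)"

lemma ip_superset:
  "finite A \<Longrightarrow> keys f \<subseteq> A \<Longrightarrow> ip f g = (\<Sum>t\<in>A. lookup f t * lookup g t * mfact t)"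
  unfolding ip_def by (rule sum.mono_neutral_left) (auto simp: in_keys_iff)

lemma ip_commute: "ip f g = ip g f"
proof -
  have "ip f g = (\<Sum>t\<in>keys f \<union> keys g. lookup f t * lookup g t * mfact t)"
    by (rule ip_superset) auto
  also have "\<dots> = ip g f"
    by (subst ip_superset[of "keys f \<union> keys g" g f]) (auto simp: mult.commute)
  finally show ?thesis .
qed

lemma linear_ip: "linear (ip f)"
  by (rule linearI) (simp_all add: ip_def lookup_add algebra_simps sum.distrib sum_distrib_left)

lemmas ip_add_right = linear_add[OF linear_ip]
  and ip_scale_right = linear_scale[OF linear_ip, unfolded real_scaleR_def]
  and ip_diff_right = linear_diff[OF linear_ip]
  and ip_zero_right [simp] = linear_0[OF linear_ip]
  and ip_sum_right = linear_sum[OF linear_ip]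

lemma ip_scale_left: "ip (c *\<^sub>R g) f = c * ip g f"
  by (metis ip_commute ip_scale_right)

lemma ip_diff_left: "ip (g - h) f = ip g f - ip h f"
  by (metis ip_commute ip_diff_right)

lemma ip_zero_left [simp]: "ip 0 f = 0"
  by (metis ip_commute ip_zero_right)

lemma ip_sum_left: "ip (\<Sum>i\<in>I. g i) f = (\<Sum>i\<in>I. ip (g i) f)"
  by (simp add: ip_commute[of _ f] ip_sum_right)

lemma ip_self_nonneg: "ip f f \<ge> 0"
  unfolding ip_def by (rule sum_nonneg) (simp add: mfact_pos order_less_imp_le)

lemma ip_self_eq_0: "ip f f = 0 \<longleftrightarrow> f = 0"
proof
  assume 0: "ip f f = 0"
  have "lookup f t * lookup f t * mfact t = 0" if "t \<in> keys f" for t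
    using 0 that unfolding ip_def
    by (subst (asm) sum_nonneg_eq_0_iff) (auto simp: mfact_pos order_less_imp_le)
  moreover have "mfact t \<noteq> 0" for t :: "'a \<Rightarrow>\<^sub>0 nat" using mfact_pos[of t] by simp
  ultimately have "lookup f t = 0" for t by (metis in_keys_iff mult_eq_0_iff)
  then show "f = 0" by (simp add: poly_mapping_eqI)
qed simp

lemma ip_disjoint: "keys f \<inter> keys g = {} \<Longrightarrow> ip f g = 0"
  unfolding ip_def by (rule sum.neutral) (auto simp: in_keys_iff)

text \<open>The factorial weights exist for this: raising the exponent of \<open>v\<close>
  multiplies \<open>mfact\<close> by the very factor that differentiation produces.\<close>

lemma ip_X_pd: "ip (X v * f) g = ip f (pd v g)"
proof -
  have "ip (X v * f) g = (\<Sum>t\<in>keys f. lookup (X v * f) (t + single v 1) * lookup g (t + single v 1) * mfact (t + single v 1))"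
    unfolding ip_def keys_X_mult by (subst sum.reindex) (auto simp: inj_on_def)
  also have "\<dots> = ip f (pd v g)"
    unfolding ip_def
  proof (rule sum.cong[OF refl])
    fix t
    show "lookup (X v * f) (t + single v 1) * lookup g (t + single v 1) * mfact (t + single v 1)
        = lookup f t * lookup (pd v g) t * mfact t"
      unfolding mfact_add_single lookup_pd lookup_X_mult
      by (simp add: lookup_add algebra_simps)
  qed
  finally show ?thesis .
qed

text \<open>Polarization operators come in adjoint pairs. Adjointness of the row operators and of
  the column operators is inherited from here.\<close>

lemma ip_X_pd_adjoint: "ip (X u * pd v f) g = ip f (X v * pd u g)"
  by (metis ip_X_pd ip_commute)

definition orthonormal :: "'i set \<Rightarrow> ('i \<Rightarrow> 'v mpol) \<Rightarrow> bool" where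
  "orthonormal I b \<longleftrightarrow> (\<forall>i\<in>I. \<forall>j\<in>I. ip (b i) (b j) = (if i = j then 1 else 0))"

lemma parseval:
  assumes "finite I" "orthonormal I b" "f \<in> span (b ` I)"
  shows "f = (\<Sum>i\<in>I. ip (b i) f *\<^sub>R b i)"
  using assms(3)
proof (induction rule: span_induct_alt)
  case base
  show ?case by simp
next
  case (step c x y)
  obtain j where j: "j \<in> I" "x = b j" using step by auto
  have "(\<Sum>i\<in>I. ip (b i) x *\<^sub>R b i) = (\<Sum>i\<in>I. if i = j then x else 0)"
    by (rule sum.cong) (use assms j in \<open>auto simp: orthonormal_def\<close>)
  then have "(\<Sum>i\<in>I. ip (b i) x *\<^sub>R b i) = x" using assms(1) j by simp
  then show ?case using step.IH
    by (simp add: ip_add_right ip_scale_right scaleR_add_left sum.distrib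
        flip: scaleR_scaleR scaleR_sum_right)
qed

lemma parseval_ip:
  assumes "finite I" "orthonormal I b" "f \<in> span (b ` I)"
  shows "ip g f = (\<Sum>i\<in>I. ip g (b i) * ip (b i) f)"
proof -
  have "ip g f = ip g (\<Sum>i\<in>I. ip (b i) f *\<^sub>R b i)" using parseval[OF assms] by simp
  then show ?thesis by (simp add: ip_sum_right ip_scale_right mult.commute)
qed

text \<open>The pieces \<open>W k\<close> are mutually orthogonal, so projecting \<open>h x\<close>
  onto the earlier vectors only involves vectors of its own grade. The orthonormal basis therefore
  stays homogeneous; later the grade is the weight.\<close>

lemma gram_schmidt:
  assumes "finite I"
    and "\<And>c. (\<Sum>i\<in>I. c i *\<^sub>R h i) = 0 \<Longrightarrow> \<forall>i\<in>I. c i = 0"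
    and W: "\<And>k. subspace (W k)" and orth: "\<And>k k' f g. k \<noteq> k' \<Longrightarrow> f \<in> W k \<Longrightarrow> g \<in> W k' \<Longrightarrow> ip f g = 0"
    and "\<And>i. i \<in> I \<Longrightarrow> h i \<in> W (\<kappa> i)"
  shows "\<exists>b. orthonormal I b \<and> (\<forall>i\<in>I. b i \<in> W (\<kappa> i) \<and> b i \<in> span (h ` I) \<and> h i \<in> span (b ` I))"
  using assms(1,2,5)
proof (induction I)
  case empty
  show ?case by (simp add: orthonormal_def)
next
  case (insert x I)
  have "\<forall>i\<in>I. c i = 0" if "(\<Sum>i\<in>I. c i *\<^sub>R h i) = 0" for c
  proof -
    have "(\<Sum>i\<in>insert x I. (c(x := 0)) i *\<^sub>R h i) = (\<Sum>i\<in>I. c i *\<^sub>R h i)"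
      using insert(1,2) by (auto intro!: sum.cong)
    then have "\<forall>i\<in>insert x I. (c(x := 0)) i = 0" using that insert(4)[of "c(x:=0)"] by argo
    then show ?thesis using insert(2) by (metis fun_upd_other insertCI)
  qed
  then obtain b where b: "orthonormal I b"
    "\<And>i. i \<in> I \<Longrightarrow> b i \<in> W (\<kappa> i) \<and> b i \<in> span (h ` I) \<and> h i \<in> span (b ` I)"
    using insert(3) insert(5) by blast
  define p where "p = (\<Sum>i\<in>I. ip (b i) (h x) *\<^sub>R b i)"
  define v where "v = h x - p"
  have pspan: "p \<in> span (h ` I)"
    unfolding p_def by (intro span_sum span_scale) (use b in auto)
  have "h x \<notin> span (h ` I)"
  proof
    assume "h x \<in> span (h ` I)"
    then have "\<exists>c. h x = (\<Sum>i\<in>I. c i *\<^sub>R h i)"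
    proof (induction rule: span_induct_alt)
      case base
      show ?case by (rule exI[of _ "\<lambda>_. 0"]) simp
    next
      case (step c y z)
      then obtain j d where jd: "j \<in> I" "y = h j" "z = (\<Sum>i\<in>I. d i *\<^sub>R h i)" by auto
      have "(\<Sum>i\<in>I. (d i + (if i = j then c else 0)) *\<^sub>R h i) = z + (\<Sum>i\<in>I. if i = j then c *\<^sub>R h j else 0)"
        unfolding jd(3) sum.distrib[symmetric] by (rule sum.cong) (auto simp: algebra_simps)
      also have "\<dots> = c *\<^sub>R y + z" using jd insert(1) by simp
      finally show ?case by metis
    qed
    then obtain c where c: "h x = (\<Sum>i\<in>I. c i *\<^sub>R h i)" by blast
    have "(\<Sum>i\<in>I. (c(x := -1)) i *\<^sub>R h i) = (\<Sum>i\<in>I. c i *\<^sub>R h i)"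
      by (rule sum.cong) (use insert(2) in auto)
    then have "(\<Sum>i\<in>insert x I. (c(x := -1)) i *\<^sub>R h i) = 0"
      using insert(1,2) c by simp
    then have "(c(x := -1)) x = 0" using insert(4) by blast
    then show False by simp
  qed
  then have "v \<noteq> 0" using pspan by (auto simp: v_def)
  then have vpos: "ip v v > 0" using ip_self_nonneg[of v] ip_self_eq_0[of v] by linarith
  have vW: "v \<in> W (\<kappa> x)"
  proof -
    have "p \<in> W (\<kappa> x)" unfolding p_def
    proof (rule subspace_sum[OF W])
      fix i assume i: "i \<in> I"
      show "ip (b i) (h x) *\<^sub>R b i \<in> W (\<kappa> x)"
      proof (cases "\<kappa> i = \<kappa> x")
        case True
        then show ?thesis using b(2)[OF i] W subspace_scale by metis
      next
        case False
        then have "ip (b i) (h x) = 0" using orth b(2)[OF i] insert(5) by blast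
          then show ?thesis using subspace_0[OF W] by simp
      qed
    qed
    then show ?thesis unfolding v_def using insert(5) W subspace_diff by blast
  qed
  have vorth: "ip (b i) v = 0" if "i \<in> I" for i
  proof -
    have "ip (b i) p = (\<Sum>j\<in>I. if j = i then ip (b j) (h x) else 0)"
      unfolding p_def ip_sum_right ip_scale_right
      by (rule sum.cong) (use b(1) that in \<open>auto simp: orthonormal_def\<close>)
    then show ?thesis using that insert(1) by (simp add: v_def ip_diff_right)
  qed
  define b' where "b' = b(x := (1 / sqrt (ip v v)) *\<^sub>R v)"
  have b'I: "b' i = b i" if "i \<in> I" for i using that insert(2) by (auto simp: b'_def)
  have b'x: "b' x = (1 / sqrt (ip v v)) *\<^sub>R v" by (simp add: b'_def)
  have nx: "ip (b' x) (b' x) = 1"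
    using vpos by (simp add: b'x ip_scale_left ip_scale_right)
  have cr: "ip (b' i) (b' x) = 0" "ip (b' x) (b' i) = 0" if "i \<in> I" for i
    using vorth[OF that] ip_commute[of v "b i"] by (simp_all add: b'I[OF that] b'x ip_scale_left ip_scale_right)
  have on: "orthonormal (insert x I) b'"
    unfolding orthonormal_def
  proof (intro ballI)
    fix i j assume ij: "i \<in> insert x I" "j \<in> insert x I"
    show "ip (b' i) (b' j) = (if i = j then 1 else 0)"
      using ij nx cr b'I b(1) insert(2) unfolding orthonormal_def
      by (cases "i = x"; cases "j = x") simp_all
  qed
  have sb: "span (b ` I) \<subseteq> span (b' ` insert x I)"
    by (rule span_mono) (use b'I in \<open>auto simp: image_iff\<close>)
  have sh: "span (h ` I) \<subseteq> span (h ` insert x I)" by (rule span_mono) auto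
  have "h x \<in> span (b' ` insert x I)"
  proof -
    have "p \<in> span (b' ` insert x I)"
      unfolding p_def using sb by (intro span_sum span_scale) (auto intro: span_base)
    moreover have "sqrt (ip v v) *\<^sub>R b' x = v" using vpos by (simp add: b'x)
    then have "v \<in> span (b' ` insert x I)" by (metis image_eqI insertI1 span_base span_scale)
    ultimately have "v + p \<in> span (b' ` insert x I)" by (rule span_add[rotated])
    then show ?thesis by (simp add: v_def)
  qed
  moreover have "b' x \<in> span (h ` insert x I)"
    unfolding b'x v_def using pspan sh by (intro span_scale span_diff) (auto intro: span_base)
  moreover have "b' x \<in> W (\<kappa> x)" unfolding b'x using vW W subspace_scale by blast
  ultimately show ?case using on b'I b(2) sb sh
    by (intro exI[of _ b']) (auto simp del: image_insert)
qed

section \<open>Leading monomials\<close>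

text \<open>A lexicographic order in which the largest variable is most significant. For variables
  (column, row), the last column is inspected first, and inside a column the largest row
  index.\<close>

definition mless :: "('v::linorder \<Rightarrow>\<^sub>0 nat) \<Rightarrow> ('v \<Rightarrow>\<^sub>0 nat) \<Rightarrow> bool" where
  "mless s t \<longleftrightarrow> (\<exists>v. lookup s v < lookup t v \<and> (\<forall>u>v. lookup s u = lookup t u))"

lemma mless_irrefl: "\<not> mless t t"
  by (auto simp: mless_def)

lemma mless_trans: "mless r s \<Longrightarrow> mless s t \<Longrightarrow> mless r t"
  unfolding mless_def
proof (elim exE conjE)
  fix v w
  assume *: "lookup r v < lookup s v" "\<forall>u>v. lookup r u = lookup s u"
    "lookup s w < lookup t w" "\<forall>u>w. lookup s u = lookup t u"
  show "\<exists>v. lookup r v < lookup t v \<and> (\<forall>u>v. lookup r u = lookup t u)"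
    by (rule exI[of _ "max v w"])
      (use * in \<open>cases v w rule: linorder_cases; auto simp: max_def intro: order.strict_trans\<close>)
qed

lemma mless_total: "s \<noteq> t \<Longrightarrow> mless s t \<or> mless t s"
proof -
  assume "s \<noteq> t"
  let ?D = "{v. lookup s v \<noteq> lookup t v}"
  have "?D \<subseteq> keys s \<union> keys t" by (auto simp: in_keys_iff)
  then have fin: "finite ?D" by (rule finite_subset) simp
  have ne: "?D \<noteq> {}" using \<open>s \<noteq> t\<close> by (auto intro: poly_mapping_eqI)
  let ?v = "Max ?D"
  have "lookup s ?v \<noteq> lookup t ?v" using Max_in[OF fin ne] by simp
  moreover have "\<forall>u>?v. lookup s u = lookup t u" using Max_ge[OF fin] by (metis (mono_tags) leD mem_Collect_eq)
  ultimately obtain v where v: "lookup s v \<noteq> lookup t v" "\<forall>u>v. lookup s u = lookup t u" by blast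
  from v(1) consider "lookup s v < lookup t v" | "lookup t v < lookup s v" by linarith
  then show ?thesis
  proof cases
    case 1
    with v(2) have "mless s t" unfolding mless_def by blast
    then show ?thesis ..
  next
    case 2
    from v(2) have "\<forall>u>v. lookup t u = lookup s u" by metis
    with 2 have "mless t s" unfolding mless_def by blast
    then show ?thesis ..
  qed
qed

lemma mless_add_right: "mless s t \<Longrightarrow> mless (s + u) (t + u)"
  by (auto simp: mless_def lookup_add)

lemma mless_add_left: "mless s t \<Longrightarrow> mless (u + s) (u + t)"
  by (auto simp: mless_def lookup_add)

definition lm :: "('v::linorder) mpol \<Rightarrow> ('v \<Rightarrow>\<^sub>0 nat) \<Rightarrow> bool" where
  "lm f t \<longleftrightarrow> t \<in> keys f \<and> (\<forall>s\<in>keys f. s = t \<or> mless s t)"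

lemma lm_exists:
  assumes "f \<noteq> 0" obtains t where "lm f t"
proof -
  have "\<exists>t\<in>A. \<forall>s\<in>A. s = t \<or> mless s t" if "finite A" "A \<noteq> {}" for A :: "('a \<Rightarrow>\<^sub>0 nat) set"
    using that
  proof (induction rule: finite_ne_induct)
    case (insert x F)
    then obtain t where t: "t \<in> F" "\<forall>s\<in>F. s = t \<or> mless s t" by blast
    show ?case
    proof (cases "mless t x")
      case True
      have "s = x \<or> mless s x" if "s \<in> insert x F" for s
        using that t(2) True mless_trans[of s t x] by auto
      then show ?thesis by blast
    next
      case False
      then have "x = t \<or> mless x t" using mless_total[of x t] by auto
      then have "s = t \<or> mless s t" if "s \<in> insert x F" for s
        using that t(2) by auto
      then show ?thesis using t(1) by blast
    qed
  qed auto
  from this[of "keys f"] assms that show ?thesis by (auto simp: lm_def)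
qed

text \<open>Once both leading terms are split off, every remaining product is strictly smaller
  because the order is compatible with addition, so nothing can cancel the product of the leading
  terms.\<close>

lemma lm_mult:
  assumes "lm f s" "lm g t"
  shows "lm (f * g) (s + t)" and "lookup (f * g) (s + t) = lookup f s * lookup g t"
proof -
  define f' where "f' = f - single s (lookup f s)"
  define g' where "g' = g - single t (lookup g t)"
  have kf: "mless r s" if "r \<in> keys f'" for r
    using that assms(1) by (auto simp: f'_def lm_def in_keys_iff lookup_minus lookup_single when_def split: if_splits)
  have kg: "mless r t" if "r \<in> keys g'" for r
    using that assms(2) by (auto simp: g'_def lm_def in_keys_iff lookup_minus lookup_single when_def split: if_splits)
  define r1 where "r1 = single s (lookup f s) * g'"
  define r2 where "r2 = f' * g"
  have eq: "f * g = single (s + t) (lookup f s * lookup g t) + (r1 + r2)"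
    by (simp add: r1_def r2_def f'_def g'_def algebra_simps mult_single)
  have "mless r (s + t)" if r: "r \<in> keys r1" for r
  proof -
    obtain b where "r = s + b" "b \<in> keys g'"
      using r keys_mult[of "single s (lookup f s)" g'] unfolding r1_def by (fastforce split: if_splits)
    then show ?thesis using kg mless_add_left by blast
  qed
  moreover have "mless r (s + t)" if r: "r \<in> keys r2" for r
  proof -
    obtain a b where "r = a + b" "a \<in> keys f'" "b \<in> keys g"
      using r keys_mult[of f' g] unfolding r2_def by fastforce
    moreover have "b = t \<or> mless b t" using calculation assms(2) by (auto simp: lm_def)
    ultimately show ?thesis using kf mless_add_left mless_add_right mless_trans by metis
  qed
  ultimately have kr: "mless r (s + t)" if "r \<in> keys (r1 + r2)" for r
    using that keys_add[of r1 r2] by auto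
  then have 0: "lookup (r1 + r2) (s + t) = 0" using mless_irrefl by (auto simp: in_keys_iff)
  show l: "lookup (f * g) (s + t) = lookup f s * lookup g t"
    unfolding eq lookup_add using 0 by (simp add: lookup_add)
  have "lookup f s \<noteq> 0" "lookup g t \<noteq> 0" using assms by (auto simp: lm_def in_keys_iff)
  then have "s + t \<in> keys (f * g)" using l by (simp add: in_keys_iff)
  moreover have "r = s + t \<or> mless r (s + t)" if "r \<in> keys (f * g)" for r
    using that kr keys_add[of "single (s+t) (lookup f s * lookup g t)" "r1 + r2"] unfolding eq
    by (auto split: if_splits)
  ultimately show "lm (f * g) (s + t)" by (simp add: lm_def)
qed

lemma lm_unique: "lm f s \<Longrightarrow> lm f t \<Longrightarrow> s = t"
  unfolding lm_def using mless_trans mless_irrefl by metis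

section \<open>An alternating sum over the symmetric group\<close>

text \<open>The Weyl-shifted zero weight. For \<open>w\<close> permuting the indices below
  \<open>n\<close> it is \<open>staircase n k - staircase n (w k)\<close> at \<open>k < n\<close>,
  so the choice between an increasing and a decreasing staircase is immaterial.\<close>

definition wshift :: "(nat \<Rightarrow> nat) \<Rightarrow> nat \<Rightarrow> int" where
  "wshift w = (\<lambda>k. int (w k) - int k)"

text \<open>Translation of a weight by \<open>r\<close> times the root of the pair
  \<open>(i, j)\<close>.\<close>

definition move :: "nat \<Rightarrow> nat \<Rightarrow> int \<Rightarrow> (nat \<Rightarrow> int) \<Rightarrow> nat \<Rightarrow> int" where
  "move i j r \<xi> = (\<lambda>k. \<xi> k + (if k = i then r else 0) - (if k = j then r else 0))"

lemma move_move: "move i j r (move i j s \<xi>) = move i j (r + s) \<xi>"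
  by (auto simp: move_def)

lemma move_zero [simp]: "move i j 0 \<xi> = \<xi>"
  by (auto simp: move_def)

lemma finite_perms [simp]: "finite {w. w permutes {..<n::nat}}"
  by (rule finite_permutations) simp

lemma permutes_less: "w permutes {..<n::nat} \<Longrightarrow> i < n \<Longrightarrow> w i < n"
  using permutes_in_image[of w "{..<n}" i] by simp

lemma sum_eq_neg_self: "sum f A = sum (\<lambda>x. - f x) A \<Longrightarrow> sum f A = (0::real)"
  by (simp add: sum_negf)

lemma sign_swap:
  assumes "w permutes {..<n::nat}" "a < n" "b < n" "a \<noteq> b"
  shows "w \<circ> transpose a b permutes {..<n}" "sign (w \<circ> transpose a b) = - sign w"
proof -
  have tr: "transpose a b permutes {..<n}" using assms by (intro permutes_swap_id) auto
  then show "w \<circ> transpose a b permutes {..<n}" using assms(1) permutes_compose by blast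
  have "permutation w" using assms(1) permutation_permutes by blast
  moreover have "permutation (transpose a b)" using tr permutation_permutes by blast
  ultimately show "sign (w \<circ> transpose a b) = - sign w"
    using assms(4) by (simp add: sign_compose sign_swap_id)
qed

text \<open>A sign-reversing involution with \<open>i\<close> and \<open>r\<close> fixed: let
  \<open>l\<close> be the position where \<open>w\<close> takes the value \<open>w j - r\<close>,
  exchange the values of \<open>w\<close> at \<open>j\<close> and \<open>l\<close>, and replace
  \<open>j\<close> by \<open>l\<close>. The translated weight is unchanged, hence so is everything
  in the summand except the sign.\<close>

lemma cancel_lower:
  fixes m :: "(nat \<Rightarrow> int) \<Rightarrow> real"
  assumes i: "i < n"
  shows "(\<Sum>(w, j, r)\<in>{(w, j, r). w permutes {..<n} \<and> j < n \<and> 1 \<le> r \<and> w i + r < w j}.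
           real_of_int (sign w) * (real_of_int (move i j (int r) (wshift w) i) * m (move i j (int r) (wshift w)))) = 0"
    (is "sum ?f ?T = 0")
proof (rule sum_eq_neg_self)
  define \<sigma> where "\<sigma> = (\<lambda>(w :: nat \<Rightarrow> nat, j, r). (w \<circ> transpose j (inv w (w j - r)), inv w (w j - r), r :: nat))"
  have main: "\<sigma> (w, j, r) \<in> ?T \<and> \<sigma> (\<sigma> (w, j, r)) = (w, j, r) \<and> ?f (\<sigma> (w, j, r)) = - ?f (w, j, r)"
    if T: "(w, j, r) \<in> ?T" for w j r
  proof -
    have w: "w permutes {..<n}" and j: "j < n" and r: "1 \<le> r" "w i + r < w j" using T by auto
    define l where "l = inv w (w j - r)"
    have wl: "w l = w j - r" using w by (simp add: l_def permutes_inverses)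
    have "l < n" using permutes_less[OF permutes_inv[OF w], of "w j - r"] permutes_less[OF w j]
      by (simp add: l_def)
    have ne: "l \<noteq> j" "i \<noteq> j" "i \<noteq> l" using wl r by auto
    define w' where "w' = w \<circ> transpose j l"
    have w': "w' permutes {..<n}" "sign w' = - sign w"
      unfolding w'_def using sign_swap[OF w j \<open>l < n\<close>] ne by auto
    have vals: "w' j = w j - r" "w' l = w j" "w' i = w i"
      using ne wl by (auto simp: w'_def transpose_def)
    have oth: "w' k = w k" if "k \<noteq> j" "k \<noteq> l" for k using that by (simp add: w'_def transpose_def)
    have \<sigma>: "\<sigma> (w, j, r) = (w', l, r)" by (simp add: \<sigma>_def w'_def l_def)
    have "inv w' (w' l - r) = j"
      using w'(1) vals permutes_inverses(2) by metis
    then have "\<sigma> (w', l, r) = (w' \<circ> transpose l j, j, r)" by (simp add: \<sigma>_def)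
    also have "w' \<circ> transpose l j = w" unfolding w'_def
      by (simp add: transpose_commute[of l j] comp_assoc)
    finally have inv: "\<sigma> (\<sigma> (w, j, r)) = (w, j, r)" by (simp add: \<sigma>)
    have mv: "move i l (int r) (wshift w') = move i j (int r) (wshift w)"
    proof
      fix k
      show "move i l (int r) (wshift w') k = move i j (int r) (wshift w) k"
        using ne vals oth[of k] wl r by (auto simp: move_def wshift_def)
    qed
    show ?thesis using w' \<open>l < n\<close> r vals inv mv by (simp add: \<sigma>)
  qed
  define f where "f = ?f"
  define T where "T = ?T"
  have main': "\<sigma> x \<in> T \<and> \<sigma> (\<sigma> x) = x \<and> f (\<sigma> x) = - f x" if "x \<in> T" for x
    using main[of "fst x" "fst (snd x)" "snd (snd x)"] that unfolding f_def T_def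
    by (simp only: prod.collapse)
  have "sum f T = (\<Sum>x\<in>T. - f x)"
    by (rule sum.reindex_bij_witness[of _ \<sigma> \<sigma>]) (simp_all add: main')
  then show "sum ?f ?T = (\<Sum>x\<in>?T. - ?f x)" by (simp only: f_def T_def)
qed

text \<open>The mirror image of \<open>cancel_lower\<close>: now \<open>j\<close> is fixed and
  \<open>i\<close> is replaced by the position where \<open>w\<close> takes the value
  \<open>w i + r\<close>.\<close>

lemma cancel_upper:
  fixes m :: "(nat \<Rightarrow> int) \<Rightarrow> real"
  assumes j: "j < n"
  shows "(\<Sum>(w, i, r)\<in>{(w, i, r). w permutes {..<n} \<and> i < n \<and> 1 \<le> r \<and> w i + r < w j}.
           real_of_int (sign w) * (real_of_int (move i j (int r) (wshift w) j) * m (move i j (int r) (wshift w)))) = 0"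
    (is "sum ?f ?T = 0")
proof (rule sum_eq_neg_self)
  define \<sigma> where "\<sigma> = (\<lambda>(w :: nat \<Rightarrow> nat, i, r). (w \<circ> transpose i (inv w (w i + r)), inv w (w i + r), r :: nat))"
  have main: "\<sigma> (w, i, r) \<in> ?T \<and> \<sigma> (\<sigma> (w, i, r)) = (w, i, r) \<and> ?f (\<sigma> (w, i, r)) = - ?f (w, i, r)"
    if T: "(w, i, r) \<in> ?T" for w i r
  proof -
    have w: "w permutes {..<n}" and i: "i < n" and r: "1 \<le> r" "w i + r < w j" using T by auto
    define l where "l = inv w (w i + r)"
    have wl: "w l = w i + r" using w by (simp add: l_def permutes_inverses)
    have "l < n" using permutes_less[OF permutes_inv[OF w], of "w i + r"] permutes_less[OF w j] r
      by (simp add: l_def)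
    have ne: "l \<noteq> i" "i \<noteq> j" "j \<noteq> l" using wl r by auto
    define w' where "w' = w \<circ> transpose i l"
    have w': "w' permutes {..<n}" "sign w' = - sign w"
      unfolding w'_def using sign_swap[OF w i \<open>l < n\<close>] ne by auto
    have vals: "w' i = w i + r" "w' l = w i" "w' j = w j"
      using ne wl by (auto simp: w'_def transpose_def)
    have oth: "w' k = w k" if "k \<noteq> i" "k \<noteq> l" for k using that by (simp add: w'_def transpose_def)
    have \<sigma>: "\<sigma> (w, i, r) = (w', l, r)" by (simp add: \<sigma>_def w'_def l_def)
    have "inv w' (w' l + r) = i"
      using w'(1) vals permutes_inverses(2) by metis
    then have "\<sigma> (w', l, r) = (w' \<circ> transpose l i, i, r)" by (simp add: \<sigma>_def)
    also have "w' \<circ> transpose l i = w" unfolding w'_def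
      by (simp add: transpose_commute[of l i] comp_assoc)
    finally have inv: "\<sigma> (\<sigma> (w, i, r)) = (w, i, r)" by (simp add: \<sigma>)
    have mv: "move l j (int r) (wshift w') = move i j (int r) (wshift w)"
    proof
      fix k
      show "move l j (int r) (wshift w') k = move i j (int r) (wshift w) k"
        using ne vals oth[of k] wl r by (auto simp: move_def wshift_def)
    qed
    show ?thesis using w' \<open>l < n\<close> r vals inv mv by (simp add: \<sigma>)
  qed
  define f where "f = ?f"
  define T where "T = ?T"
  have main': "\<sigma> x \<in> T \<and> \<sigma> (\<sigma> x) = x \<and> f (\<sigma> x) = - f x" if "x \<in> T" for x
    using main[of "fst x" "fst (snd x)" "snd (snd x)"] that unfolding f_def T_def
    by (simp only: prod.collapse)
  have "sum f T = (\<Sum>x\<in>T. - f x)"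
    by (rule sum.reindex_bij_witness[of _ \<sigma> \<sigma>]) (simp_all add: main')
  then show "sum ?f ?T = (\<Sum>x\<in>?T. - ?f x)" by (simp only: f_def T_def)
qed

lemma card_perm_less:
  assumes w: "w permutes {..<n::nat}" and "q \<le> n"
  shows "card {j \<in> {..<n}. w j < q} = q"
proof -
  have "w ` {j \<in> {..<n}. w j < q} = {..<q}"
  proof
    show "{..<q} \<subseteq> w ` {j \<in> {..<n}. w j < q}"
    proof
      fix y assume "y \<in> {..<q}"
      then have "y = w (inv w y)" "inv w y < n"
        using w assms(2) permutes_less[OF permutes_inv[OF w], of y] by (auto simp: permutes_inverses)
      then show "y \<in> w ` {j \<in> {..<n}. w j < q}" using \<open>y \<in> {..<q}\<close> by (intro image_eqI[of _ _ "inv w y"]) auto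
    qed
  qed auto
  moreover have "inj_on w {j \<in> {..<n}. w j < q}" using permutes_inj[OF w] by (rule inj_on_subset) simp
  ultimately show ?thesis by (metis card_image card_lessThan)
qed

text \<open>Orienting every pair so that the smaller value of \<open>w\<close> comes first costs
  commutators. Together with the diagonal terms these add up to a Casimir eigenvalue times
  \<open>m\<close>, and that eigenvalue is zero at the weights \<open>wshift w\<close>, as it is at
  the weight zero.\<close>

lemma alternating_step:
  fixes t :: "nat \<Rightarrow> nat \<Rightarrow> real" and m :: real
  assumes w: "w permutes {..<n::nat}"
    and comm: "\<And>i j. i < n \<Longrightarrow> j < n \<Longrightarrow> i \<noteq> j \<Longrightarrow> t i j - t j i = real_of_int (wshift w i - wshift w j) * m"
    and diag: "\<And>i. i < n \<Longrightarrow> t i i = real_of_int ((wshift w i)\<^sup>2) * m"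
  shows "(\<Sum>i<n. \<Sum>j<n. t i j) = 2 * (\<Sum>i<n. \<Sum>j<n. if w i < w j then t j i else 0)"
proof -
  define x where "x = (\<lambda>i. real_of_int (wshift w i))"
  have inj: "w i = w j \<longleftrightarrow> i = j" for i j using permutes_inj[OF w] by (simp add: inj_eq)
  have 1: "(\<Sum>i<n. \<Sum>j<n. t i j) = (\<Sum>i<n. \<Sum>j<n. (if i = j then t i i else 0)
      + (if w i < w j then t i j else 0) + (if w j < w i then t i j else 0))"
    by (intro sum.cong refl) (use inj in \<open>auto simp: not_less_iff_gr_or_eq\<close>)
  have 2: "(\<Sum>i<n. \<Sum>j<n. (if w j < w i then t i j else 0)) = (\<Sum>i<n. \<Sum>j<n. (if w i < w j then t j i else 0))"
    by (rule sum.swap)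
  have 3: "(\<Sum>i<n. \<Sum>j<n. (if w i < w j then t i j else 0))
     = (\<Sum>i<n. \<Sum>j<n. (if w i < w j then t j i else 0)) + (\<Sum>i<n. \<Sum>j<n. (if w i < w j then (x i - x j) * m else 0))"
    unfolding sum.distrib[symmetric]
  proof (intro sum.cong refl)
    fix i j assume "i \<in> {..<n}" "j \<in> {..<n}"
    then show "(if w i < w j then t i j else 0) = (if w i < w j then t j i else 0) + (if w i < w j then (x i - x j) * m else 0)"
      using comm[of i j] by (cases "i = j") (auto simp: x_def)
  qed
  have 4: "(\<Sum>i<n. \<Sum>j<n. (if w i < w j then (x i - x j) * m else 0))
     = (\<Sum>i<n. x i * (real n - 1 - 2 * real (w i))) * m"
  proof -
    have "(\<Sum>i<n. \<Sum>j<n. (if w i < w j then (x i - x j) * m else 0))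
      = (\<Sum>i<n. \<Sum>j<n. (if w i < w j then x i * m else 0)) - (\<Sum>i<n. \<Sum>j<n. (if w i < w j then x j * m else 0))"
      unfolding sum_subtractf[symmetric] by (intro sum.cong refl) (auto simp: algebra_simps)
    also have "(\<Sum>i<n. \<Sum>j<n. (if w i < w j then x j * m else 0)) = (\<Sum>i<n. \<Sum>j<n. (if w j < w i then x i * m else 0))"
      by (rule sum.swap)
    also have "(\<Sum>i<n. \<Sum>j<n. (if w j < w i then x i * m else 0)) = (\<Sum>i<n. real (w i) * (x i * m))"
    proof (intro sum.cong refl)
      fix i assume i: "i \<in> {..<n}"
      have "(\<Sum>j<n. (if w j < w i then x i * m else 0)) = real (card {j \<in> {..<n}. w j < w i}) * (x i * m)"
        by (subst sum.inter_filter[symmetric]) auto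
      then show "(\<Sum>j<n. (if w j < w i then x i * m else 0)) = real (w i) * (x i * m)"
        using card_perm_less[OF w, of "w i"] permutes_less[OF w, of i] i by auto
    qed
    also have "(\<Sum>i<n. \<Sum>j<n. (if w i < w j then x i * m else 0)) = (\<Sum>i<n. (real n - 1 - real (w i)) * (x i * m))"
    proof (intro sum.cong refl)
      fix i assume i: "i \<in> {..<n}"
      have wi: "w i < n" using permutes_less[OF w, of i] i by auto
      have eq: "{j \<in> {..<n}. w i < w j} = {..<n} - {j \<in> {..<n}. w j < Suc (w i)}" by auto
      then have "card {j \<in> {..<n}. w i < w j} = n - Suc (w i)"
        using card_perm_less[OF w, of "Suc (w i)"] wi by (subst eq, subst card_Diff_subset) auto
      moreover have "(\<Sum>j<n. (if w i < w j then x i * m else 0)) = real (card {j \<in> {..<n}. w i < w j}) * (x i * m)"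
        by (subst sum.inter_filter[symmetric]) auto
      ultimately show "(\<Sum>j<n. (if w i < w j then x i * m else 0)) = (real n - 1 - real (w i)) * (x i * m)"
        using wi by (simp add: of_nat_diff)
    qed
    finally show ?thesis
      unfolding sum_distrib_right sum_subtractf[symmetric] by (simp add: algebra_simps)
  qed
  have sumw: "(\<Sum>i<n. f (w i)) = (\<Sum>i<n. f i)" for f :: "nat \<Rightarrow> real"
    using sum.permute[OF w, of f] by (simp add: comp_def)
  \<comment> \<open>Here the special form of the weight enters. With \<open>x i = w i - i\<close>
    each summand is \<open>i^2 - (w i)^2 + (n - 1) * (w i - i)\<close>, and \<open>w\<close> only
    permutes the indices.\<close>
  have "(\<Sum>i<n. (x i)\<^sup>2) + (\<Sum>i<n. x i * (real n - 1 - 2 * real (w i)))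
     = (\<Sum>i<n. (real i)\<^sup>2) - (\<Sum>i<n. (real (w i))\<^sup>2) + (real n - 1) * ((\<Sum>i<n. real (w i)) - (\<Sum>i<n. real i))"
    unfolding sum.distrib[symmetric] sum_subtractf[symmetric] sum_distrib_left
    by (intro sum.cong refl) (simp add: x_def wshift_def power2_eq_square algebra_simps)
  also have "\<dots> = 0" using sumw[of "\<lambda>i. (real i)\<^sup>2"] sumw[of real] by simp
  finally have 5: "(\<Sum>i<n. (x i)\<^sup>2) * m + (\<Sum>i<n. x i * (real n - 1 - 2 * real (w i))) * m = 0"
    by (metis distrib_right mult_zero_left)
  have 6: "(\<Sum>i<n. \<Sum>j<n. (if i = j then t i i else 0)) = (\<Sum>i<n. (x i)\<^sup>2) * m"
    by (simp add: diag x_def sum_distrib_right)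
  show ?thesis
    unfolding 1 sum.distrib 2 3 4 6 using 5 by simp
qed

text \<open>Cyclicity identifies \<open>t i j\<close> at a weight with \<open>t j i\<close> one root
  step earlier, so the commutator relation becomes a difference equation along the root
  string.\<close>

lemma string_telescope:
  fixes t :: "nat \<Rightarrow> nat \<Rightarrow> (nat \<Rightarrow> int) \<Rightarrow> real" and m :: "(nat \<Rightarrow> int) \<Rightarrow> real"
  assumes comm: "\<And>\<xi>. t i j \<xi> - t j i \<xi> = real_of_int (\<xi> i - \<xi> j) * m \<xi>"
    and cyc: "\<And>\<xi>. t i j \<xi> = t j i (move i j (-1) \<xi>)"
  shows "t j i \<xi> - t j i (move i j (int q) \<xi>)
    = (\<Sum>r = 1..q. real_of_int (move i j (int r) \<xi> i - move i j (int r) \<xi> j) * m (move i j (int r) \<xi>))"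
proof (induction q)
  case (Suc q)
  have "t j i (move i j (int q) \<xi>) = t i j (move i j (int (Suc q)) \<xi>)"
    by (subst cyc) (simp add: move_move)
  then show ?case using Suc comm[of "move i j (int (Suc q)) \<xi>"] by simp
qed simp

text \<open>In the application \<open>t i j \<xi>\<close> is the trace of \<open>Z\<close> composed
  with \<open>E i j\<close> and \<open>E j i\<close> on the weight space of \<open>\<xi>\<close>,
  and \<open>m \<xi>\<close> is the trace of \<open>Z\<close> there. The three hypotheses are the
  commutator relation, cyclicity of the trace, and the diagonal action. The conclusion says that the
  Casimir part drops out of the alternating sum.\<close>

theorem alternating_identity:
  fixes t :: "nat \<Rightarrow> nat \<Rightarrow> (nat \<Rightarrow> int) \<Rightarrow> real" and m :: "(nat \<Rightarrow> int) \<Rightarrow> real"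
  assumes comm: "\<And>i j \<xi>. i < n \<Longrightarrow> j < n \<Longrightarrow> i \<noteq> j \<Longrightarrow> t i j \<xi> - t j i \<xi> = real_of_int (\<xi> i - \<xi> j) * m \<xi>"
    and cyc: "\<And>i j \<xi>. i < n \<Longrightarrow> j < n \<Longrightarrow> i \<noteq> j \<Longrightarrow> t i j \<xi> = t j i (move i j (-1) \<xi>)"
    and diag: "\<And>i \<xi>. i < n \<Longrightarrow> t i i \<xi> = real_of_int ((\<xi> i)\<^sup>2) * m \<xi>"
  shows "(\<Sum>w | w permutes {..<n}. real_of_int (sign w) * (\<Sum>i<n. \<Sum>j<n. t i j (wshift w))) = 0"
proof -
  let ?P = "{w. w permutes {..<n}}"
  define A where "A = (\<lambda>i j. \<Sum>w\<in>?P. if w i < w j then real_of_int (sign w) * t j i (wshift w) else 0)"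
  define S where "S = (\<lambda>i j w. (\<Sum>r = 1..w j - w i - 1.
     real_of_int (move i j (int r) (wshift w) i - move i j (int r) (wshift w) j) * m (move i j (int r) (wshift w))))"
  have "(\<Sum>w\<in>?P. real_of_int (sign w) * (\<Sum>i<n. \<Sum>j<n. t i j (wshift w)))
     = (\<Sum>w\<in>?P. real_of_int (sign w) * (2 * (\<Sum>i<n. \<Sum>j<n. if w i < w j then t j i (wshift w) else 0)))"
    by (intro sum.cong refl, subst alternating_step[where m = "m (wshift _)"]) (auto simp: comm diag)
  also have "\<dots> = 2 * (\<Sum>w\<in>?P. \<Sum>i<n. \<Sum>j<n. if w i < w j then real_of_int (sign w) * t j i (wshift w) else 0)"
    by (simp add: sum_distrib_left if_distrib[of "\<lambda>x. _ * x"] mult.left_commute cong: if_cong)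
  also have "(\<Sum>w\<in>?P. \<Sum>i<n. \<Sum>j<n. if w i < w j then real_of_int (sign w) * t j i (wshift w) else 0)
     = (\<Sum>i<n. \<Sum>j<n. A i j)"
    unfolding A_def by (subst sum.swap, rule sum.cong[OF refl], rule sum.swap)
  also have "2 * (\<Sum>i<n. \<Sum>j<n. A i j) = (\<Sum>i<n. \<Sum>j<n. A i j) + (\<Sum>i<n. \<Sum>j<n. A j i)"
    by (subst (2) sum.swap) simp
  also have "\<dots> = (\<Sum>i<n. \<Sum>j<n. \<Sum>w\<in>?P. if w i < w j then real_of_int (sign w) * S i j w else 0)"
    unfolding sum.distrib[symmetric]
  proof (intro sum.cong refl)
    fix i j assume "i \<in> {..<n}" "j \<in> {..<n}"
    then have ij: "i < n" "j < n" by auto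
    show "A i j + A j i = (\<Sum>w\<in>?P. if w i < w j then real_of_int (sign w) * S i j w else 0)"
    proof (cases "i = j")
      case True
      then show ?thesis by (simp add: A_def)
    next
      case False
      define \<tau> where "\<tau> = (\<lambda>w :: nat \<Rightarrow> nat. w \<circ> transpose i j)"
      \<comment> \<open>Composition with the transposition carries the permutations with
        \<open>w j < w i\<close> to those with \<open>w i < w j\<close>, so both summands can be
        compared at the same \<open>w\<close>.\<close>
      have Aji: "A j i = (\<Sum>w\<in>?P. if w i < w j then - real_of_int (sign w) * t i j (wshift (\<tau> w)) else 0)"
        unfolding A_def
      proof (rule sum.reindex_bij_witness[of _ \<tau> \<tau>])
        fix w assume "w \<in> ?P"
        then show "\<tau> (\<tau> w) = w" "\<tau> w \<in> ?P" "\<tau> (\<tau> w) = w" "\<tau> w \<in> ?P"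
          using sign_swap[of w n i j] ij False by (auto simp: \<tau>_def comp_assoc)
        have "\<tau> (\<tau> w) = w" by (simp add: \<tau>_def comp_assoc)
        moreover have "\<tau> w i = w j" "\<tau> w j = w i" by (simp_all add: \<tau>_def)
        moreover have "sign (\<tau> w) = - sign w" using sign_swap[of w n i j] ij False \<open>w \<in> ?P\<close> by (auto simp: \<tau>_def)
        ultimately show "(if \<tau> w i < \<tau> w j then - real_of_int (sign (\<tau> w)) * t i j (wshift (\<tau> (\<tau> w))) else 0)
          = (if w j < w i then real_of_int (sign w) * t i j (wshift w) else 0)"
          by simp
      qed
      \<comment> \<open>The weights of \<open>w\<close> and of \<open>\<tau> w\<close> lie on one
        root string, \<open>w j - w i\<close> steps apart. Cyclicity accounts for one step, and the
        telescope for the remaining \<open>q\<close>.\<close>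
      have St: "S i j w = t j i (wshift w) - t i j (wshift (\<tau> w))" if "w i < w j" for w
      proof -
        define q where "q = w j - w i - 1"
        have "t i j (wshift (\<tau> w)) = t j i (move i j (-1) (wshift (\<tau> w)))"
          using cyc ij False by blast
        also have "move i j (-1) (wshift (\<tau> w)) = move i j (int q) (wshift w)"
          using that False by (auto simp: fun_eq_iff move_def wshift_def \<tau>_def transpose_def q_def)
        finally show ?thesis
          using string_telescope[of t i j m "wshift w" q] comm[OF ij False] cyc[OF ij False]
          by (simp add: S_def q_def)
      qed
      show ?thesis
        unfolding Aji unfolding A_def sum.distrib[symmetric]
        by (intro sum.cong refl) (simp add: St algebra_simps)
    qed
  qed
  \<comment> \<open>Each interior weight of a string contributes its coordinate \<open>i\<close>
    minus its coordinate \<open>j\<close>. The first part is summed over \<open>j\<close> with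
    \<open>i\<close> fixed, the second over \<open>i\<close> with \<open>j\<close> fixed; these are
    the two sums that cancel.\<close>
  also have "\<dots> = 0"
  proof -
    define T where "T = (\<lambda>i j. {(w, r). w permutes {..<n} \<and> 1 \<le> r \<and> w i + r < w j})"
    let ?g = "\<lambda>i j k (w, r). real_of_int (sign w) * (real_of_int (move i j (int r) (wshift w) k) * m (move i j (int r) (wshift w)))"
    have T: "T i j = Sigma ?P (\<lambda>w. if w i < w j then {1..w j - w i - 1} else {})" for i j
      by (auto simp: T_def split: if_splits)
    have finT [simp]: "finite (T i j)" for i j unfolding T by (rule finite_SigmaI) auto
    have "(\<Sum>w\<in>?P. if w i < w j then real_of_int (sign w) * S i j w else 0) = sum (?g i j i) (T i j) - sum (?g i j j) (T i j)" for i j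
    proof -
      let ?D = "\<lambda>w r. real_of_int (sign w) * (real_of_int (move i j (int r) (wshift w) i - move i j (int r) (wshift w) j) * m (move i j (int r) (wshift w)))"
      have "sum (?g i j i) (T i j) - sum (?g i j j) (T i j)
        = (\<Sum>(w, r)\<in>Sigma ?P (\<lambda>w. if w i < w j then {1..w j - w i - 1} else {}). ?D w r)"
        unfolding T sum_subtractf[symmetric] by (intro sum.cong refl) (auto simp: algebra_simps)
      also have "\<dots> = (\<Sum>w\<in>?P. \<Sum>r\<in>(if w i < w j then {1..w j - w i - 1} else {}). ?D w r)"
        by (subst sum.Sigma[symmetric]) auto
      also have "\<dots> = (\<Sum>w\<in>?P. if w i < w j then real_of_int (sign w) * S i j w else 0)"
        by (intro sum.cong refl) (simp add: S_def sum_distrib_left)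
      finally show ?thesis by simp
    qed
    then have "(\<Sum>i<n. \<Sum>j<n. \<Sum>w\<in>?P. if w i < w j then real_of_int (sign w) * S i j w else 0)
       = (\<Sum>i<n. \<Sum>j<n. sum (?g i j i) (T i j)) - (\<Sum>j<n. \<Sum>i<n. sum (?g i j j) (T i j))"
      by (simp add: sum_subtractf sum.swap[of "\<lambda>i j. sum (?g i j j) (T i j)"])
    moreover have "(\<Sum>j<n. sum (?g i j i) (T i j)) = 0" if "i < n" for i
    proof -
      have "(\<Sum>j<n. sum (?g i j i) (T i j)) = (\<Sum>(j, w, r)\<in>Sigma {..<n} (T i). ?g i j i (w, r))"
        by (subst sum.Sigma) (auto simp: split_def)
      also have "\<dots> = 0"
        by (subst cancel_lower[OF that, of m, symmetric],
            rule sum.reindex_bij_witness[of _ "\<lambda>(w, j, r). (j, w, r)" "\<lambda>(j, w, r). (w, j, r)"])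
          (auto simp: T_def)
      finally show ?thesis .
    qed
    moreover have "(\<Sum>i<n. sum (?g i j j) (T i j)) = 0" if "j < n" for j
    proof -
      have "(\<Sum>i<n. sum (?g i j j) (T i j)) = (\<Sum>(i, w, r)\<in>Sigma {..<n} (\<lambda>i. T i j). ?g i j j (w, r))"
        by (subst sum.Sigma) (auto simp: split_def)
      also have "\<dots> = 0"
        by (subst cancel_upper[OF that, of m, symmetric],
            rule sum.reindex_bij_witness[of _ "\<lambda>(w, i, r). (i, w, r)" "\<lambda>(i, w, r). (w, i, r)"])
          (auto simp: T_def)
      finally show ?thesis .
    qed
    ultimately show ?thesis by simp
  qed
  finally show ?thesis .
qed

section \<open>Invariants of unitary modules\<close>

text \<open>Elimination with a pivot \<open>p\<close> for the coordinate \<open>y\<close>. Applied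
  to the matrix entries of the powers of the Casimir operator, it supplies a polynomial that
  annihilates it.\<close>

lemma linear_dependence:
  fixes \<phi> :: "'j \<Rightarrow> 'x \<Rightarrow> real"
  assumes "finite A" "finite J" "card A < card J"
  shows "\<exists>a. (\<exists>j\<in>J. a j \<noteq> 0) \<and> (\<forall>x\<in>A. (\<Sum>j\<in>J. a j * \<phi> j x) = 0)"
  using assms
proof (induction A arbitrary: J \<phi>)
  case empty
  then have "J \<noteq> {}" by auto
  then show ?case by (intro exI[of _ "\<lambda>_. 1"]) auto
next
  case (insert y A)
  show ?case
  proof (cases "\<forall>j\<in>J. \<phi> j y = 0")
    case True
    have "card A < card J" using insert by simp
    then obtain a where "\<exists>j\<in>J. a j \<noteq> 0" "\<forall>x\<in>A. (\<Sum>j\<in>J. a j * \<phi> j x) = 0"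
      using insert.IH[OF insert.prems(1)] by blast
    then show ?thesis using True by (intro exI[of _ a]) auto
  next
    case False
    then obtain p where p: "p \<in> J" "\<phi> p y \<noteq> 0" by blast
    define J' where "J' = J - {p}"
    have J': "finite J'" "card A < card J'" "p \<notin> J'" "J = insert p J'"
      using insert p by (auto simp: J'_def)
    define \<psi> where "\<psi> = (\<lambda>j x. \<phi> j x - \<phi> j y / \<phi> p y * \<phi> p x)"
    obtain a where a: "\<exists>j\<in>J'. a j \<noteq> 0" "\<forall>x\<in>A. (\<Sum>j\<in>J'. a j * \<psi> j x) = 0"
      using insert.IH[OF J'(1,2), of \<psi>] by blast
    define c where "c = - (\<Sum>j\<in>J'. a j * \<phi> j y) / \<phi> p y"
    define a' where "a' = a(p := c)"
    have "(\<Sum>j\<in>J. a' j * \<phi> j x) = (\<Sum>j\<in>J'. a j * \<psi> j x)" for x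
    proof -
      have "(\<Sum>j\<in>J'. a' j * \<phi> j x) = (\<Sum>j\<in>J'. a j * \<phi> j x)"
        by (rule sum.cong) (use J' in \<open>auto simp: a'_def\<close>)
      then have "(\<Sum>j\<in>J. a' j * \<phi> j x) = c * \<phi> p x + (\<Sum>j\<in>J'. a j * \<phi> j x)"
        using J' by (simp add: a'_def)
      also have "\<dots> = (\<Sum>j\<in>J'. a j * \<psi> j x)"
      proof -
        have "(\<Sum>j\<in>J'. a j * \<psi> j x) = (\<Sum>j\<in>J'. a j * \<phi> j x) - (\<Sum>j\<in>J'. (a j * \<phi> j y) * (\<phi> p x / \<phi> p y))"
          by (simp add: \<psi>_def algebra_simps sum_subtractf)
        then show ?thesis unfolding sum_distrib_right[symmetric] by (simp add: c_def)
      qed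
      finally show ?thesis .
    qed
    moreover have "\<psi> j y = 0" for j using p by (simp add: \<psi>_def)
    moreover have "\<exists>j\<in>J. a' j \<noteq> 0" using a(1) J' by (auto simp: a'_def)
    ultimately show ?thesis using a(2) by (intro exI[of _ a']) auto
  qed
qed

lemmas ip_minus_right = linear_neg[OF linear_ip]

lemma ip_minus_left: "ip (- f) g = - ip f g"
  by (metis ip_commute ip_minus_right)

text \<open>A finite-dimensional \<open>gl_n\<close>-module with an orthonormal weight basis;
  \<open>adj\<close> is unitarity. The operators live on all polynomials, so their relations need no
  membership conditions, and only stability and weights refer to the span. The weights vanish from
  \<open>n\<close> on so that they can be compared with \<open>wshift w\<close> as
  functions.\<close>

locale unitary_module =
  fixes n :: nat and E :: "nat \<Rightarrow> nat \<Rightarrow> 'v mpol \<Rightarrow> 'v mpol"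
    and I :: "'i set" and b :: "'i \<Rightarrow> 'v mpol" and \<kappa> :: "'i \<Rightarrow> nat \<Rightarrow> int"
  assumes finI: "finite I" and onb: "orthonormal I b"
    and linE: "\<And>i j. i < n \<Longrightarrow> j < n \<Longrightarrow> linear (E i j)"
    and adj: "\<And>i j f g. i < n \<Longrightarrow> j < n \<Longrightarrow> ip (E i j f) g = ip f (E j i g)"
    and comm: "\<And>i j k l f. i < n \<Longrightarrow> j < n \<Longrightarrow> k < n \<Longrightarrow> l < n \<Longrightarrow>
      E i j (E k l f) - E k l (E i j f) = (if j = k then E i l f else 0) - (if l = i then E k j f else 0)"
    and stab: "\<And>i j f. i < n \<Longrightarrow> j < n \<Longrightarrow> f \<in> span (b ` I) \<Longrightarrow> E i j f \<in> span (b ` I)"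
    and wt: "\<And>i s. i < n \<Longrightarrow> s \<in> I \<Longrightarrow> E i i (b s) = real_of_int (\<kappa> s i) *\<^sub>R b s"
    and \<kappa>_zero: "\<And>i s. s \<in> I \<Longrightarrow> i \<ge> n \<Longrightarrow> \<kappa> s i = 0"
begin

definition Inv :: "'v mpol set" where
  "Inv = {f \<in> span (b ` I). \<forall>i<n. \<forall>j<n. E i j f = 0}"

definition casimir :: "'v mpol \<Rightarrow> 'v mpol" where
  "casimir f = (\<Sum>i<n. \<Sum>j<n. E i j (E j i f))"

lemma linear_casimir: "linear casimir"
proof -
  have "linear (\<lambda>f. E i j (E j i f))" if "i < n" "j < n" for i j
    using linear_compose[OF linE[OF that(2,1)] linE[OF that]] by (simp add: comp_def)
  then have "linear (\<lambda>f. \<Sum>i<n. \<Sum>j<n. E i j (E j i f))"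
    by (intro linear_compose_sum ballI) auto
  then show ?thesis by (simp add: casimir_def[abs_def])
qed

lemma casimir_adj: "ip (casimir f) g = ip f (casimir g)"
  by (simp add: casimir_def ip_sum_left ip_sum_right adj cong: sum.cong_simp)

text \<open>Bracketing with \<open>E k l\<close> acts on each of the two factors. The four resulting
  double sums collapse to two single sums, each of which occurs with both signs.\<close>

lemma casimir_comm:
  assumes k: "k < n" and l: "l < n"
  shows "E k l (casimir f) = casimir (E k l f)"
proof -
  have lin: "linear (E k l)" using linE assms by blast
  have "E k l (casimir f) - casimir (E k l f) = (\<Sum>i<n. \<Sum>j<n. E k l (E i j (E j i f)) - E i j (E j i (E k l f)))"
    by (simp add: casimir_def linear_sum[OF lin] sum_subtractf)
  also have "\<dots> = (\<Sum>i<n. \<Sum>j<n. ((if l = i then E k j (E j i f) else 0) - (if j = k then E i l (E j i f) else 0))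
        + ((if l = j then E i j (E k i f) else 0) - (if i = k then E i j (E j l f) else 0)))"
  proof (intro sum.cong refl)
    fix i j assume "i \<in> {..<n}" "j \<in> {..<n}"
    then have ij: "i < n" "j < n" by auto
    have 1: "E k l (E i j (E j i f)) - E i j (E k l (E j i f))
       = (if l = i then E k j (E j i f) else 0) - (if j = k then E i l (E j i f) else 0)"
      by (rule comm[OF k l ij])
    have "E i j (E k l (E j i f)) - E i j (E j i (E k l f)) = E i j (E k l (E j i f) - E j i (E k l f))"
      by (rule linear_diff[OF linE[OF ij], symmetric])
    also have "\<dots> = E i j ((if l = j then E k i f else 0) - (if i = k then E j l f else 0))"
      by (subst comm[OF k l ij(2,1)]) (rule refl)
    also have "\<dots> = (if l = j then E i j (E k i f) else 0) - (if i = k then E i j (E j l f) else 0)"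
      using linear_diff[OF linE[OF ij]] linear_0[OF linE[OF ij]] by auto
    finally have 2: "E i j (E k l (E j i f)) - E i j (E j i (E k l f))
      = (if l = j then E i j (E k i f) else 0) - (if i = k then E i j (E j l f) else 0)" .
    have "E k l (E i j (E j i f)) - E i j (E j i (E k l f))
      = (E k l (E i j (E j i f)) - E i j (E k l (E j i f))) + (E i j (E k l (E j i f)) - E i j (E j i (E k l f)))"
      by simp
    then show "E k l (E i j (E j i f)) - E i j (E j i (E k l f))
      = ((if l = i then E k j (E j i f) else 0) - (if j = k then E i l (E j i f) else 0))
        + ((if l = j then E i j (E k i f) else 0) - (if i = k then E i j (E j l f) else 0))"
      unfolding 1 2 .
  qed
  also have "\<dots> = 0"
  proof -
    have 1: "(\<Sum>i<n. \<Sum>j<n. (if l = i then E k j (E j i f) else 0)) = (\<Sum>j<n. E k j (E j l f))"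
      by (subst sum.swap) (use l in simp)
    have 2: "(\<Sum>i<n. \<Sum>j<n. (if j = k then E i l (E j i f) else 0)) = (\<Sum>i<n. E i l (E k i f))"
      using k by simp
    have 3: "(\<Sum>i<n. \<Sum>j<n. (if l = j then E i j (E k i f) else 0)) = (\<Sum>i<n. E i l (E k i f))"
      using l by simp
    have 4: "(\<Sum>i<n. \<Sum>j<n. (if i = k then E i j (E j l f) else 0)) = (\<Sum>j<n. E k j (E j l f))"
      by (subst sum.swap) (use k in simp)
    show ?thesis unfolding sum.distrib sum_subtractf 1 2 3 4 by simp
  qed
  finally show ?thesis by simp
qed

lemma stab_casimir: "f \<in> span (b ` I) \<Longrightarrow> casimir f \<in> span (b ` I)"
  unfolding casimir_def by (intro span_sum stab) auto

text \<open>Pairing \<open>casimir f\<close> with \<open>f\<close> gives the sum of the squared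
  norms of all \<open>E i j f\<close>, by unitarity.\<close>

lemma casimir_ker:
  assumes "casimir f = 0" "i < n" "j < n"
  shows "E i j f = 0"
proof -
  have "(\<Sum>j<n. \<Sum>i<n. ip (E i j f) (E i j f)) = ip f (casimir f)"
    by (simp add: casimir_def ip_sum_right adj cong: sum.cong_simp)
  also have "\<dots> = 0" using assms by simp
  finally have "(\<Sum>i<n. ip (E i j f) (E i j f)) = 0"
    using assms(3) by (subst (asm) sum_nonneg_eq_0_iff) (auto intro!: sum_nonneg ip_self_nonneg)
  then have "ip (E i j f) (E i j f) = 0"
    using assms(2) by (subst (asm) sum_nonneg_eq_0_iff) (auto intro!: ip_self_nonneg)
  then show ?thesis by (simp add: ip_self_eq_0)
qed

lemma power_linear: "linear (casimir ^^ r)"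
proof (induction r)
  case 0
  show ?case by (simp add: linear_iff)
next
  case (Suc r)
  then show ?case using linear_compose[OF Suc linear_casimir] by (simp add: comp_def)
qed

lemma power_adj: "ip ((casimir ^^ r) f) g = ip f ((casimir ^^ r) g)"
  by (induction r arbitrary: f g) (simp_all add: casimir_adj funpow_swap1)

lemma power_comm: "k < n \<Longrightarrow> l < n \<Longrightarrow> E k l ((casimir ^^ r) f) = (casimir ^^ r) (E k l f)"
  by (induction r) (simp_all add: casimir_comm)

lemma power_stab: "f \<in> span (b ` I) \<Longrightarrow> (casimir ^^ r) f \<in> span (b ` I)"
  by (induction r) (simp_all add: stab_casimir)

text \<open>A self-adjoint operator has no nilpotent part: one power can be moved to the other side
  of the inner product, which exhibits a vanishing norm.\<close>

lemma power_ker: "(casimir ^^ r) f = 0 \<Longrightarrow> casimir f = 0"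
proof (induction r)
  case 0
  then show ?case using linear_0[OF linear_casimir] by simp
next
  case (Suc r)
  show ?case
  proof (cases r)
    case 0
    then show ?thesis using Suc by simp
  next
    case (Suc q)
    have "ip ((casimir ^^ r) f) ((casimir ^^ r) f) = ip ((casimir ^^ q) f) ((casimir ^^ Suc r) f)"
      using casimir_adj by (simp add: Suc)
    also have "\<dots> = 0" using Suc.prems by simp
    finally show ?thesis using Suc.IH by (simp add: ip_self_eq_0)
  qed
qed

text \<open>Divide an annihilating polynomial of the Casimir operator by its lowest term. What
  results is a power of the operator times \<open>1 - casimir Z\<close>, with \<open>Z\<close> a
  polynomial in the operator, and \<open>power_ker\<close> reduces that power to the first. As such
  a polynomial, \<open>Z\<close> inherits linearity, self-adjointness, stability and the commutation
  with all \<open>E k l\<close>.\<close>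

lemma pseudo_inverse:
  obtains Z where "linear Z" "\<And>f g. ip (Z f) g = ip f (Z g)"
    "\<And>f. f \<in> span (b ` I) \<Longrightarrow> Z f \<in> span (b ` I)"
    "\<And>k l f. k < n \<Longrightarrow> l < n \<Longrightarrow> E k l (Z f) = Z (E k l f)"
    "\<And>f. f \<in> span (b ` I) \<Longrightarrow> casimir (f - casimir (Z f)) = 0"
proof -
  \<comment> \<open>The powers from 0 to \<open>N\<close> are one more than the matrix entries of an
    operator on the module, so they are linearly dependent there.\<close>
  define N where "N = card (I \<times> I)"
  obtain a where a: "\<exists>r\<in>{..N}. a r \<noteq> 0"
    "\<forall>x\<in>I \<times> I. (\<Sum>r\<le>N. a r * (case x of (s, t) \<Rightarrow> ip (b s) ((casimir ^^ r) (b t)))) = 0"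
    using linear_dependence[of "I \<times> I" "{..N}" "\<lambda>r (s, t). ip (b s) ((casimir ^^ r) (b t))"] finI
    by (auto simp: N_def)
  \<comment> \<open>The order of vanishing at zero of the annihilating polynomial.\<close>
  define r0 where "r0 = (LEAST r. r \<le> N \<and> a r \<noteq> 0)"
  have r0: "r0 \<le> N" "a r0 \<noteq> 0" "\<And>r. r < r0 \<Longrightarrow> a r = 0"
    using LeastI_ex[of "\<lambda>r. r \<le> N \<and> a r \<noteq> 0"] a(1) not_less_Least[of _ "\<lambda>r. r \<le> N \<and> a r \<noteq> 0"]
    unfolding r0_def[symmetric] by (auto, metis dual_order.trans nat_less_le)
  define p where "p = (\<lambda>f. \<Sum>r\<le>N. a r *\<^sub>R (casimir ^^ r) f)"
  have linp: "linear p" unfolding p_def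
    by (intro linear_compose_sum ballI linear_compose_scale_right power_linear)
  have p0: "p f = 0" if "f \<in> span (b ` I)" for f
  proof (rule linear_eq_0_on_span[OF linp _ that])
    fix x assume "x \<in> b ` I"
    then obtain t where t: "t \<in> I" "x = b t" by blast
    have "p x \<in> span (b ` I)" unfolding p_def
      using t by (intro span_sum span_scale power_stab) (auto intro: span_base)
    moreover have "ip (b s) (p x) = 0" if "s \<in> I" for s
      using a(2) t that by (force simp: p_def ip_sum_right ip_scale_right)
    ultimately show "p x = 0" using parseval[OF finI onb, of "p x"] by simp
  qed
  define Z where "Z = (\<lambda>f. (- 1 / a r0) *\<^sub>R (\<Sum>r\<in>{r0<..N}. a r *\<^sub>R (casimir ^^ (r - r0 - 1)) f))"
  have lin: "linear Z" unfolding Z_def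
    by (intro linear_compose_sum ballI linear_compose_scale_right power_linear)
  moreover have "ip (Z f) g = ip f (Z g)" for f g
    by (simp add: Z_def ip_minus_left ip_minus_right ip_scale_left ip_scale_right ip_sum_left ip_sum_right power_adj)
  moreover have "Z f \<in> span (b ` I)" if "f \<in> span (b ` I)" for f
    unfolding Z_def using that by (intro span_sum span_scale power_stab)
  moreover have "E k l (Z f) = Z (E k l f)" if "k < n" "l < n" for k l f
    unfolding Z_def
    by (simp add: linear_scale[OF linE] linear_neg[OF linE] linear_sum[OF linE] that power_comm)
  moreover have "casimir (f - casimir (Z f)) = 0" if f: "f \<in> span (b ` I)" for f
  proof -
    have "casimir (Z f) = (- 1 / a r0) *\<^sub>R (\<Sum>r\<in>{r0<..N}. a r *\<^sub>R (casimir ^^ (r - r0)) f)"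
    proof -
      have "casimir ((casimir ^^ (r - r0 - 1)) f) = (casimir ^^ (r - r0)) f" if "r \<in> {r0<..N}" for r
        using that by (metis Suc_diff_Suc comp_apply diff_Suc_1 diff_diff_left funpow.simps(2) greaterThanAtMost_iff plus_1_eq_Suc add.commute)
      then show ?thesis unfolding Z_def
        by (simp add: linear_scale[OF linear_casimir] linear_neg[OF linear_casimir] linear_sum[OF linear_casimir] del: funpow.simps)
    qed
    then have "a r0 *\<^sub>R (f - casimir (Z f)) = a r0 *\<^sub>R f + (\<Sum>r\<in>{r0<..N}. a r *\<^sub>R (casimir ^^ (r - r0)) f)"
      using r0(2) by (simp add: scaleR_right_distrib)
    also have "\<dots> = (\<Sum>r\<in>{r0..N}. a r *\<^sub>R (casimir ^^ (r - r0)) f)"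
      using r0(1) by (subst atLeastAtMost_insertL[symmetric]) (simp_all add: sum.head atLeastSucAtMost_greaterThanAtMost)
    finally have B: "a r0 *\<^sub>R (f - casimir (Z f)) = (\<Sum>r\<in>{r0..N}. a r *\<^sub>R (casimir ^^ (r - r0)) f)" .
    have "(casimir ^^ r0) (a r0 *\<^sub>R (f - casimir (Z f))) = (\<Sum>r\<in>{r0..N}. a r *\<^sub>R (casimir ^^ r) f)"
      unfolding B linear_sum[OF power_linear] linear_scale[OF power_linear]
    proof (rule sum.cong[OF refl])
      fix r assume "r \<in> {r0..N}"
      then have "(casimir ^^ r0) ((casimir ^^ (r - r0)) f) = (casimir ^^ r) f"
        by (metis atLeastAtMost_iff comp_apply funpow_add le_add_diff_inverse)
      then show "a r *\<^sub>R (casimir ^^ r0) ((casimir ^^ (r - r0)) f) = a r *\<^sub>R (casimir ^^ r) f" by simp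
    qed
    also have "\<dots> = p f"
      unfolding p_def by (rule sum.mono_neutral_left) (use r0(3) in auto)
    finally have "casimir (a r0 *\<^sub>R (f - casimir (Z f))) = 0"
      using p0[OF f] power_ker by simp
    then show ?thesis using r0(2) by (simp add: linear_scale[OF linear_casimir])
  qed
  ultimately show ?thesis using that by blast
qed

text \<open>Evaluate the bracket of \<open>E k k\<close> and \<open>E j i\<close> between two weight
  vectors: a nonzero entry of \<open>E j i\<close> forces the two weights to differ by one
  root.\<close>

lemma weight_shift:
  assumes "s \<in> I" "u \<in> I" "i < n" "j < n" "i \<noteq> j" "ip (b u) (E j i (b s)) \<noteq> 0"
  shows "\<kappa> u = move i j (-1) (\<kappa> s)"
proof
  fix k
  show "\<kappa> u k = move i j (-1) (\<kappa> s) k"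
  proof (cases "k < n")
    case True
    have "E k k (E j i (b s)) - E j i (E k k (b s)) = (if k = j then E k i (b s) else 0) - (if i = k then E j k (b s) else 0)"
      using comm[OF True True assms(4,3)] by simp
    then have "E k k (E j i (b s)) = real_of_int (move i j (-1) (\<kappa> s) k) *\<^sub>R E j i (b s)"
      using wt[OF True assms(1)] linear_scale[OF linE[OF assms(4,3)]] assms(5)
      by (auto simp: move_def algebra_simps split: if_splits)
    moreover have "ip (b u) (E k k (E j i (b s))) = real_of_int (\<kappa> u k) * ip (b u) (E j i (b s))"
      using wt[OF True assms(2)] adj[OF True True, of "b u"] by (simp add: ip_scale_left)
    ultimately show ?thesis using assms(6) by (simp add: ip_scale_right)
  next
    case False
    then show ?thesis using \<kappa>_zero assms by (simp add: move_def)
  qed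
qed

lemma subspace_Inv: "subspace Inv"
proof -
  have "linear (E i j)" if "i < n" "j < n" for i j using linE that by blast
  then show ?thesis
    unfolding subspace_def Inv_def
    by (auto simp: span_zero span_add span_scale linear_0 linear_add linear_scale)
qed

text \<open>A trace may be computed in any orthonormal basis: inserting an orthonormal basis of the
  invariants and exchanging the sums counts its elements.\<close>

lemma trace_projection:
  assumes Q: "\<And>f. f \<in> span (b ` I) \<Longrightarrow> Q f \<in> Inv" "\<And>f. f \<in> Inv \<Longrightarrow> Q f = f"
    and Qadj: "\<And>f g. ip (Q f) g = ip f (Q g)"
  shows "(\<Sum>s\<in>I. ip (b s) (Q (b s))) = real (dim Inv)"
proof -
  obtain B where B: "B \<subseteq> Inv" "independent B" "Inv \<subseteq> span B" "card B = dim Inv"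
    using basis_exists[of Inv] by blast
  have "B \<subseteq> span (b ` I)" using B(1) by (auto simp: Inv_def)
  then have finB: "finite B" using independent_span_bound[of "b ` I" B] finI B(2) by auto
  \<comment> \<open>With a single grade \<open>gram_schmidt\<close> is the ungraded
    procedure.\<close>
  have "\<exists>k. orthonormal B k \<and> (\<forall>x\<in>B. k x \<in> (\<lambda>_. UNIV) () \<and> k x \<in> span ((\<lambda>x. x) ` B) \<and> x \<in> span (k ` B))"
  proof (rule gram_schmidt[where \<kappa> = "\<lambda>_. ()"])
    fix c assume "(\<Sum>i\<in>B. c i *\<^sub>R i) = 0"
    then show "\<forall>i\<in>B. c i = 0" using B(2) finB by (metis independentD subset_refl)
  qed (use finB in auto)
  then obtain k where k: "orthonormal B k" "\<And>x. x \<in> B \<Longrightarrow> k x \<in> span B" "\<And>x. x \<in> B \<Longrightarrow> x \<in> span (k ` B)"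
    by auto
  have "span B \<subseteq> Inv" using B(1) subspace_Inv by (simp add: span_minimal)
  then have kInv: "k x \<in> Inv" if "x \<in> B" for x using k(2) that by blast
  have "B \<subseteq> span (k ` B)" using k(3) by blast
  then have Ik: "Inv \<subseteq> span (k ` B)" using B(3) by (meson span_minimal subspace_span subset_trans)
  have "(\<Sum>s\<in>I. ip (b s) (Q (b s))) = (\<Sum>s\<in>I. \<Sum>x\<in>B. ip (b s) (k x) * ip (k x) (b s))"
  proof (rule sum.cong[OF refl])
    fix s assume "s \<in> I"
    then have "Q (b s) \<in> span (k ` B)" using Q(1) Ik by (meson image_eqI span_base subsetD)
    then have "ip (b s) (Q (b s)) = (\<Sum>x\<in>B. ip (b s) (k x) * ip (k x) (Q (b s)))"
      by (rule parseval_ip[OF finB k(1)])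
    also have "\<dots> = (\<Sum>x\<in>B. ip (b s) (k x) * ip (k x) (b s))"
      using Q(2) kInv Qadj by (intro sum.cong refl) metis
    finally show "ip (b s) (Q (b s)) = (\<Sum>x\<in>B. ip (b s) (k x) * ip (k x) (b s))" .
  qed
  also have "\<dots> = (\<Sum>x\<in>B. \<Sum>s\<in>I. ip (k x) (b s) * ip (b s) (k x))"
    by (subst sum.swap) (simp add: mult.commute)
  also have "\<dots> = (\<Sum>x\<in>B. ip (k x) (k x))"
    by (intro sum.cong refl parseval_ip[OF finI onb, symmetric]) (use kInv in \<open>auto simp: Inv_def\<close>)
  also have "\<dots> = real (card B)" using k(1) by (simp add: orthonormal_def)
  finally show ?thesis using B(4) by simp
qed

text \<open>The complement of the invariants is written as a sum of images of the operators
  \<open>E i j\<close>, since this form survives multiplication by an invariant. It is visible from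
  \<open>casimir (Z f)\<close>.\<close>

theorem reynolds:
  assumes "f \<in> span (b ` I)"
  obtains q u where "q \<in> Inv" "\<And>i j. i < n \<Longrightarrow> j < n \<Longrightarrow> u i j \<in> span (b ` I)"
    "f = q + (\<Sum>i<n. \<Sum>j<n. E i j (u i j))"
proof -
  obtain Z where Z: "\<And>f. f \<in> span (b ` I) \<Longrightarrow> Z f \<in> span (b ` I)"
    "\<And>f. f \<in> span (b ` I) \<Longrightarrow> casimir (f - casimir (Z f)) = 0"
    using pseudo_inverse by metis
  show ?thesis
  proof (rule that[of "f - casimir (Z f)" "\<lambda>i j. E j i (Z f)"])
    show "f - casimir (Z f) \<in> Inv"
      unfolding Inv_def using assms Z casimir_ker by (auto intro!: span_diff stab_casimir)
  qed (use assms Z stab in \<open>auto simp: casimir_def\<close>)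
qed

text \<open>The multiplicity of a weight splits into the trace of the projection \<open>Q\<close>
  and the trace of \<open>casimir\<close> composed with \<open>Z\<close> on that weight space. The
  first is concentrated in weight zero; the second disappears in the alternating sum.\<close>

theorem dim_Inv:
  "real (dim Inv) = (\<Sum>w | w permutes {..<n}. real_of_int (sign w) * real (card {s \<in> I. \<kappa> s = wshift w}))"
proof -
  obtain Z where Z: "linear Z" "\<And>f g. ip (Z f) g = ip f (Z g)"
    "\<And>f. f \<in> span (b ` I) \<Longrightarrow> Z f \<in> span (b ` I)"
    "\<And>k l f. k < n \<Longrightarrow> l < n \<Longrightarrow> E k l (Z f) = Z (E k l f)"
    "\<And>f. f \<in> span (b ` I) \<Longrightarrow> casimir (f - casimir (Z f)) = 0"
    using pseudo_inverse by metis
  have Zcas: "casimir (Z f) = Z (casimir f)" for f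
    unfolding casimir_def by (simp add: linear_sum[OF Z(1)] Z(4) cong: sum.cong_simp)
  have bs: "b s \<in> span (b ` I)" if "s \<in> I" for s using that by (auto intro: span_base)
  define Q where "Q = (\<lambda>f. f - casimir (Z f))"
  have QInv: "Q f \<in> Inv" if "f \<in> span (b ` I)" for f
    unfolding Inv_def Q_def using that Z casimir_ker by (auto intro!: span_diff stab_casimir)
  have Qfix: "Q f = f" if "f \<in> Inv" for f
  proof -
    have "casimir f = 0" using that linear_0[OF linE] unfolding casimir_def Inv_def by simp
    then show ?thesis by (simp add: Q_def Zcas linear_0[OF Z(1)])
  qed
  have Qadj: "ip (Q f) g = ip f (Q g)" for f g
    by (simp add: Q_def ip_diff_left ip_diff_right casimir_adj Z(2) Zcas)
  \<comment> \<open>All traces are taken over one weight space at a time.\<close>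
  define t where "t = (\<lambda>i j \<xi>. \<Sum>s\<in>{s\<in>I. \<kappa> s = \<xi>}. ip (b s) (Z (E i j (E j i (b s)))))"
  define m where "m = (\<lambda>\<xi>. \<Sum>s\<in>{s\<in>I. \<kappa> s = \<xi>}. ip (b s) (Z (b s)))"
  define q where "q = (\<lambda>\<xi>. \<Sum>s\<in>{s\<in>I. \<kappa> s = \<xi>}. ip (b s) (Q (b s)))"
  have id0: "(\<Sum>w | w permutes {..<n}. real_of_int (sign w) * (\<Sum>i<n. \<Sum>j<n. t i j (wshift w))) = 0"
  proof (rule alternating_identity[where m = m])
    fix i j \<xi> assume ij: "i < n" "j < n" "i \<noteq> j"
    show "t i j \<xi> - t j i \<xi> = real_of_int (\<xi> i - \<xi> j) * m \<xi>"
      unfolding t_def m_def sum_subtractf[symmetric] sum_distrib_left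
    proof (intro sum.cong refl)
      fix s assume s: "s \<in> {s \<in> I. \<kappa> s = \<xi>}"
      have "E i j (E j i (b s)) - E j i (E i j (b s)) = E i i (b s) - E j j (b s)"
        using comm[OF ij(1,2,2,1), of "b s"] by simp
      also have "\<dots> = real_of_int (\<xi> i - \<xi> j) *\<^sub>R b s"
        using wt[OF ij(1)] wt[OF ij(2)] s by (simp add: scaleR_diff_left)
      finally have "Z (E i j (E j i (b s))) - Z (E j i (E i j (b s))) = real_of_int (\<xi> i - \<xi> j) *\<^sub>R Z (b s)"
        by (metis linear_diff[OF Z(1)] linear_scale[OF Z(1)])
      then show "ip (b s) (Z (E i j (E j i (b s)))) - ip (b s) (Z (E j i (E i j (b s)))) = real_of_int (\<xi> i - \<xi> j) * ip (b s) (Z (b s))"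
        by (metis ip_diff_right ip_scale_right)
    qed
    \<comment> \<open>Cyclicity: \<open>E j i\<close> maps the weight space of \<open>\<xi>\<close>
      to the one of the translated weight and \<open>E i j\<close> maps back, so the same double sum
      over both bases computes either trace.\<close>
    show "t i j \<xi> = t j i (move i j (-1) \<xi>)"
    proof -
      let ?\<xi> = "move i j (-1) \<xi>"
      have "t i j \<xi> = (\<Sum>s\<in>{s\<in>I. \<kappa> s = \<xi>}. \<Sum>u\<in>{u\<in>I. \<kappa> u = ?\<xi>}. ip (E i j (b u)) (b s) * ip (b s) (Z (E i j (b u))))"
        unfolding t_def
      proof (intro sum.cong refl)
        fix s assume s: "s \<in> {s \<in> I. \<kappa> s = \<xi>}"
        have "ip (b s) (Z (E i j (E j i (b s)))) = ip (E j i (Z (b s))) (E j i (b s))"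
          using ij by (simp add: Z(2) adj)
        also have "\<dots> = (\<Sum>u\<in>I. ip (E j i (Z (b s))) (b u) * ip (b u) (E j i (b s)))"
          using s ij stab bs by (intro parseval_ip[OF finI onb]) auto
        also have "\<dots> = (\<Sum>u\<in>I. ip (E i j (b u)) (b s) * ip (b s) (Z (E i j (b u))))"
          using ij by (simp add: adj Z(2) mult.commute)
        also have "\<dots> = (\<Sum>u\<in>{u\<in>I. \<kappa> u = ?\<xi>}. ip (E i j (b u)) (b s) * ip (b s) (Z (E i j (b u))))"
          by (rule sum.mono_neutral_right)
            (use finI s ij weight_shift[of s _ i j] in \<open>auto simp: adj\<close>)
        finally show "ip (b s) (Z (E i j (E j i (b s)))) = (\<Sum>u\<in>{u\<in>I. \<kappa> u = ?\<xi>}. ip (E i j (b u)) (b s) * ip (b s) (Z (E i j (b u))))" .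
      qed
      also have "\<dots> = (\<Sum>u\<in>{u\<in>I. \<kappa> u = ?\<xi>}. \<Sum>s\<in>{s\<in>I. \<kappa> s = \<xi>}. ip (E i j (b u)) (b s) * ip (b s) (Z (E i j (b u))))"
        by (rule sum.swap)
      also have "\<dots> = t j i ?\<xi>"
        unfolding t_def
      proof (intro sum.cong refl)
        fix u assume u: "u \<in> {u \<in> I. \<kappa> u = ?\<xi>}"
        have "(\<Sum>s\<in>{s\<in>I. \<kappa> s = \<xi>}. ip (E i j (b u)) (b s) * ip (b s) (Z (E i j (b u))))
          = (\<Sum>s\<in>I. ip (E i j (b u)) (b s) * ip (b s) (Z (E i j (b u))))"
        proof (rule sum.mono_neutral_left)
          show "\<forall>s\<in>I - {s \<in> I. \<kappa> s = \<xi>}. ip (E i j (b u)) (b s) * ip (b s) (Z (E i j (b u))) = 0"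
          proof
            fix s assume s: "s \<in> I - {s \<in> I. \<kappa> s = \<xi>}"
            have "ip (b u) (E j i (b s)) = 0"
            proof (rule ccontr)
              assume "ip (b u) (E j i (b s)) \<noteq> 0"
              then have "move i j (-1) \<xi> = move i j (-1) (\<kappa> s)"
                using weight_shift[of s u i j] s u ij by auto
              then have "move i j 1 (move i j (-1) \<xi>) = move i j 1 (move i j (-1) (\<kappa> s))" by simp
              then show False using s by (simp add: move_move)
            qed
            then show "ip (E i j (b u)) (b s) * ip (b s) (Z (E i j (b u))) = 0" using ij by (simp add: adj)
          qed
        qed (use finI in auto)
        also have "\<dots> = ip (E i j (b u)) (Z (E i j (b u)))"
          using u ij stab bs Z(3) by (intro parseval_ip[OF finI onb, symmetric]) auto
        also have "\<dots> = ip (b u) (Z (E j i (E i j (b u))))" using ij by (simp add: adj Z(4))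
        finally show "(\<Sum>s\<in>{s\<in>I. \<kappa> s = \<xi>}. ip (E i j (b u)) (b s) * ip (b s) (Z (E i j (b u)))) = ip (b u) (Z (E j i (E i j (b u))))" .
      qed
      finally show ?thesis .
    qed
  next
    fix i \<xi> assume i: "i < n"
    show "t i i \<xi> = real_of_int ((\<xi> i)\<^sup>2) * m \<xi>"
      unfolding t_def m_def sum_distrib_left
      by (intro sum.cong refl)
        (auto simp: wt i linear_scale[OF linE] linear_scale[OF Z(1)] ip_scale_right power2_eq_square)
  qed
  \<comment> \<open>Invariants have weight zero, so they are orthogonal to basis vectors of any
    other weight.\<close>
  have q0: "q \<xi> = 0" if "\<xi> \<noteq> (\<lambda>_. 0)" for \<xi>
    unfolding q_def
  proof (rule sum.neutral, rule ballI)
    fix s assume s: "s \<in> {s \<in> I. \<kappa> s = \<xi>}"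
    from that obtain k where k: "\<xi> k \<noteq> 0" by (auto simp: fun_eq_iff)
    then have kn: "k < n" using \<kappa>_zero[of s k] s by (cases "k < n") auto
    have "real_of_int (\<xi> k) * ip (b s) (Q (b s)) = ip (E k k (b s)) (Q (b s))"
      using wt[OF kn] s by (simp add: ip_scale_left)
    also have "\<dots> = ip (b s) (E k k (Q (b s)))" using kn by (simp add: adj)
    also have "E k k (Q (b s)) = 0" using QInv[of "b s"] s bs kn by (auto simp: Inv_def)
    finally show "ip (b s) (Q (b s)) = 0" using k by simp
  qed
  have "real (card {s \<in> I. \<kappa> s = \<xi>}) = q \<xi> + (\<Sum>i<n. \<Sum>j<n. t i j \<xi>)" for \<xi>
  proof -
    have "(\<Sum>i<n. \<Sum>j<n. t i j \<xi>) = (\<Sum>s\<in>{s\<in>I. \<kappa> s = \<xi>}. ip (b s) (Z (casimir (b s))))"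
      unfolding t_def casimir_def
      by (simp add: linear_sum[OF Z(1)] ip_sum_right sum.swap[of _ _ "{s\<in>I. \<kappa> s = \<xi>}"])
    moreover have "real (card {s \<in> I. \<kappa> s = \<xi>}) = (\<Sum>s\<in>{s\<in>I. \<kappa> s = \<xi>}. ip (b s) (b s))"
      using onb by (simp add: orthonormal_def)
    ultimately show ?thesis
      by (simp add: q_def Q_def ip_diff_right sum_subtractf Zcas)
  qed
  then have "(\<Sum>w | w permutes {..<n}. real_of_int (sign w) * real (card {s \<in> I. \<kappa> s = wshift w}))
     = (\<Sum>w | w permutes {..<n}. real_of_int (sign w) * q (wshift w))"
    using id0 by (simp add: distrib_left sum.distrib)
  also have "\<dots> = (\<Sum>w\<in>{id}. real_of_int (sign w) * q (wshift w))"
  proof (rule sum.mono_neutral_right)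
    show "\<forall>w\<in>{w. w permutes {..<n}} - {id}. real_of_int (sign w) * q (wshift w) = 0"
    proof
      fix w :: "nat \<Rightarrow> nat" assume "w \<in> {w. w permutes {..<n}} - {id}"
      then have "wshift w \<noteq> (\<lambda>_. 0)" by (auto simp: wshift_def fun_eq_iff)
      then show "real_of_int (sign w) * q (wshift w) = 0" using q0 by simp
    qed
  qed (auto simp: permutes_id)
  also have "\<dots> = q (\<lambda>_. 0)" by (simp add: wshift_def sign_id)
  also have "\<dots> = (\<Sum>s\<in>I. ip (b s) (Q (b s)))"
  proof -
    have "ip (b s) (Q (b s)) = 0" if "s \<in> I" "\<kappa> s \<noteq> (\<lambda>_. 0)" for s
    proof -
      from that(2) obtain k where k: "\<kappa> s k \<noteq> 0" by (auto simp: fun_eq_iff)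
      then have kn: "k < n" using \<kappa>_zero[of s k] that(1) by (cases "k < n") auto
      have "real_of_int (\<kappa> s k) * ip (b s) (Q (b s)) = ip (b s) (E k k (Q (b s)))"
        using wt[OF kn that(1)] adj[OF kn kn, of "b s"] by (simp add: ip_scale_left)
      also have "E k k (Q (b s)) = 0" using QInv[of "b s"] that bs kn by (auto simp: Inv_def)
      finally show ?thesis using k by simp
    qed
    then show ?thesis unfolding q_def by (intro sum.mono_neutral_left) (use finI in auto)
  qed
  also have "\<dots> = real (dim Inv)" by (rule trace_projection[OF QInv Qfix Qadj])
  finally show ?thesis by simp
qed

end

section \<open>Highest weight polynomials of a matrix of variables\<close>

text \<open>Variables are pairs (column, row), so that the lexicographic order compares columns first.\<close>

type_synonym vpol = "(nat \<times> nat) mpol"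

text \<open>The number \<open>C\<close> of columns is a parameter because the analysis of leading
  monomials freezes the last columns one by one and works with the operator on the remaining
  ones.\<close>

definition raise :: "nat \<Rightarrow> nat \<Rightarrow> vpol \<Rightarrow> vpol" where
  "raise C a f = (\<Sum>c<C. X (c, a) * pd (c, Suc a) f)"

definition lower :: "nat \<Rightarrow> nat \<Rightarrow> vpol \<Rightarrow> vpol" where
  "lower C a f = (\<Sum>c<C. X (c, Suc a) * pd (c, a) f)"

text \<open>For a tableau with content matrix \<open>t\<close>, the number of entries below
  \<open>C\<close> in row \<open>r\<close>.\<close>

definition cs :: "nat \<Rightarrow> nat \<Rightarrow> (nat \<times> nat \<Rightarrow>\<^sub>0 nat) \<Rightarrow> nat" where
  "cs C r t = (\<Sum>c<C. lookup t (c, r))"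

lemma derivation_raise: "derivation (raise C a)"
  unfolding raise_def[abs_def]
  by (intro derivation_sum derivation_mult_left derivation_pd)

lemma derivation_lower: "derivation (lower C a)"
  unfolding lower_def[abs_def]
  by (intro derivation_sum derivation_mult_left derivation_pd)

lemmas linear_raise = derivation_linear[OF derivation_raise]
  and linear_lower = derivation_linear[OF derivation_lower]

lemma raise_X: "raise C a (X (c, r)) = (if r = Suc a \<and> c < C then X (c, a) else 0)"
  by (auto simp: raise_def pd_X if_distrib[of "\<lambda>x. _ * x"] cong: if_cong)

lemma lower_X: "lower C a (X (c, r)) = (if r = a \<and> c < C then X (c, Suc a) else 0)"
  by (auto simp: lower_def pd_X if_distrib[of "\<lambda>x. _ * x"] cong: if_cong)

lemma raise_lower_adjoint: "ip (raise C a f) g = ip f (lower C a g)"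
  by (simp add: raise_def lower_def ip_sum_left ip_sum_right ip_X_pd_adjoint)

lemma raise_lower_commute:
  "raise C a (lower C a f) - lower C a (raise C a f)
    = (\<Sum>c<C. X (c, a) * pd (c, a) f - X (c, Suc a) * pd (c, Suc a) f)"
proof (rule derivation_ext[where D = "\<lambda>f. raise C a (lower C a f) - lower C a (raise C a f)"
      and D' = "\<lambda>f. \<Sum>c<C. X (c, a) * pd (c, a) f - X (c, Suc a) * pd (c, Suc a) f"])
  show "derivation (\<lambda>f. raise C a (lower C a f) - lower C a (raise C a f))"
    by (intro derivation_commutator derivation_raise derivation_lower)
  show "derivation (\<lambda>f. \<Sum>c<C. X (c, a) * pd (c, a) f - X (c, Suc a) * pd (c, Suc a) f)"
    by (intro derivation_sum derivation_diff derivation_mult_left derivation_pd)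
  fix v :: "nat \<times> nat"
  obtain c r where v: "v = (c, r)" by (cases v)
  have "(\<Sum>d<C. X (d, a) * pd (d, a) (X (c, r))) = (if r = a \<and> c < C then X (c, a) else 0)"
    by (auto simp: pd_X if_distrib[of "\<lambda>x. _ * x"] cong: if_cong)
  moreover have "(\<Sum>d<C. X (d, Suc a) * pd (d, Suc a) (X (c, r))) = (if r = Suc a \<and> c < C then X (c, Suc a) else 0)"
    by (auto simp: pd_X if_distrib[of "\<lambda>x. _ * x"] cong: if_cong)
  ultimately show "raise C a (lower C a (X v)) - lower C a (raise C a (X v))
     = (\<Sum>c<C. X (c, a) * pd (c, a) (X v) - X (c, Suc a) * pd (c, Suc a) (X v))"
    unfolding v sum_subtractf
    by (auto simp: raise_X lower_X linear_0[OF linear_raise] linear_0[OF linear_lower])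
qed

definition balanced :: "nat \<Rightarrow> nat \<Rightarrow> int \<Rightarrow> vpol \<Rightarrow> bool" where
  "balanced C a k f \<longleftrightarrow> (\<forall>t\<in>keys f. int (cs C a t) - int (cs C (Suc a) t) = k)"

lemma cs_move:
  assumes "lookup s (c, r) > 0"
  shows "int (cs C q (s - single (c, r) 1 + single (d, p) 1))
    = int (cs C q s) - (if r = q \<and> c < C then 1 else 0) + (if p = q \<and> d < C then 1 else 0)"
proof -
  have "int (lookup (s - single (c, r) 1 + single (d, p) 1) (x, q))
      = int (lookup s (x, q)) - (if x = c then if r = q then 1 else 0 else 0) + (if x = d then if p = q then 1 else 0 else 0)" for x
    using assms by (auto simp: lookup_add lookup_minus lookup_single when_def)
  then show ?thesis by (simp add: cs_def sum.distrib sum_subtractf)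
qed

lemma keys_lower: "s \<in> keys (lower C a f) \<Longrightarrow> \<exists>c<C. s \<in> keys (X (c, Suc a) * pd (c, a) f)"
  using keys_sum[of "\<lambda>c. X (c, Suc a) * pd (c, a) f" "{..<C}"] by (auto simp: lower_def)

lemma balanced_lower: "balanced C a k f \<Longrightarrow> balanced C a (k - 2) (lower C a f)"
  unfolding balanced_def
proof
  fix t assume f: "\<forall>t\<in>keys f. int (cs C a t) - int (cs C (Suc a) t) = k" and t: "t \<in> keys (lower C a f)"
  from keys_lower[OF t] obtain c where c: "c < C" "t \<in> keys (X (c, Suc a) * pd (c, a) f)" by blast
  then obtain s where s: "s \<in> keys f" "lookup s (c, a) > 0" "t = s - single (c, a) 1 + single (c, Suc a) 1"
    by (elim keys_X_pd)
  show "int (cs C a t) - int (cs C (Suc a) t) = k - 2"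
    unfolding s(3) cs_move[OF s(2)] using f s(1) c(1) by simp
qed

lemma balanced_eigen:
  assumes "balanced C a k f"
  shows "raise C a (lower C a f) - lower C a (raise C a f) = real_of_int k *\<^sub>R f"
  unfolding raise_lower_commute
proof (rule poly_mapping_eqI)
  fix t
  have "lookup (\<Sum>c<C. X (c, a) * pd (c, a) f - X (c, Suc a) * pd (c, Suc a) f) t
      = (real (cs C a t) - real (cs C (Suc a) t)) * lookup f t"
    by (simp add: lookup_sum lookup_minus lookup_X_pd_same cs_def sum_subtractf left_diff_distrib sum_distrib_right)
  also have "\<dots> = real_of_int k * lookup f t"
  proof (cases "t \<in> keys f")
    case True
    then have "real (cs C a t) - real (cs C (Suc a) t) = real_of_int k"
      using assms unfolding balanced_def by (metis of_int_diff of_int_of_nat_eq)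
    then show ?thesis by simp
  qed (simp add: in_keys_iff)
  finally show "lookup (\<Sum>c<C. X (c, a) * pd (c, a) f - X (c, Suc a) * pd (c, Suc a) f) t
     = lookup (real_of_int k *\<^sub>R f) t" by simp
qed

text \<open>The representation theory of \<open>sl_2\<close> through norms. For a highest weight
  vector of weight \<open>h\<close>, each lowering step from level \<open>j\<close> multiplies the
  squared norm by \<open>(j + 1) * (h - j)\<close>. Nonnegativity at the first step gives
  \<open>h \<ge> 0\<close>, and the factor vanishes at \<open>j = h\<close>.\<close>

lemma lower_string:
  assumes "raise C a g = 0" "balanced C a h g" "g \<noteq> 0"
  shows "h \<ge> 0" and "(lower C a ^^ Suc (nat h)) g = 0"
proof -
  let ?L = "lower C a"
  have bal: "balanced C a (h - 2 * int j) ((?L ^^ j) g)" for j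
  proof (induction j)
    case (Suc j)
    from balanced_lower[OF this] show ?case by (simp add: algebra_simps)
  qed (use assms in simp)
  have rj: "raise C a ((?L ^^ Suc j) g) = (real (Suc j) * real_of_int (h - int j)) *\<^sub>R (?L ^^ j) g" for j
  proof (induction j)
    case 0
    show ?case using balanced_eigen[OF bal[of 0]] assms(1) linear_0[OF linear_lower] by simp
  next
    case (Suc j)
    have "raise C a ((?L ^^ Suc (Suc j)) g) = ?L (raise C a ((?L ^^ Suc j) g)) + real_of_int (h - 2 * int (Suc j)) *\<^sub>R (?L ^^ Suc j) g"
      using balanced_eigen[OF bal[of "Suc j"]] by (simp add: algebra_simps)
    also have "?L (raise C a ((?L ^^ Suc j) g)) = (real (Suc j) * real_of_int (h - int j)) *\<^sub>R (?L ^^ Suc j) g"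
      unfolding Suc linear_scale[OF linear_lower] by simp
    also have "\<dots> + real_of_int (h - 2 * int (Suc j)) *\<^sub>R (?L ^^ Suc j) g
       = (real (Suc (Suc j)) * real_of_int (h - int (Suc j))) *\<^sub>R (?L ^^ Suc j) g"
      unfolding scaleR_add_left[symmetric] by (simp add: algebra_simps)
    finally show ?case .
  qed
  have norm: "ip ((?L ^^ Suc j) g) ((?L ^^ Suc j) g) = real (Suc j) * real_of_int (h - int j) * ip ((?L ^^ j) g) ((?L ^^ j) g)" for j
  proof -
    have "ip ((?L ^^ Suc j) g) ((?L ^^ Suc j) g) = ip (raise C a ((?L ^^ Suc j) g)) ((?L ^^ j) g)"
      by (simp add: raise_lower_adjoint)
    then show ?thesis unfolding rj by (simp add: ip_scale_left)
  qed
  show h: "h \<ge> 0"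
  proof (rule ccontr)
    assume "\<not> 0 \<le> h"
    then have "real_of_int h < 0" by simp
    moreover have "ip g g > 0" using assms(3) ip_self_nonneg[of g] ip_self_eq_0[of g] by linarith
    ultimately have "real_of_int h * ip g g < 0" by (rule mult_neg_pos)
    then show False using norm[of 0] ip_self_nonneg[of "?L g"] by simp
  qed
  have "ip ((?L ^^ Suc (nat h)) g) ((?L ^^ Suc (nat h)) g) = 0"
    unfolding norm using h by simp
  then show "(?L ^^ Suc (nat h)) g = 0" by (simp add: ip_self_eq_0)
qed

lemma lookup_X_pd:
  assumes "u \<noteq> v"
  shows "lookup (X u * pd v f) s = (if lookup s u = 0 then 0 else (real (lookup s v) + 1) * lookup f (s - single u 1 + single v 1))"
  using assms by (simp add: lookup_X_mult lookup_pd lookup_minus lookup_single when_def)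

section \<open>Interlacing of leading monomials\<close>

definition agree :: "nat \<Rightarrow> (nat \<times> nat \<Rightarrow>\<^sub>0 nat) \<Rightarrow> (nat \<times> nat \<Rightarrow>\<^sub>0 nat) \<Rightarrow> bool" where
  "agree C t s \<longleftrightarrow> (\<forall>c r. C \<le> c \<longrightarrow> lookup s (c, r) = lookup t (c, r))"

definition restr :: "(('v \<Rightarrow>\<^sub>0 nat) \<Rightarrow> bool) \<Rightarrow> 'v mpol \<Rightarrow> 'v mpol" where
  "restr P f = (\<Sum>t\<in>{t \<in> keys f. P t}. single t (lookup f t))"

lemma lookup_restr: "lookup (restr P f) t = (if P t then lookup f t else 0)"
  by (auto simp: restr_def lookup_sum lookup_single when_def sum.delta' in_keys_iff)

lemma keys_restr: "keys (restr P f) = {t \<in> keys f. P t}"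
  by (auto simp: in_keys_iff lookup_restr split: if_splits)

lemma raise_restr:
  assumes "C \<le> D"
  shows "lookup (raise C a (restr (agree D t) f)) s = (if agree D t s then lookup (raise C a f) s else 0)"
proof -
  have "agree D t (s - single (c, a) 1 + single (c, Suc a) 1) = agree D t s" if "c < C" for c
    using that assms by (auto simp: agree_def lookup_add lookup_minus lookup_single when_def)
  then show ?thesis
    by (auto simp: raise_def lookup_sum lookup_X_pd lookup_restr intro!: sum.cong sum.neutral)
qed

lemma lm_not_less: "lm f t \<Longrightarrow> s \<in> keys f \<Longrightarrow> \<not> mless t s"
  using mless_trans[of t s t] mless_irrefl[of t] by (auto simp: lm_def)

text \<open>Downward induction on \<open>C\<close>. Freezing column \<open>C\<close> drops one
  summand of the raising operator, and that summand cannot contribute: it would need a monomial of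
  \<open>f\<close> that agrees with \<open>t\<close> after column \<open>C\<close> and exceeds it at
  \<open>(C, Suc a)\<close>.\<close>

lemma raise_slice:
  assumes f: "raise M a f = 0" and lm: "lm f t" and cols: "\<And>s v. s \<in> keys f \<Longrightarrow> v \<in> keys s \<Longrightarrow> fst v < M"
    and "C \<le> M"
  shows "raise C a (restr (agree C t) f) = 0"
  using \<open>C \<le> M\<close>
proof (induction rule: inc_induct)
  case base
  have "lookup s (c, r) = 0" if "s \<in> keys f" "M \<le> c" for s c r
    using cols[OF that(1), of "(c, r)"] that(2) by (auto simp: in_keys_iff)
  moreover have "t \<in> keys f" using lm by (simp add: lm_def)
  ultimately have "agree M t s" if "s \<in> keys f" for s
    using that by (simp add: agree_def)
  then have "restr (agree M t) f = f"
    by (intro poly_mapping_eqI) (simp add: lookup_restr, metis in_keys_iff)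
  then show ?case using f by simp
next
  case (step C)
  show ?case
  proof (rule poly_mapping_eqI)
    fix s
    let ?g = "restr (agree (Suc C) t) f"
    show "lookup (raise C a (restr (agree C t) f)) s = lookup 0 s"
    proof (cases "agree C t s")
      case True
      then have "agree (Suc C) t s" by (auto simp: agree_def)
      have "lookup (X (C, a) * pd (C, Suc a) ?g) s = 0"
      proof (rule ccontr)
        let ?s = "s - single (C, a) 1 + single (C, Suc a) 1"
        assume "lookup (X (C, a) * pd (C, Suc a) ?g) s \<noteq> 0"
        then have "lookup ?g ?s \<noteq> 0" by (auto simp: lookup_X_pd split: if_splits)
        then have "?s \<in> keys f" by (auto simp: lookup_restr in_keys_iff split: if_splits)
        moreover have "mless t ?s"
          unfolding mless_def
          by (rule exI[of _ "(C, Suc a)"])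
            (use True in \<open>auto simp: agree_def lookup_add lookup_minus lookup_single when_def\<close>)
        ultimately show False using lm_not_less[OF lm] by blast
      qed
      moreover have "raise (Suc C) a ?g = raise C a ?g + X (C, a) * pd (C, Suc a) ?g"
        by (simp add: raise_def)
      ultimately have "lookup (raise C a ?g) s = 0" using step.IH by (metis lookup_add lookup_zero add.right_neutral)
      then show ?thesis using True \<open>agree (Suc C) t s\<close> by (simp add: raise_restr)
    qed (simp add: raise_restr)
  qed
qed

text \<open>The slice \<open>g\<close> that agrees with \<open>t\<close> after column
  \<open>C\<close> is an \<open>sl_2\<close> highest weight vector of weight \<open>h\<close> in the
  first \<open>C + 1\<close> columns. Lowering it \<open>j\<close> times still leaves the monomial
  with \<open>j\<close> units of column \<open>C\<close> moved from row \<open>a\<close> to row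
  \<open>Suc a\<close>. Since lowering dies after \<open>h\<close> steps, the exponent of
  \<open>(C, a)\<close> is at most \<open>h\<close>, which is the claim.\<close>

lemma lm_interlacing:
  assumes f: "raise M a f = 0" and lm: "lm f t" and cols: "\<And>s v. s \<in> keys f \<Longrightarrow> v \<in> keys s \<Longrightarrow> fst v < M"
    and deg: "\<And>s. s \<in> keys f \<Longrightarrow> cs M a s = cs M a t \<and> cs M (Suc a) s = cs M (Suc a) t"
    and C: "C < M"
  shows "cs (Suc C) (Suc a) t \<le> cs C a t"
proof -
  define g where "g = restr (agree (Suc C) t) f"
  define h where "h = int (cs (Suc C) a t) - int (cs (Suc C) (Suc a) t)"
  let ?L = "lower (Suc C) a"
  have g0: "raise (Suc C) a g = 0"
    unfolding g_def using raise_slice[OF f lm cols] C by simp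
  have tg: "t \<in> keys g" using lm by (simp add: g_def keys_restr lm_def agree_def)
  have cseq: "cs (Suc C) r s = cs (Suc C) r t" if "cs M r s = cs M r t" "agree (Suc C) t s" for r s
  proof -
    have "cs M r u = cs (Suc C) r u + (\<Sum>c\<in>{Suc C..<M}. lookup u (c, r))" for u
      unfolding cs_def using C by (subst sum.union_disjoint[symmetric]) (auto intro!: sum.cong)
    moreover have "(\<Sum>c\<in>{Suc C..<M}. lookup s (c, r)) = (\<Sum>c\<in>{Suc C..<M}. lookup t (c, r))"
      by (rule sum.cong) (use that(2) in \<open>auto simp: agree_def\<close>)
    ultimately show ?thesis using that(1) by simp
  qed
  have bal: "balanced (Suc C) a h g"
    unfolding balanced_def h_def using deg cseq by (auto simp: g_def keys_restr)
  have "g \<noteq> 0" using tg by auto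
  note str = lower_string[OF g0 bal this]
  \<comment> \<open>Monomials that look like \<open>t\<close> after \<open>i\<close> transfers
    inside column \<open>C\<close>, as far as \<open>(C, a)\<close> and the variables from
    \<open>(C, Suc a)\<close> upwards are concerned.\<close>
  define Hit where "Hit = (\<lambda>i s. lookup s (C, a) + i = lookup t (C, a) \<and> lookup s (C, Suc a) = lookup t (C, Suc a) + i
      \<and> (\<forall>u>(C, Suc a). lookup s u = lookup t u))"
  have step_back: "\<exists>s'\<in>keys y. lookup s' (c, a) > 0 \<and> s = s' - single (c, a) 1 + single (c, Suc a) 1 \<and> (c < C \<longrightarrow> Hit i s') \<and> (c = C \<longrightarrow> Hit (i - 1) s')"
    if "s \<in> keys (X (c, Suc a) * pd (c, a) y)" "Hit i s" "c \<le> C" "i \<ge> 1" for s c y i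
  proof -
    from that(1) obtain s' where s': "s' \<in> keys y" "lookup s' (c, a) > 0" "s = s' - single (c, a) 1 + single (c, Suc a) 1"
      by (elim keys_X_pd)
    have val: "lookup s v = lookup s' v" if "v \<noteq> (c, a)" "v \<noteq> (c, Suc a)" for v
      unfolding s'(3) using that by (simp add: lookup_add lookup_minus lookup_single)
    have val2: "lookup s (c, a) = lookup s' (c, a) - 1" "lookup s (c, Suc a) = lookup s' (c, Suc a) + 1"
      unfolding s'(3) by (simp_all add: lookup_add lookup_minus lookup_single)
    have far: "u \<noteq> (c, a) \<and> u \<noteq> (c, Suc a)" if "u > (C, Suc a)" for u
      using that \<open>c \<le> C\<close> by (cases u) auto
    have vfar: "lookup s' u = lookup t u" if "u > (C, Suc a)" for u
      using that far[OF that] val[of u] \<open>Hit i s\<close> unfolding Hit_def by auto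
    have "Hit i s'" if "c < C"
      using \<open>Hit i s\<close> that vfar val[of "(C, a)"] val[of "(C, Suc a)"] unfolding Hit_def by simp
    moreover have "Hit (i - 1) s'" if "c = C"
    proof -
      have "lookup s' (C, a) + (i - 1) = lookup t (C, a)" "lookup s' (C, Suc a) = lookup t (C, Suc a) + (i - 1)"
        using \<open>Hit i s\<close> val2 s'(2) that \<open>i \<ge> 1\<close> unfolding Hit_def by auto
      then show ?thesis using vfar unfolding Hit_def by simp
    qed
    ultimately show ?thesis using s' by blast
  qed
  \<comment> \<open>One lowering accounts for at most one transfer. With more transfers than
    lowerings, some monomial of \<open>g\<close> itself would lie above its leading monomial
    \<open>t\<close>.\<close>
  have nohit: "\<not> Hit i s" if "s \<in> keys ((?L ^^ j) g)" "i > j" for i j s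
    using that
  proof (induction j arbitrary: i s)
    case 0
    show ?case
    proof
      assume "Hit i s"
      then have "mless t s" unfolding Hit_def mless_def using 0(2) by (intro exI[of _ "(C, Suc a)"]) auto
      moreover have "s \<in> keys f" using 0(1) by (simp add: g_def keys_restr)
      ultimately show False using lm_not_less[OF lm] by blast
    qed
  next
    case (Suc j)
    show ?case
    proof
      assume hit: "Hit i s"
      have "s \<in> keys (?L ((?L ^^ j) g))" using Suc.prems(1) by simp
      from keys_lower[OF this] obtain c where c: "c \<le> C" "s \<in> keys (X (c, Suc a) * pd (c, a) ((?L ^^ j) g))"
        by (auto simp: less_Suc_eq_le)
      obtain s' where "s' \<in> keys ((?L ^^ j) g)" "(c < C \<longrightarrow> Hit i s') \<and> (c = C \<longrightarrow> Hit (i - 1) s')"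
        using step_back[OF c(2) hit c(1)] Suc.prems(2) by auto
      moreover have "j < i - 1" "j < i" using Suc.prems(2) by linarith+
      ultimately show False using Suc.IH[of s' i] Suc.IH[of s' "i - 1"] c(1) by (cases "c < C") auto
    qed
  qed
  define tt where "tt = (\<lambda>j. t - single (C, a) j + single (C, Suc a) j)"
  \<comment> \<open>By \<open>nohit\<close> the monomial \<open>tt (Suc j)\<close> is reached from
    \<open>tt j\<close> alone, through column \<open>C\<close>, so its coefficient is a positive
    multiple of the previous one.\<close>
  have coeff: "lookup ((?L ^^ j) g) (tt j) \<noteq> 0" if "j \<le> lookup t (C, a)" for j
    using that
  proof (induction j)
    case 0
    have "tt 0 = t" by (simp add: tt_def)
    then show ?case using tg by (simp add: in_keys_iff)
  next
    case (Suc j)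
    let ?y = "(?L ^^ j) g"
    have hit: "Hit (Suc j) (tt (Suc j))"
      unfolding Hit_def tt_def using Suc.prems
      by (auto simp: lookup_add lookup_minus lookup_single when_def)
    have z: "lookup (X (c, Suc a) * pd (c, a) ?y) (tt (Suc j)) = 0" if "c < C" for c
    proof (rule ccontr)
      assume "lookup (X (c, Suc a) * pd (c, a) ?y) (tt (Suc j)) \<noteq> 0"
      then have "tt (Suc j) \<in> keys (X (c, Suc a) * pd (c, a) ?y)" by (simp add: in_keys_iff)
      from step_back[OF this hit] that obtain s' where "s' \<in> keys ?y" "Hit (Suc j) s'" by auto
      then show False using nohit[of s' j "Suc j"] by simp
    qed
    have tt: "tt (Suc j) - single (C, Suc a) 1 + single (C, a) 1 = tt j"
      using Suc.prems by (intro poly_mapping_eqI) (auto simp: tt_def lookup_add lookup_minus lookup_single when_def)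
    have pos: "lookup (tt (Suc j)) (C, Suc a) \<noteq> 0" by (simp add: tt_def lookup_add)
    have "lookup ((?L ^^ Suc j) g) (tt (Suc j)) = lookup (X (C, Suc a) * pd (C, a) ?y) (tt (Suc j))"
      using z by (simp add: lower_def lookup_sum lookup_add)
    also have "\<dots> = (real (lookup (tt (Suc j)) (C, a)) + 1) * lookup ?y (tt j)"
      using pos tt by (simp add: lookup_X_pd)
    finally show ?case using Suc by simp
  qed
  have "\<not> Suc (nat h) \<le> lookup t (C, a)"
    using coeff[of "Suc (nat h)"] str(2) by (metis lookup_zero)
  then have "int (lookup t (C, a)) \<le> h" using str(1) by linarith
  moreover have "cs (Suc C) a t = cs C a t + lookup t (C, a)" by (simp add: cs_def)
  ultimately show ?thesis unfolding h_def by linarith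
qed

section \<open>Minors of consecutive rows as highest weight polynomials\<close>

definition minor_mon :: "nat \<Rightarrow> nat \<Rightarrow> (nat \<Rightarrow> nat) \<Rightarrow> (nat \<Rightarrow> nat) \<Rightarrow> (nat \<times> nat \<Rightarrow>\<^sub>0 nat)" where
  "minor_mon s p cc \<pi> = (\<Sum>q<p. single (cc q, s + \<pi> q) 1)"

definition minor :: "nat \<Rightarrow> nat \<Rightarrow> (nat \<Rightarrow> nat) \<Rightarrow> vpol" where
  "minor s p cc = (\<Sum>\<pi> | \<pi> permutes {..<p}. real_of_int (sign \<pi>) *\<^sub>R (\<Prod>q<p. X (cc q, s + \<pi> q)))"

lemma prod_X: "finite A \<Longrightarrow> (\<Prod>q\<in>A. X (f q)) = single (\<Sum>q\<in>A. single (f q) 1) 1"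
  by (induction A rule: finite_induct) (simp_all add: X_def mult_single)

lemma minor_eq: "minor s p cc = (\<Sum>\<pi> | \<pi> permutes {..<p}. single (minor_mon s p cc \<pi>) (real_of_int (sign \<pi>)))"
  unfolding minor_def minor_mon_def by (intro sum.cong refl) (simp add: prod_X scaleR_single)

lemma lookup_minor_mon: "lookup (minor_mon s p cc \<pi>) (c, r) = card {q \<in> {..<p}. cc q = c \<and> s + \<pi> q = r}"
proof -
  have "lookup (minor_mon s p cc \<pi>) (c, r) = (\<Sum>q<p. if cc q = c \<and> s + \<pi> q = r then 1 else 0)"
    unfolding minor_mon_def lookup_sum lookup_single when_def by (intro sum.cong refl) auto
  then show ?thesis by (subst (asm) sum.inter_filter[symmetric]) auto
qed

text \<open>Let \<open>m\<close> be the largest point moved by \<open>\<pi>\<close>; it is sent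
  downwards. In column \<open>cc m\<close> the diagonal term then uses a larger row index, and no
  larger variable distinguishes the two terms.\<close>

lemma minor_mon_less:
  assumes cc: "\<And>q q'. q < q' \<Longrightarrow> q' < p \<Longrightarrow> cc q < cc q'" and \<pi>: "\<pi> permutes {..<p}" and "\<pi> \<noteq> id"
  shows "mless (minor_mon s p cc \<pi>) (minor_mon s p cc id)"
proof -
  let ?D = "{q. \<pi> q \<noteq> q}"
  have sub: "?D \<subseteq> {..<p}" using \<pi> unfolding permutes_def by blast
  then have fin: "finite ?D" by (rule finite_subset) simp
  have ne: "?D \<noteq> {}" using \<open>\<pi> \<noteq> id\<close> by auto
  define m where "m = Max ?D"
  have m: "\<pi> m \<noteq> m" "m < p" using Max_in[OF fin ne] sub by (auto simp: m_def)
  have fixed: "\<pi> q = q" if "q > m" for q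
    using Max_ge[OF fin, of q] that unfolding m_def by (cases "q \<in> ?D") auto
  have inj: "q = q'" if "cc q = cc q'" "q < p" "q' < p" for q q'
    using that cc[of q q'] cc[of q' q] by (cases q q' rule: linorder_cases) auto
  have "\<pi> m \<le> m"
  proof (rule ccontr)
    assume "\<not> \<pi> m \<le> m"
    then have "\<pi> (\<pi> m) = \<pi> m" using fixed by simp
    then show False using m(1) permutes_inj[OF \<pi>] by (metis injD)
  qed
  show ?thesis
    unfolding mless_def
  proof (intro exI[of _ "(cc m, s + m)"] conjI allI impI)
    have False if "q < p" "cc q = cc m" "s + \<pi> q = s + m" for q
      using inj[OF that(2,1) m(2)] that m(1) by simp
    then have "{q \<in> {..<p}. cc q = cc m \<and> s + \<pi> q = s + m} = {}" by blast
    moreover have "{q \<in> {..<p}. cc q = cc m \<and> s + id q = s + m} = {m}" using m by auto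
    ultimately show "lookup (minor_mon s p cc \<pi>) (cc m, s + m) < lookup (minor_mon s p cc id) (cc m, s + m)"
      by (simp add: lookup_minor_mon)
  next
    fix u assume u: "u > (cc m, s + m)"
    obtain c r where cr: "u = (c, r)" by (cases u)
    have "{q \<in> {..<p}. cc q = c \<and> s + \<pi> q = r} = {q \<in> {..<p}. cc q = c \<and> s + id q = r}"
    proof (rule Collect_cong)
      fix q
      show "(q \<in> {..<p} \<and> cc q = c \<and> s + \<pi> q = r) = (q \<in> {..<p} \<and> cc q = c \<and> s + id q = r)"
      proof (cases q m rule: linorder_cases)
        case less
        then show ?thesis using cc[of q m] m u cr by auto
      next
        case equal
        then show ?thesis using u cr \<open>\<pi> m \<le> m\<close> by auto
      next
        case greater
        then show ?thesis using fixed by simp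
      qed
    qed
    then show "lookup (minor_mon s p cc \<pi>) u = lookup (minor_mon s p cc id) u"
      by (simp add: cr lookup_minor_mon)
  qed
qed

lemma keys_minor: "t \<in> keys (minor s p cc) \<Longrightarrow> \<exists>\<pi>. \<pi> permutes {..<p} \<and> t = minor_mon s p cc \<pi>"
proof -
  assume t: "t \<in> keys (minor s p cc)"
  have "t \<in> (\<Union>\<pi>\<in>{\<pi>. \<pi> permutes {..<p}}. keys (single (minor_mon s p cc \<pi>) (real_of_int (sign \<pi>))))"
    using t keys_sum[of "\<lambda>\<pi>. single (minor_mon s p cc \<pi>) (real_of_int (sign \<pi>))" "{\<pi>. \<pi> permutes {..<p}}"]
    unfolding minor_eq by (rule subsetD[rotated])
  then show ?thesis by (auto split: if_splits)
qed

lemma lm_minor: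
  assumes cc: "\<And>q q'. q < q' \<Longrightarrow> q' < p \<Longrightarrow> cc q < cc q'"
  shows "lm (minor s p cc) (minor_mon s p cc id)" and "lookup (minor s p cc) (minor_mon s p cc id) = 1"
proof -
  have ne: "minor_mon s p cc \<pi> \<noteq> minor_mon s p cc id" if "\<pi> permutes {..<p}" "\<pi> \<noteq> id" for \<pi>
    using minor_mon_less[of p cc \<pi> s, OF cc that] mless_irrefl by metis
  have "lookup (minor s p cc) (minor_mon s p cc id)
     = (\<Sum>\<pi> | \<pi> permutes {..<p}. if \<pi> = id then 1 else 0)"
    unfolding minor_eq lookup_sum
    by (intro sum.cong refl) (use ne in \<open>auto simp: lookup_single when_def sign_id\<close>)
  also have "\<dots> = 1" by (subst sum.delta) (auto simp: permutes_id)
  finally show 1: "lookup (minor s p cc) (minor_mon s p cc id) = 1" .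
  then show "lm (minor s p cc) (minor_mon s p cc id)"
    unfolding lm_def using keys_minor minor_mon_less[of p cc _ s, OF cc]
    by (metis in_keys_iff zero_neq_one)
qed

text \<open>If the minor contains rows \<open>a\<close> and \<open>Suc a\<close>, raising produces a
  determinant with two equal rows; \<open>\<tau>\<close> exchanges these rows and reverses the sign
  of the sum. Otherwise row \<open>Suc a\<close> does not occur, since the only remaining case,
  \<open>Suc a\<close> as first row, is excluded.\<close>

lemma raise_minor:
  assumes "Suc a \<noteq> s" and "\<And>q. q < p \<Longrightarrow> cc q < M"
  shows "raise M a (minor s p cc) = 0"
proof (cases "s \<le> a \<and> Suc a < s + p")
  case True
  define \<phi> where "\<phi> = (\<lambda>r. if r = Suc a then a else r)"
  define \<tau> where "\<tau> = transpose (a - s) (Suc a - s)"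
  have \<tau>: "\<tau> permutes {..<p}" unfolding \<tau>_def using True by (intro permutes_swap_id) auto
  have st: "sign (\<tau> \<circ> \<pi>) = - sign \<pi>" if "\<pi> permutes {..<p}" for \<pi>
  proof -
    have "permutation \<pi>" "permutation \<tau>" using that \<tau> permutation_permutes by blast+
    moreover have "a - s \<noteq> Suc a - s" using True by auto
    then have "sign \<tau> = -1" unfolding \<tau>_def by (simp add: sign_swap_id)
    ultimately show ?thesis by (simp add: sign_compose)
  qed
  have \<phi>\<tau>: "\<phi> (s + \<tau> x) = \<phi> (s + x)" for x
    using True by (auto simp: \<phi>_def \<tau>_def transpose_def)
  let ?G = "\<lambda>\<pi>. \<Prod>q<p. X (cc q, \<phi> (s + \<pi> q))"
  have "raise M a (\<Prod>q<p. X (cc q, s + \<pi> q)) = ?G \<pi>" if \<pi>: "\<pi> permutes {..<p}" for \<pi>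
  proof -
    define q1 where "q1 = inv \<pi> (Suc a - s)"
    have q1: "\<pi> q1 = Suc a - s" using \<pi> by (simp add: q1_def permutes_inverses)
    have q1p: "q1 < p" using permutes_less[OF permutes_inv[OF \<pi>], of "Suc a - s"] True by (auto simp: q1_def)
    have uniq: "s + \<pi> q = Suc a \<longleftrightarrow> q = q1" for q
    proof
      assume "s + \<pi> q = Suc a"
      then have "\<pi> q = \<pi> q1" using q1 by linarith
      then show "q = q1" using permutes_inj[OF \<pi>] by (rule injD[rotated])
    qed (use q1 True in simp)
    have "raise M a (\<Prod>q<p. X (cc q, s + \<pi> q))
      = (\<Sum>q<p. raise M a (X (cc q, s + \<pi> q)) * (\<Prod>q'\<in>{..<p} - {q}. X (cc q', s + \<pi> q')))"
      by (rule derivation_prod[OF derivation_raise]) simp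
    also have "\<dots> = (\<Sum>q<p. if q = q1 then X (cc q, a) * (\<Prod>q'\<in>{..<p} - {q}. X (cc q', s + \<pi> q')) else 0)"
      by (intro sum.cong refl) (use uniq assms(2) in \<open>auto simp: raise_X\<close>)
    also have "\<dots> = X (cc q1, a) * (\<Prod>q'\<in>{..<p} - {q1}. X (cc q', s + \<pi> q'))"
      using q1p by simp
    also have "(\<Prod>q'\<in>{..<p} - {q1}. X (cc q', s + \<pi> q')) = (\<Prod>q'\<in>{..<p} - {q1}. X (cc q', \<phi> (s + \<pi> q')))"
      by (intro prod.cong refl) (use uniq in \<open>auto simp: \<phi>_def\<close>)
    also have "X (cc q1, a) * \<dots> = ?G \<pi>"
      using q1p uniq[of q1] by (subst (2) prod.remove[of _ q1]) (auto simp: \<phi>_def)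
    finally show ?thesis .
  qed
  then have "raise M a (minor s p cc) = (\<Sum>\<pi> | \<pi> permutes {..<p}. real_of_int (sign \<pi>) *\<^sub>R ?G \<pi>)"
    unfolding minor_def by (simp add: linear_sum[OF linear_raise] linear_scale[OF linear_raise])
  also have "\<dots> = (\<Sum>\<pi> | \<pi> permutes {..<p}. - (real_of_int (sign \<pi>) *\<^sub>R ?G \<pi>))"
  proof (rule sum.reindex_bij_witness[of _ "\<lambda>\<pi>. \<tau> \<circ> \<pi>" "\<lambda>\<pi>. \<tau> \<circ> \<pi>"])
    fix \<pi> assume "\<pi> \<in> {\<pi>. \<pi> permutes {..<p}}"
    then have \<pi>: "\<pi> permutes {..<p}" by simp
    show "\<tau> \<circ> (\<tau> \<circ> \<pi>) = \<pi>" "\<tau> \<circ> (\<tau> \<circ> \<pi>) = \<pi>" by (simp_all add: \<tau>_def comp_assoc[symmetric])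
    show "\<tau> \<circ> \<pi> \<in> {\<pi>. \<pi> permutes {..<p}}" "\<tau> \<circ> \<pi> \<in> {\<pi>. \<pi> permutes {..<p}}"
      using permutes_compose[OF \<pi> \<tau>] by simp_all
    show "- (real_of_int (sign (\<tau> \<circ> \<pi>)) *\<^sub>R ?G (\<tau> \<circ> \<pi>)) = real_of_int (sign \<pi>) *\<^sub>R ?G \<pi>"
      by (simp add: st[OF \<pi>] \<phi>\<tau>)
  qed
  also have "\<dots> = - (\<Sum>\<pi> | \<pi> permutes {..<p}. real_of_int (sign \<pi>) *\<^sub>R ?G \<pi>)"
    by (rule sum_negf)
  finally have eq: "raise M a (minor s p cc) = - (\<Sum>\<pi> | \<pi> permutes {..<p}. real_of_int (sign \<pi>) *\<^sub>R ?G \<pi>)"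
    and "raise M a (minor s p cc) = (\<Sum>\<pi> | \<pi> permutes {..<p}. real_of_int (sign \<pi>) *\<^sub>R ?G \<pi>)"
    using \<open>raise M a (minor s p cc) = (\<Sum>\<pi> | \<pi> permutes {..<p}. real_of_int (sign \<pi>) *\<^sub>R ?G \<pi>)\<close> by simp_all
  then have "raise M a (minor s p cc) + raise M a (minor s p cc) = 0" by simp
  then have "2 *\<^sub>R raise M a (minor s p cc) = 0" by (simp add: scaleR_2)
  then show ?thesis by simp
next
  case False
  have "raise M a (\<Prod>q<p. X (cc q, s + \<pi> q)) = 0" if \<pi>: "\<pi> permutes {..<p}" for \<pi>
  proof -
    have "s + \<pi> q \<noteq> Suc a" if "q < p" for q
      using permutes_less[OF \<pi> that] False assms(1) by auto
    then show ?thesis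
      by (subst derivation_prod[OF derivation_raise]) (auto simp: raise_X)
  qed
  then show ?thesis
    unfolding minor_def by (simp add: linear_sum[OF linear_raise] linear_scale[OF linear_raise])
qed

text \<open>\<open>V\<close> is the set of variables in use, and \<open>R\<close> the set of rows
  \<open>a\<close> for which the condition \<open>raise M a f = 0\<close> is imposed. Leaving gaps
  in \<open>R\<close> separates groups of rows, so one matrix can hold several independent highest
  weight problems.\<close>

locale shape =
  fixes K M :: nat and V :: "(nat \<times> nat) set" and R :: "nat set"
  assumes V_sub: "\<And>c r. (c, r) \<in> V \<Longrightarrow> c < M \<and> r < K"
    and V_R: "\<And>a c. a \<in> R \<Longrightarrow> (c, a) \<in> V \<longleftrightarrow> (c, Suc a) \<in> V"
    and R_less: "\<And>a. a \<in> R \<Longrightarrow> Suc a < K"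
begin

definition mons :: "(nat \<Rightarrow> nat) \<Rightarrow> (nat \<times> nat \<Rightarrow>\<^sub>0 nat) set" where
  "mons \<Lambda> = {t. keys t \<subseteq> V \<and> (\<forall>r<K. cs M r t = \<Lambda> r)}"

text \<open>The interlacing cone. By \<open>lm_Sp_Sig\<close> and \<open>hw_exists\<close> it is
  exactly the set of leading monomials of elements of \<open>Sp \<Lambda>\<close>.\<close>

definition Sig :: "(nat \<Rightarrow> nat) \<Rightarrow> (nat \<times> nat \<Rightarrow>\<^sub>0 nat) set" where
  "Sig \<Lambda> = {t \<in> mons \<Lambda>. \<forall>a\<in>R. \<forall>c<M. cs (Suc c) (Suc a) t \<le> cs c a t}"

text \<open>For a single chain of rows this is the model of the Schur module of shape
  \<open>\<Lambda>\<close> by highest weight vectors of the row action; the columns index a basis of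
  the underlying space.\<close>

definition Sp :: "(nat \<Rightarrow> nat) \<Rightarrow> vpol set" where
  "Sp \<Lambda> = {f. keys f \<subseteq> mons \<Lambda> \<and> (\<forall>a\<in>R. raise M a f = 0)}"

definition colsum :: "nat \<Rightarrow> (nat \<times> nat \<Rightarrow>\<^sub>0 nat) \<Rightarrow> nat" where
  "colsum c t = (\<Sum>r<K. lookup t (c, r))"

lemma cs_add: "cs C r (s + t) = cs C r s + cs C r t"
  by (simp add: cs_def lookup_add sum.distrib)

lemma colsum_add: "colsum c (s + t) = colsum c s + colsum c t"
  by (simp add: colsum_def lookup_add sum.distrib)

lemma subspace_Sp: "subspace (Sp \<Lambda>)"
  unfolding subspace_def Sp_def
proof (safe)
  fix f g :: vpol and c :: real and a t
  assume "keys f \<subseteq> mons \<Lambda>" "keys g \<subseteq> mons \<Lambda>" "t \<in> keys (f + g)"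
  then show "t \<in> mons \<Lambda>" using keys_add[of f g] by blast
next
  fix f :: vpol and c :: real and t
  assume "keys f \<subseteq> mons \<Lambda>" "t \<in> keys (c *\<^sub>R f)"
  then show "t \<in> mons \<Lambda>" using keys_scaleR[of c f] by blast
qed (simp_all add: linear_0[OF linear_raise] linear_add[OF linear_raise] linear_scale[OF linear_raise])

lemma mons_mult: "s \<in> mons \<Lambda> \<Longrightarrow> t \<in> mons \<Lambda>' \<Longrightarrow> s + t \<in> mons (\<lambda>r. \<Lambda> r + \<Lambda>' r)"
  using keys_add[of s t] by (auto simp: mons_def cs_add)

lemma Sp_mult:
  assumes "f \<in> Sp \<Lambda>" "g \<in> Sp \<Lambda>'"
  shows "f * g \<in> Sp (\<lambda>r. \<Lambda> r + \<Lambda>' r)"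
proof -
  have "t \<in> mons (\<lambda>r. \<Lambda> r + \<Lambda>' r)" if t: "t \<in> keys (f * g)" for t
  proof -
    obtain u v where "t = u + v" "u \<in> keys f" "v \<in> keys g" using t keys_mult[of f g] by blast
    then show ?thesis using assms mons_mult unfolding Sp_def by blast
  qed
  then show ?thesis using assms by (auto simp: Sp_def derivation_mult[OF derivation_raise])
qed

lemma one_Sp: "1 \<in> Sp (\<lambda>_. 0)"
  by (auto simp: Sp_def mons_def cs_def derivation_one[OF derivation_raise])

lemma lookup_outside: "t \<in> mons \<Lambda> \<Longrightarrow> (c, r) \<notin> V \<Longrightarrow> lookup t (c, r) = 0"
  unfolding mons_def by (auto simp: in_keys_iff)

lemma lm_Sp_Sig:
  assumes f: "f \<in> Sp \<Lambda>" and lm: "lm f t"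
  shows "t \<in> Sig \<Lambda>"
proof -
  have t: "t \<in> keys f" using lm by (simp add: lm_def)
  have "cs (Suc c) (Suc a) t \<le> cs c a t" if a: "a \<in> R" and c: "c < M" for a c
  proof (rule lm_interlacing[OF _ lm _ _ c])
    show "raise M a f = 0" using f a by (simp add: Sp_def)
    fix s assume "s \<in> keys f"
    then have s: "s \<in> mons \<Lambda>" using f by (auto simp: Sp_def)
    show "fst v < M" if "v \<in> keys s" for v
      using that s V_sub unfolding mons_def by (cases v) auto
    have "t \<in> mons \<Lambda>" using f t by (auto simp: Sp_def)
    then show "cs M a s = cs M a t \<and> cs M (Suc a) s = cs M (Suc a) t"
      using s R_less[OF a] by (simp add: mons_def)
  qed
  then show ?thesis using f t by (auto simp: Sig_def Sp_def)
qed

lemma cs_mono: "c \<le> d \<Longrightarrow> cs c r t \<le> cs d r t"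
  unfolding cs_def by (rule sum_mono2) auto

lemma cs_diff:
  assumes "\<And>v. lookup u v \<le> lookup t v"
  shows "cs c r (t - u) = cs c r t - cs c r u"
  unfolding cs_def lookup_minus by (rule sum_subtractf_nat) (use assms in auto)

lemma Sig_dom:
  assumes t: "t \<in> Sig \<Lambda>" and a: "a \<in> R"
  shows "\<Lambda> (Suc a) \<le> \<Lambda> a"
proof -
  have e: "cs M a t = \<Lambda> a" "cs M (Suc a) t = \<Lambda> (Suc a)"
    and i: "\<And>c. c < M \<Longrightarrow> cs (Suc c) (Suc a) t \<le> cs c a t"
    using t a R_less[OF a] by (simp_all add: Sig_def mons_def)
  show ?thesis
  proof (cases "M = 0")
    case True
    then show ?thesis using e by (simp add: cs_def)
  next
    case False
    then have "cs M (Suc a) t \<le> cs (M - 1) a t" using i[of "M - 1"] by simp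
    also have "\<dots> \<le> cs M a t" by (rule cs_mono) simp
    finally show ?thesis using e by simp
  qed
qed

text \<open>Splitting off the leftmost column of the tableau with content matrix \<open>t\<close> yields a
  minor whose leading monomial divides \<open>t\<close> inside the interlacing cone.\<close>

lemma Sig_split:
  assumes t: "t \<in> Sig \<Lambda>" and "t \<noteq> 0"
  obtains s p cc where "p > 0" "\<And>q q'. q < q' \<Longrightarrow> q' < p \<Longrightarrow> cc q < cc q'"
    "\<And>q q'. q < p \<Longrightarrow> q' < p \<Longrightarrow> (cc q, s + q') \<in> V"
    "\<And>a. a \<in> R \<Longrightarrow> Suc a \<noteq> s"
    "\<And>v. lookup (minor_mon s p cc id) v \<le> lookup t v"
    "t - minor_mon s p cc id \<in> Sig (\<lambda>r. \<Lambda> r - (if s \<le> r \<and> r < s + p then 1 else 0))"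
proof -
  have tm: "t \<in> mons \<Lambda>" using t by (simp add: Sig_def)
  obtain c0 r0 where "lookup t (c0, r0) \<noteq> 0" using \<open>t \<noteq> 0\<close> by (metis poly_mapping_eqI lookup_zero surj_pair)
  then have v0: "(c0, r0) \<in> V" using lookup_outside[OF tm, of c0 r0] by auto
  have r0K: "r0 < K" "c0 < M" using V_sub[OF v0] by auto
  have cs_pos: "cs M r t > 0" if "lookup t (c, r) \<noteq> 0" "c < M" for c r
    using that unfolding cs_def by (metis finite_lessThan gr0I lessThan_iff sum_eq_0_iff)
  have \<Lambda>r0: "\<Lambda> r0 > 0" using cs_pos[of c0 r0] \<open>lookup t (c0, r0) \<noteq> 0\<close> r0K tm by (auto simp: mons_def)
  \<comment> \<open>From a nonempty row \<open>r0\<close>, go up to the first row \<open>s\<close>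
    of its chain of linked rows. By dominance all rows in between are nonempty.\<close>
  define good where "good = (\<lambda>s. s \<le> r0 \<and> (\<forall>a. s \<le> a \<and> a < r0 \<longrightarrow> a \<in> R))"
  define s where "s = (LEAST s. good s)"
  have gs: "good s" unfolding s_def by (rule LeastI[of good r0]) (auto simp: good_def)
  have sR: "Suc a \<noteq> s" if "a \<in> R" for a
  proof
    assume "Suc a = s"
    moreover from this have "good a" using gs that unfolding good_def by (auto simp: le_Suc_eq not_less_eq_eq[symmetric] dest: le_neq_implies_less) 
    ultimately show False using Least_le[of good a] unfolding s_def[symmetric] by simp
  qed
  have "\<Lambda> (r0 - i) > 0" if "i \<le> r0 - s" for i
    using that
  proof (induction i)
    case (Suc i)
    have "r0 - Suc i \<in> R" using gs Suc.prems unfolding good_def by auto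
    moreover have "Suc (r0 - Suc i) = r0 - i" using Suc.prems by auto
    ultimately have "\<Lambda> (r0 - i) \<le> \<Lambda> (r0 - Suc i)" using Sig_dom[OF t, of "r0 - Suc i"] by simp
    then show ?case using Suc by simp
  qed (use \<Lambda>r0 in simp)
  from this[of "r0 - s"] have \<Lambda>s: "\<Lambda> s > 0" using gs by (simp add: good_def)
  have sK: "s < K" using gs r0K by (simp add: good_def)
  \<comment> \<open>The tableau column ends where the chain of linked rows ends or where the next
    row is empty.\<close>
  define stop where "stop = (\<lambda>p. p > 0 \<and> (s + p - 1 \<notin> R \<or> \<Lambda> (s + p) = 0))"
  define p where "p = (LEAST p. stop p)"
  have "stop K" using R_less[of "s + K - 1"] sK unfolding stop_def by auto
  then have sp: "stop p" unfolding p_def by (rule LeastI)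
  have chain: "s + q \<in> R \<and> \<Lambda> (s + Suc q) > 0" if "Suc q < p" for q
  proof -
    have "\<not> stop (Suc q)" using not_less_Least[of "Suc q" stop] that unfolding p_def by blast
    then show ?thesis by (simp add: stop_def)
  qed
  have \<Lambda>pos: "\<Lambda> (s + q) > 0" if "q < p" for q
    using that \<Lambda>s chain by (cases q) auto
  have rowK: "s + q < K" if "q < p" for q
    using that sK chain R_less by (cases q) fastforce+
  \<comment> \<open>The smallest column index present in a row is the first entry of that row of the
    tableau.\<close>
  define cc where "cc = (\<lambda>q. LEAST c. lookup t (c, s + q) > 0)"
  have ccpos: "lookup t (cc q, s + q) > 0" and ccmin: "\<And>c. c < cc q \<Longrightarrow> lookup t (c, s + q) = 0" if "q < p" for q
  proof -
    have "cs M (s + q) t > 0" using \<Lambda>pos[OF that] tm rowK[OF that] by (simp add: mons_def)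
    then have "\<exists>c. lookup t (c, s + q) > 0" unfolding cs_def by (metis gr0I less_irrefl sum.neutral)
    then show "lookup t (cc q, s + q) > 0" unfolding cc_def by (rule LeastI_ex)
    show "\<And>c. c < cc q \<Longrightarrow> lookup t (c, s + q) = 0" unfolding cc_def using not_less_Least by blast
  qed
  have ccV: "(cc q, s + q) \<in> V" if "q < p" for q using lookup_outside[OF tm] ccpos[OF that] by force
  have ccM: "cc q < M" if "q < p" for q using ccV[OF that] V_sub by blast
  have cs0: "cs c (s + q) t = 0" if "c \<le> cc q" "q < p" for c q
    unfolding cs_def using ccmin[OF that(2)] that(1) by simp
  have csp: "cs c (s + q) t > 0" if "cc q < c" "q < p" for c q
  proof -
    have "lookup t (cc q, s + q) \<le> cs c (s + q) t"
      unfolding cs_def by (rule member_le_sum[of _ _ "\<lambda>c. lookup t (c, s + q)"]) (use that in auto)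
    then show ?thesis using ccpos[OF that(2)] by simp
  qed
  \<comment> \<open>Strict increase down the tableau column is interlacing, tested at the first
    entry of the lower row.\<close>
  have ccSuc: "cc q < cc (Suc q)" if q: "Suc q < p" for q
  proof (rule ccontr)
    assume n: "\<not> cc q < cc (Suc q)"
    have "cs (Suc (cc (Suc q))) (s + Suc q) t > 0" by (rule csp) (use q in auto)
    moreover have "cs (Suc (cc (Suc q))) (Suc (s + q)) t \<le> cs (cc (Suc q)) (s + q) t"
      using t chain[OF q] ccM[OF q] by (simp add: Sig_def)
    moreover have "cs (cc (Suc q)) (s + q) t = 0" by (rule cs0) (use n q in auto)
    ultimately show False by simp
  qed
  have cc: "cc q < cc q'" if "q < q'" "q' < p" for q q'
    using that
  proof (induction q')
    case (Suc q')
    then show ?case using ccSuc[of q'] by (cases "q = q'") auto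
  qed simp
  have Vup: "(c, s + q) \<in> V \<longleftrightarrow> (c, s) \<in> V" if "q < p" for q c
    using that
  proof (induction q)
    case (Suc q)
    then show ?case using V_R[of "s + q" c] chain[of q] by simp
  qed simp
  have VV: "(cc q, s + q') \<in> V" if "q < p" "q' < p" for q q'
    using Vup that ccV by blast
  define \<mu> where "\<mu> = minor_mon s p cc id"
  have mu: "lookup \<mu> (c, r) = (if s \<le> r \<and> r < s + p \<and> c = cc (r - s) then 1 else 0)" for c r
  proof -
    show ?thesis
    proof (cases "s \<le> r \<and> r < s + p \<and> c = cc (r - s)")
      case True
      define d where "d = r - s"
      have d: "r = s + d" "d < p" "c = cc d" using True by (auto simp: d_def)
      have "q < p \<and> cc q = c \<and> s + id q = r \<longleftrightarrow> q = d" for q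
        using d by auto
      then have "{q \<in> {..<p}. cc q = c \<and> s + id q = r} = {d}" by auto
      then show ?thesis using True by (simp add: \<mu>_def lookup_minor_mon)
    next
      case False
      have "\<not> (q < p \<and> cc q = c \<and> s + id q = r)" for q
      proof
        assume "q < p \<and> cc q = c \<and> s + id q = r"
        then have "s \<le> r" "r < s + p" "c = cc (r - s)" by auto
        then show False using False by blast
      qed
      then have e: "{q \<in> {..<p}. cc q = c \<and> s + id q = r} = {}" by blast
      show ?thesis unfolding \<mu>_def lookup_minor_mon e using False by auto
    qed
  qed
  have le: "lookup \<mu> v \<le> lookup t v" for v
  proof (cases v)
    case (Pair c r)
    show ?thesis unfolding Pair mu using ccpos[of "r - s"] by (auto simp: Suc_le_eq)
  qed
  have csmu: "cs c r \<mu> = (if s \<le> r \<and> r < s + p \<and> cc (r - s) < c then 1 else 0)" for c r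
    unfolding cs_def mu by (cases "s \<le> r \<and> r < s + p") auto
  have "t - \<mu> \<in> Sig (\<lambda>r. \<Lambda> r - (if s \<le> r \<and> r < s + p then 1 else 0))"
    unfolding Sig_def mons_def
  proof (safe)
    fix c r assume "(c, r) \<in> keys (t - \<mu>)"
    then have "(c, r) \<in> keys t" by (auto simp: in_keys_iff lookup_minus)
    then show "(c, r) \<in> V" using tm by (auto simp: mons_def)
  next
    fix r assume r: "r < K"
    have "cc (r - s) < M" if "s \<le> r" "r < s + p" using ccM[of "r - s"] that by simp
    then show "cs M r (t - \<mu>) = \<Lambda> r - (if s \<le> r \<and> r < s + p then 1 else 0)"
      unfolding cs_diff[OF le] csmu using tm r by (auto simp: mons_def)
  next
    fix a c assume a: "a \<in> R" and c: "c < M"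
    have base: "cs (Suc c) (Suc a) t \<le> cs c a t" using t a c by (simp add: Sig_def)
    \<comment> \<open>If both rows lose a box, either both sides of the inequality drop or the left
      side is already zero. Below the last row of the minor, row \<open>Suc a\<close> is empty. In
      the third case the left side does not change and the right side cannot drop.\<close>
    consider "s \<le> a" "Suc a < s + p" | "s \<le> a" "Suc a = s + p" | "Suc a < s \<or> s + p \<le> a"
      using sR[OF a] by linarith
    then show "cs (Suc c) (Suc a) (t - \<mu>) \<le> cs c a (t - \<mu>)"
    proof cases
      case 1
      define q where "q = a - s"
      have q: "a = s + q" "Suc q < p" using 1 by (auto simp: q_def)
      show ?thesis
      proof (cases "cc (Suc q) \<le> c")
        case True
        then have "cc q < c" using ccSuc[OF q(2)] by simp
        then show ?thesis unfolding cs_diff[OF le] csmu using base True q by simp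
      next
        case False
        then have "cs (Suc c) (s + Suc q) t = 0" by (intro cs0) (use q in auto)
        then show ?thesis unfolding cs_diff[OF le] using q by simp
      qed
    next
      case 2
      then have "\<Lambda> (s + p) = 0" using sp a unfolding stop_def by (metis diff_Suc_1)
      then have "cs M (Suc a) t = 0" using tm R_less[OF a] 2 by (simp add: mons_def)
      then have "cs (Suc c) (Suc a) t = 0" using cs_mono[of "Suc c" M "Suc a" t] c by simp
      then show ?thesis unfolding cs_diff[OF le] by simp
    next
      case 3
      then show ?thesis unfolding cs_diff[OF le] csmu using base by auto
    qed
  qed
  moreover have "p > 0" using sp by (simp add: stop_def)
  ultimately show ?thesis using that[of p cc s] cc VV sR le unfolding \<mu>_def by blast
qed

lemma minor_Sp:
  assumes "\<And>q q'. q < p \<Longrightarrow> q' < p \<Longrightarrow> (cc q, s + q') \<in> V" and "\<And>a. a \<in> R \<Longrightarrow> Suc a \<noteq> s"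
    and "\<And>q q'. q < q' \<Longrightarrow> q' < p \<Longrightarrow> cc q < cc q'"
  shows "minor s p cc \<in> Sp (\<lambda>r. if s \<le> r \<and> r < s + p then 1 else 0)"
    and "\<And>u. u \<in> keys (minor s p cc) \<Longrightarrow> colsum c u = colsum c (minor_mon s p cc id)"
proof -
  have M: "cc q < M" if "q < p" for q using assms(1)[of q q] that V_sub by blast
  have K: "s + q < K" if "q < p" for q using assms(1)[of q q] that V_sub by blast
  have row: "cs M r (minor_mon s p cc \<pi>) = (if s \<le> r \<and> r < s + p then 1 else 0)" if \<pi>: "\<pi> permutes {..<p}" for \<pi> r
  proof -
    have "cs M r (minor_mon s p cc \<pi>) = (\<Sum>q<p. \<Sum>c<M. if c = cc q then if s + \<pi> q = r then 1 else 0 else 0)"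
      unfolding cs_def minor_mon_def lookup_sum lookup_single when_def
      by (subst sum.swap) (intro sum.cong refl, auto)
    also have "\<dots> = (\<Sum>q<p. if s + \<pi> q = r then 1 else 0)"
      by (intro sum.cong refl) (use M in simp)
    also have "\<dots> = (\<Sum>q<p. if s + q = r then 1 else 0)"
      using sum.permute[OF \<pi>, of "\<lambda>q. if s + q = r then 1 else (0 :: nat)"] by (simp add: comp_def)
    also have "\<dots> = (\<Sum>q<p. if q = r - s then if s \<le> r then 1 else 0 else 0)"
      by (intro sum.cong refl) auto
    also have "\<dots> = (if s \<le> r \<and> r < s + p then 1 else 0)" by auto
    finally show ?thesis .
  qed
  have sub: "keys (minor_mon s p cc \<pi>) \<subseteq> V" if \<pi>: "\<pi> permutes {..<p}" for \<pi>
  proof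
    fix v assume v: "v \<in> keys (minor_mon s p cc \<pi>)"
    obtain c r where cr: "v = (c, r)" by (cases v)
    have "{q \<in> {..<p}. cc q = c \<and> s + \<pi> q = r} \<noteq> {}"
      using v unfolding cr in_keys_iff lookup_minor_mon by (metis card.empty)
    then obtain q where "q < p" "cc q = c" "s + \<pi> q = r" by blast
    then show "v \<in> V" using assms(1)[of q "\<pi> q"] permutes_less[OF \<pi>] cr by auto
  qed
  show "minor s p cc \<in> Sp (\<lambda>r. if s \<le> r \<and> r < s + p then 1 else 0)"
    unfolding Sp_def mons_def using row sub raise_minor[of _ s p cc M] assms(2) M
    by (auto dest!: keys_minor)
  have col: "colsum c (minor_mon s p cc \<pi>) = card {q \<in> {..<p}. cc q = c}" if \<pi>: "\<pi> permutes {..<p}" for \<pi>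
  proof -
    have "colsum c (minor_mon s p cc \<pi>) = (\<Sum>q<p. \<Sum>r<K. if r = s + \<pi> q then if cc q = c then 1 else 0 else 0)"
      unfolding colsum_def minor_mon_def lookup_sum lookup_single when_def
      by (subst sum.swap) (intro sum.cong refl, auto)
    also have "\<dots> = (\<Sum>q<p. if cc q = c then 1 else 0)"
      by (intro sum.cong refl) (use K permutes_less[OF \<pi>] in simp)
    also have "\<dots> = card {q \<in> {..<p}. cc q = c}"
      by (subst sum.inter_filter[symmetric]) auto
    finally show ?thesis .
  qed
  show "colsum c u = colsum c (minor_mon s p cc id)" if u: "u \<in> keys (minor s p cc)" for u
    using keys_minor[OF u] col permutes_id by auto
qed

text \<open>Peeling off tableau columns writes \<open>t\<close> as a sum of diagonal monomials, and
  the product of the corresponding minors has leading monomial \<open>t\<close> with coefficient 1.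
  Minors are homogeneous in every column, hence the product is a weight vector for the column
  action.\<close>

theorem hw_exists:
  assumes "t \<in> Sig \<Lambda>"
  shows "\<exists>h\<in>Sp \<Lambda>. lm h t \<and> lookup h t = 1 \<and> (\<forall>u\<in>keys h. \<forall>c. colsum c u = colsum c t)"
  using assms
proof (induction "\<Sum>r<K. \<Lambda> r" arbitrary: t \<Lambda> rule: less_induct)
  case less
  have tm: "t \<in> mons \<Lambda>" using less.prems by (simp add: Sig_def)
  show ?case
  proof (cases "t = 0")
    case True
    then have "1 \<in> Sp \<Lambda>" using tm one_Sp by (auto simp: Sp_def mons_def)
    then show ?thesis by (intro bexI[of _ 1]) (auto simp: lm_def True lookup_one)
  next
    case False
    obtain s p cc where p: "p > 0" and cc: "\<And>q q'. q < q' \<Longrightarrow> q' < p \<Longrightarrow> cc q < cc q'"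
      and VV: "\<And>q q'. q < p \<Longrightarrow> q' < p \<Longrightarrow> (cc q, s + q') \<in> V"
      and sR: "\<And>a. a \<in> R \<Longrightarrow> Suc a \<noteq> s"
      and le: "\<And>v. lookup (minor_mon s p cc id) v \<le> lookup t v"
      and tS: "t - minor_mon s p cc id \<in> Sig (\<lambda>r. \<Lambda> r - (if s \<le> r \<and> r < s + p then 1 else 0))"
      by (rule Sig_split[OF less.prems False], rule that)
    let ?\<mu> = "minor_mon s p cc id" and ?\<Lambda>' = "\<lambda>r. \<Lambda> r - (if s \<le> r \<and> r < s + p then 1 else 0)"
    note mS = minor_Sp[of p cc s, OF VV sR cc]
    have lmm: "lm (minor s p cc) ?\<mu>" "lookup (minor s p cc) ?\<mu> = 1" using lm_minor[of p cc s] cc by blast+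
    have t: "t = ?\<mu> + (t - ?\<mu>)"
      by (rule poly_mapping_eqI) (use le in \<open>simp add: lookup_add lookup_minus\<close>)
    have mu1: "cs M r ?\<mu> = (if s \<le> r \<and> r < s + p then 1 else 0)" if "r < K" for r
      using mS(1) lmm(1) that unfolding Sp_def mons_def lm_def by blast
    have \<Lambda>ge: "(if s \<le> r \<and> r < s + p then 1 else 0) \<le> \<Lambda> r" if "r < K" for r
    proof -
      have "cs M r ?\<mu> \<le> cs M r t" unfolding cs_def by (rule sum_mono) (rule le)
      then show ?thesis using tm that mu1[OF that] by (simp add: mons_def)
    qed
    have sK: "s < K" using VV[of 0 0] p V_sub by force
    have "(\<Sum>r<K. ?\<Lambda>' r) < (\<Sum>r<K. \<Lambda> r)"
    proof (rule sum_strict_mono_ex1)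
      show "\<exists>r\<in>{..<K}. ?\<Lambda>' r < \<Lambda> r"
        by (rule bexI[of _ s]) (use \<Lambda>ge[OF sK] p sK in auto)
    qed auto
    from less.hyps[OF this tS] obtain h where h: "h \<in> Sp ?\<Lambda>'" "lm h (t - ?\<mu>)" "lookup h (t - ?\<mu>) = 1"
      "\<And>u c. u \<in> keys h \<Longrightarrow> colsum c u = colsum c (t - ?\<mu>)" by blast
    have "minor s p cc * h \<in> Sp (\<lambda>r. (if s \<le> r \<and> r < s + p then 1 else 0) + ?\<Lambda>' r)"
      by (rule Sp_mult[OF mS(1) h(1)])
    moreover have "mons (\<lambda>r. (if s \<le> r \<and> r < s + p then 1 else 0) + ?\<Lambda>' r) = mons \<Lambda>"
      unfolding mons_def using \<Lambda>ge by auto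
    ultimately have "minor s p cc * h \<in> Sp \<Lambda>" by (simp add: Sp_def)
    moreover have "lm (minor s p cc * h) t" "lookup (minor s p cc * h) t = 1"
      using lm_mult[OF lmm(1) h(2)] lmm(2) h(3) t by simp_all
    moreover have "colsum c u = colsum c t" if u: "u \<in> keys (minor s p cc * h)" for u c
    proof -
      obtain x y where "u = x + y" "x \<in> keys (minor s p cc)" "y \<in> keys h" using u keys_mult by blast
      then have "colsum c u = colsum c ?\<mu> + colsum c (t - ?\<mu>)"
        using mS(2) h(4) by (simp add: colsum_add)
      then show ?thesis using t colsum_add by metis
    qed
    ultimately show ?thesis by blast
  qed
qed

lemma finite_Sig: "finite (Sig \<Lambda>)"
proof -
  let ?N = "\<Sum>r<K. \<Lambda> r"
  have finV: "finite V" by (rule finite_subset[of _ "{..<M} \<times> {..<K}"]) (use V_sub in auto)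
  have "(\<lambda>t. restrict (lookup t) V) ` Sig \<Lambda> \<subseteq> PiE V (\<lambda>_. {..?N})"
  proof
    fix x assume "x \<in> (\<lambda>t. restrict (lookup t) V) ` Sig \<Lambda>"
    then obtain t where t: "x = restrict (lookup t) V" "t \<in> mons \<Lambda>" by (auto simp: Sig_def)
    have "lookup t (c, r) \<le> ?N" if "(c, r) \<in> V" for c r
    proof -
      have "lookup t (c, r) \<le> cs M r t"
        unfolding cs_def by (rule member_le_sum[of _ _ "\<lambda>c. lookup t (c, r)"]) (use V_sub that in auto)
      also have "\<dots> = \<Lambda> r" using t(2) V_sub[OF that] by (simp add: mons_def)
      also have "\<dots> \<le> ?N" by (rule member_le_sum) (use V_sub[OF that] in auto)
      finally show ?thesis .
    qed
    then show "x \<in> PiE V (\<lambda>_. {..?N})" unfolding t(1) by auto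
  qed
  moreover have "inj_on (\<lambda>t. restrict (lookup t) V) (Sig \<Lambda>)"
  proof (rule inj_onI)
    fix t u assume tu: "t \<in> Sig \<Lambda>" "u \<in> Sig \<Lambda>" "restrict (lookup t) V = restrict (lookup u) V"
    show "t = u"
    proof (rule poly_mapping_eqI)
      fix v :: "nat \<times> nat"
      show "lookup t v = lookup u v"
      proof (cases "v \<in> V")
        case True
        then show ?thesis using tu(3) by (metis restrict_apply')
      next
        case False
        then show ?thesis
            using tu(1,2) lookup_outside[of t \<Lambda>] lookup_outside[of u \<Lambda>] by (cases v) (auto simp: Sig_def)
      qed
    qed
  qed
  ultimately show ?thesis using finV finite_PiE by (metis finite_atMost finite_imageD finite_subset)
qed

text \<open>Leading monomials of nonzero elements of \<open>Sp \<Lambda>\<close> stay in the finite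
  set \<open>Sig \<Lambda>\<close>, so the number of its elements below the leading monomial can
  serve as measure.\<close>

lemma descent_induct:
  assumes "f \<in> Sp \<Lambda>"
    and zero: "P 0"
    and step: "\<And>f t. f \<in> Sp \<Lambda> \<Longrightarrow> lm f t \<Longrightarrow> t \<in> Sig \<Lambda> \<Longrightarrow>
      (\<And>g. g \<in> Sp \<Lambda> \<Longrightarrow> (\<And>s. lm g s \<Longrightarrow> mless s t) \<Longrightarrow> P g) \<Longrightarrow> P f"
  shows "P f"
  using assms(1)
proof (induction "card {s \<in> Sig \<Lambda>. \<exists>t. lm f t \<and> mless s t}" arbitrary: f rule: less_induct)
  case less
  show ?case
  proof (cases "f = 0")
    case True
    then show ?thesis using zero by simp
  next
    case False
    then obtain t where t: "lm f t" by (rule lm_exists)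
    have tS: "t \<in> Sig \<Lambda>" using lm_Sp_Sig[OF less.prems t] .
    have eq: "{s \<in> Sig \<Lambda>. \<exists>t. lm f t \<and> mless s t} = {s \<in> Sig \<Lambda>. mless s t}"
      using t lm_unique by blast
    show ?thesis
    proof (rule step[OF less.prems t tS])
      fix g assume g: "g \<in> Sp \<Lambda>" "\<And>s. lm g s \<Longrightarrow> mless s t"
      show "P g"
      proof (cases "g = 0")
        case True
        then show ?thesis using zero by simp
      next
        case False
        then obtain u where u: "lm g u" by (rule lm_exists)
        have uS: "u \<in> Sig \<Lambda>" using lm_Sp_Sig[OF g(1) u] .
        have "{s \<in> Sig \<Lambda>. \<exists>t. lm g t \<and> mless s t} = {s \<in> Sig \<Lambda>. mless s u}"
          using u lm_unique by blast
        moreover have "{s \<in> Sig \<Lambda>. mless s u} \<subset> {s \<in> Sig \<Lambda>. mless s t}"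
        proof (rule psubsetI)
          show "{s \<in> Sig \<Lambda>. mless s u} \<subseteq> {s \<in> Sig \<Lambda>. mless s t}"
            using mless_trans[OF _ g(2)[OF u]] by blast
          show "{s \<in> Sig \<Lambda>. mless s u} \<noteq> {s \<in> Sig \<Lambda>. mless s t}"
            using g(2)[OF u] uS mless_irrefl[of u] by blast
        qed
        ultimately have "card {s \<in> Sig \<Lambda>. \<exists>t. lm g t \<and> mless s t} < card {s \<in> Sig \<Lambda>. \<exists>t. lm f t \<and> mless s t}"
          unfolding eq using finite_Sig by (simp add: psubset_card_mono)
        then show ?thesis using less.hyps g(1) by blast
      qed
    qed
  qed
qed

lemma lm_cancel:
  assumes "lm f t" "lm g t" "lookup g t = 1" "lm (f - lookup f t *\<^sub>R g) s"
  shows "mless s t"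
proof -
  have s: "s \<in> keys (f - lookup f t *\<^sub>R g)" using assms(4) by (simp add: lm_def)
  then have "s \<noteq> t" using assms(3) by (auto simp: in_keys_iff lookup_minus)
  moreover have "s \<in> keys f \<or> s \<in> keys g" using s by (auto simp: in_keys_iff lookup_minus)
  ultimately show ?thesis using assms(1,2) by (auto simp: lm_def)
qed

definition hw :: "(nat \<Rightarrow> nat) \<Rightarrow> (nat \<times> nat \<Rightarrow>\<^sub>0 nat) \<Rightarrow> vpol" where
  "hw \<Lambda> t = (SOME h. h \<in> Sp \<Lambda> \<and> lm h t \<and> lookup h t = 1 \<and> (\<forall>u\<in>keys h. \<forall>c. colsum c u = colsum c t))"

lemma hw:
  assumes "t \<in> Sig \<Lambda>"
  shows "hw \<Lambda> t \<in> Sp \<Lambda>" "lm (hw \<Lambda> t) t" "lookup (hw \<Lambda> t) t = 1"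
    "\<And>u c. u \<in> keys (hw \<Lambda> t) \<Longrightarrow> colsum c u = colsum c t"
proof -
  have "\<exists>h. h \<in> Sp \<Lambda> \<and> lm h t \<and> lookup h t = 1 \<and> (\<forall>u\<in>keys h. \<forall>c. colsum c u = colsum c t)"
    using hw_exists[OF assms] by blast
  from someI_ex[OF this, folded hw_def]
  show "hw \<Lambda> t \<in> Sp \<Lambda>" "lm (hw \<Lambda> t) t" "lookup (hw \<Lambda> t) t = 1"
    "\<And>u c. u \<in> keys (hw \<Lambda> t) \<Longrightarrow> colsum c u = colsum c t" by blast+
qed

text \<open>Division by leading terms: subtracting a multiple of \<open>hw \<Lambda> t\<close>
  lowers the leading monomial.\<close>

lemma span_hw: "span (hw \<Lambda> ` Sig \<Lambda>) = Sp \<Lambda>"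
proof
  show "span (hw \<Lambda> ` Sig \<Lambda>) \<subseteq> Sp \<Lambda>"
    by (rule span_minimal) (use hw(1) subspace_Sp in auto)
  show "Sp \<Lambda> \<subseteq> span (hw \<Lambda> ` Sig \<Lambda>)"
  proof
    fix f assume "f \<in> Sp \<Lambda>"
    then show "f \<in> span (hw \<Lambda> ` Sig \<Lambda>)"
    proof (rule descent_induct)
      fix f t assume f: "f \<in> Sp \<Lambda>" "lm f t" "t \<in> Sig \<Lambda>"
        and IH: "\<And>g. g \<in> Sp \<Lambda> \<Longrightarrow> (\<And>s. lm g s \<Longrightarrow> mless s t) \<Longrightarrow> g \<in> span (hw \<Lambda> ` Sig \<Lambda>)"
      let ?g = "f - lookup f t *\<^sub>R hw \<Lambda> t"
      have "?g \<in> Sp \<Lambda>" using f(1) hw(1)[OF f(3)] subspace_Sp by (simp add: subspace_diff subspace_scale)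
      then have "?g \<in> span (hw \<Lambda> ` Sig \<Lambda>)" using lm_cancel[OF f(2) hw(2,3)[OF f(3)]] by (rule IH)
      moreover have "lookup f t *\<^sub>R hw \<Lambda> t \<in> span (hw \<Lambda> ` Sig \<Lambda>)" using f(3) by (intro span_scale span_base) auto
      ultimately have "?g + lookup f t *\<^sub>R hw \<Lambda> t \<in> span (hw \<Lambda> ` Sig \<Lambda>)" by (rule span_add)
      then show "f \<in> span (hw \<Lambda> ` Sig \<Lambda>)" by simp
    qed (rule span_zero)
  qed
qed

lemma independent_hw:
  assumes "(\<Sum>t\<in>Sig \<Lambda>. c t *\<^sub>R hw \<Lambda> t) = 0"
  shows "\<forall>t\<in>Sig \<Lambda>. c t = 0"
proof (rule ccontr)
  assume "\<not> (\<forall>t\<in>Sig \<Lambda>. c t = 0)"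
  define A where "A = {t \<in> Sig \<Lambda>. c t \<noteq> 0}"
  have A: "finite A" "A \<noteq> {}" using \<open>\<not> _\<close> finite_Sig unfolding A_def by auto
  \<comment> \<open>This polynomial with monomial set \<open>A\<close> only serves to obtain the
    largest element of \<open>A\<close> from \<open>lm_exists\<close>. There the combination has
    coefficient \<open>c t\<close>, because smaller basis elements do not reach it.\<close>
  have k: "keys (\<Sum>t\<in>A. single t (1 :: real)) = A"
    using A(1) by (auto simp: in_keys_iff lookup_sum lookup_single when_def sum.delta' split: if_splits)
  then have "(\<Sum>t\<in>A. single t (1 :: real)) \<noteq> 0" using A(2) by auto
  then obtain t where "lm (\<Sum>t\<in>A. single t (1 :: real)) t" by (rule lm_exists)
  then have t: "t \<in> Sig \<Lambda>" "c t \<noteq> 0" "\<And>s. s \<in> Sig \<Lambda> \<Longrightarrow> c s \<noteq> 0 \<Longrightarrow> s = t \<or> mless s t"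
    unfolding lm_def k by (auto simp: A_def)
  have "lookup (hw \<Lambda> s) t = 0" if s: "s \<in> Sig \<Lambda>" "c s \<noteq> 0" "s \<noteq> t" for s
  proof (rule ccontr)
    assume "lookup (hw \<Lambda> s) t \<noteq> 0"
    then have "t \<in> keys (hw \<Lambda> s)" by (simp add: in_keys_iff)
    then have "mless t s" using hw(2)[OF s(1)] s(3) by (auto simp: lm_def)
    then show False using t(3)[OF s(1,2)] s(3) mless_trans[of t s t] mless_irrefl by blast
  qed
  then have "lookup (\<Sum>s\<in>Sig \<Lambda>. c s *\<^sub>R hw \<Lambda> s) t = (\<Sum>s\<in>Sig \<Lambda>. if s = t then c t else 0)"
    unfolding lookup_sum using hw(3)[OF t(1)] by (intro sum.cong refl) auto
  also have "\<dots> = c t" using t(1) finite_Sig by simp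
  finally show False using assms t(2) by simp
qed

end

section \<open>Covariants of a block of variables\<close>

context unitary_module
begin

lemma in_span: "s \<in> I \<Longrightarrow> b s \<in> span (b ` I)"
  by (auto intro: span_base)

lemma matrix_sym: "i < n \<Longrightarrow> j < n \<Longrightarrow> ip (b s) (E i j (b t)) = ip (b t) (E j i (b s))"
  by (metis adj ip_commute)

lemma matrix_diag:
  "i < n \<Longrightarrow> s \<in> I \<Longrightarrow> t \<in> I \<Longrightarrow> ip (b s) (E i i (b t)) = (if s = t then real_of_int (\<kappa> s i) else 0)"
  using onb by (simp add: wt ip_scale_right orthonormal_def)

text \<open>Products of matrix entries are entries of the composed operators, since
  \<open>parseval_ip\<close> inserts the identity between them. Thus a unitary module yields
  matrices that can again act on columns.\<close>

lemma matrix_comm: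
  assumes "i < n" "j < n" "k < n" "l < n" "s \<in> I" "t \<in> I"
  shows "(\<Sum>x\<in>I. ip (b s) (E i j (b x)) * ip (b x) (E k l (b t)))
      - (\<Sum>x\<in>I. ip (b s) (E k l (b x)) * ip (b x) (E i j (b t)))
    = (if j = k then ip (b s) (E i l (b t)) else 0) - (if l = i then ip (b s) (E k j (b t)) else 0)"
proof -
  have *: "(\<Sum>x\<in>I. ip (b s) (E i j (b x)) * ip (b x) (E k l (b t))) = ip (b s) (E i j (E k l (b t)))"
    if "i < n" "j < n" "k < n" "l < n" for i j k l
  proof -
    have "ip (E j i (b s)) (E k l (b t)) = (\<Sum>x\<in>I. ip (E j i (b s)) (b x) * ip (b x) (E k l (b t)))"
      by (rule parseval_ip[OF finI onb]) (use that assms stab in_span in auto)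
    then show ?thesis using that by (simp add: adj)
  qed
  show ?thesis
    using assms comm[of i j k l "b t"] by (simp add: * ip_diff_right[symmetric] ip_minus_right)
qed

end

text \<open>A representation of \<open>gl_n\<close> by explicit real matrices in an orthonormal
  weight basis. Matrices are used instead of operators so that the columns of a new polynomial ring
  can carry any such representation, including direct sums, duals and Schur modules already
  constructed.\<close>

locale col_rep =
  fixes n M :: nat and e :: "nat \<Rightarrow> nat \<Rightarrow> nat \<Rightarrow> nat \<Rightarrow> real" and wt :: "nat \<Rightarrow> nat \<Rightarrow> int"
  assumes e_sym: "\<And>i j c d. i < n \<Longrightarrow> j < n \<Longrightarrow> c < M \<Longrightarrow> d < M \<Longrightarrow> e i j c d = e j i d c"
    and e_diag: "\<And>i c d. i < n \<Longrightarrow> c < M \<Longrightarrow> d < M \<Longrightarrow> e i i c d = (if c = d then real_of_int (wt c i) else 0)"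
    and e_comm: "\<And>i j k l c d. i < n \<Longrightarrow> j < n \<Longrightarrow> k < n \<Longrightarrow> l < n \<Longrightarrow> c < M \<Longrightarrow> d < M \<Longrightarrow>
      (\<Sum>x<M. e i j c x * e k l x d) - (\<Sum>x<M. e k l c x * e i j x d)
        = (if j = k then e i l c d else 0) - (if l = i then e k j c d else 0)"
    and wt_zero: "\<And>c i. c < M \<Longrightarrow> i \<ge> n \<Longrightarrow> wt c i = 0"

text \<open>The additional condition keeps the set \<open>V\<close> of variables stable under the
  column action.\<close>

locale block = shape K M V R + col_rep n M e wt
  for K M V R n e wt +
  assumes e_V: "\<And>i j c d r. i < n \<Longrightarrow> j < n \<Longrightarrow> c < M \<Longrightarrow> d < M \<Longrightarrow> e i j c d \<noteq> 0 \<Longrightarrow> (d, r) \<in> V \<Longrightarrow> (c, r) \<in> V"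
begin

text \<open>The extension, as a derivation, of the column representation applied simultaneously in
  every row.\<close>

definition Eop :: "nat \<Rightarrow> nat \<Rightarrow> vpol \<Rightarrow> vpol" where
  "Eop i j f = (\<Sum>r<K. \<Sum>d<M. \<Sum>c<M. e i j c d *\<^sub>R (X (c, r) * pd (d, r) f))"

lemma derivation_Eop: "derivation (Eop i j)"
  unfolding Eop_def[abs_def]
  by (intro derivation_sum derivation_scaleR derivation_mult_left derivation_pd)

lemmas linear_Eop = derivation_linear[OF derivation_Eop]

lemma Eop_X: "Eop i j (X (d, r)) = (if d < M \<and> r < K then \<Sum>c<M. e i j c d *\<^sub>R X (c, r) else 0)"
proof -
  let ?Q = "\<Sum>c<M. e i j c d *\<^sub>R X (c, r)"
  have "(\<Sum>c<M. e i j c d' *\<^sub>R (X (c, r') * pd (d', r') (X (d, r)))) = (if r' = r then if d' = d then ?Q else 0 else 0)" for r' d'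
    by (cases "r' = r"; cases "d' = d") (simp_all add: pd_X)
  then have "Eop i j (X (d, r)) = (\<Sum>r'<K. \<Sum>d'<M. if r' = r then if d' = d then ?Q else 0 else 0)"
    by (simp add: Eop_def)
  also have "\<dots> = (\<Sum>r'<K. if r' = r then \<Sum>d'<M. if d' = d then ?Q else 0 else 0)"
    by (intro sum.cong refl) auto
  finally show ?thesis by simp
qed

lemma Eop_adjoint:
  assumes "i < n" "j < n"
  shows "ip (Eop i j f) g = ip f (Eop j i g)"
proof -
  have "ip (Eop i j f) g = (\<Sum>r<K. \<Sum>d<M. \<Sum>c<M. e j i d c * ip f (X (d, r) * pd (c, r) g))"
    unfolding Eop_def ip_sum_left ip_scale_left ip_X_pd_adjoint
    by (intro sum.cong refl) (use assms e_sym in auto)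
  also have "\<dots> = (\<Sum>r<K. \<Sum>c<M. \<Sum>d<M. e j i d c * ip f (X (d, r) * pd (c, r) g))"
    by (intro sum.cong refl sum.swap)
  also have "\<dots> = ip f (Eop j i g)"
    unfolding Eop_def ip_sum_right ip_scale_right ..
  finally show ?thesis .
qed

lemma Eop_comm:
  assumes "i < n" "j < n" "k < n" "l < n"
  shows "Eop i j (Eop k l f) - Eop k l (Eop i j f) = (if j = k then Eop i l f else 0) - (if l = i then Eop k j f else 0)"
proof (rule derivation_ext[where D = "\<lambda>f. Eop i j (Eop k l f) - Eop k l (Eop i j f)"
      and D' = "\<lambda>f. (if j = k then Eop i l f else 0) - (if l = i then Eop k j f else 0)"])
  show "derivation (\<lambda>f. Eop i j (Eop k l f) - Eop k l (Eop i j f))"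
    by (intro derivation_commutator derivation_Eop)
  have z: "derivation (\<lambda>f. if P then D f else 0)" if "derivation D" for P and D :: "vpol \<Rightarrow> vpol"
    using that by (cases P) (auto simp: derivation_def linear_iff)
  show "derivation (\<lambda>f. (if j = k then Eop i l f else 0) - (if l = i then Eop k j f else 0))"
    by (intro derivation_diff z derivation_Eop)
  fix v :: "nat \<times> nat"
  obtain d r where v: "v = (d, r)" by (cases v)
  show "Eop i j (Eop k l (X v)) - Eop k l (Eop i j (X v))
      = (if j = k then Eop i l (X v) else 0) - (if l = i then Eop k j (X v) else 0)"
  proof (cases "d < M \<and> r < K")
    case False
    then have z: "Eop i j (X v) = 0" for i j unfolding v Eop_X by auto
    then show ?thesis by (simp add: linear_0[OF linear_Eop])
  next
    case True
    have "Eop i j (Eop k l (X v)) = (\<Sum>x<M. (\<Sum>c<M. e i j x c * e k l c d) *\<^sub>R X (x, r))" for i j k l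
    proof -
      have "Eop i j (Eop k l (X v)) = (\<Sum>c<M. e k l c d *\<^sub>R (\<Sum>x<M. e i j x c *\<^sub>R X (x, r)))"
        unfolding v using True by (simp add: Eop_X linear_sum[OF linear_Eop] linear_scale[OF linear_Eop])
      also have "\<dots> = (\<Sum>c<M. \<Sum>x<M. (e i j x c * e k l c d) *\<^sub>R X (x, r))"
        by (simp add: scaleR_sum_right mult.commute)
      finally show ?thesis by (subst (asm) sum.swap) (simp add: scaleR_sum_left)
    qed
    then have "Eop i j (Eop k l (X v)) - Eop k l (Eop i j (X v))
       = (\<Sum>x<M. ((\<Sum>c<M. e i j x c * e k l c d) - (\<Sum>c<M. e k l x c * e i j c d)) *\<^sub>R X (x, r))"
      by (simp add: sum_subtractf scaleR_diff_left)
    also have "\<dots> = (\<Sum>x<M. ((if j = k then e i l x d else 0) - (if l = i then e k j x d else 0)) *\<^sub>R X (x, r))"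
      by (intro sum.cong refl) (subst e_comm, use assms True in auto)
    also have "\<dots> = (if j = k then Eop i l (X v) else 0) - (if l = i then Eop k j (X v) else 0)"
      unfolding v using True by (simp add: Eop_X sum_subtractf scaleR_diff_left)
    finally show ?thesis .
  qed
qed

text \<open>Row operators and column operators act on different indices of the variables; therefore
  highest weight spaces for the rows are \<open>gl_n\<close>-modules.\<close>

lemma raise_Eop:
  assumes "a \<in> R"
  shows "raise M a (Eop i j f) = Eop i j (raise M a f)"
proof -
  have "raise M a (Eop i j f) - Eop i j (raise M a f) = 0"
  proof (rule derivation_ext[where D = "\<lambda>f. raise M a (Eop i j f) - Eop i j (raise M a f)" and D' = "\<lambda>_. 0"])
    show "derivation (\<lambda>f. raise M a (Eop i j f) - Eop i j (raise M a f))"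
      by (intro derivation_commutator derivation_Eop derivation_raise)
    show "derivation (\<lambda>_. 0 :: vpol)" by (simp add: derivation_def linear_iff)
    fix v :: "nat \<times> nat"
    obtain d r where v: "v = (d, r)" by (cases v)
    show "raise M a (Eop i j (X v)) - Eop i j (raise M a (X v)) = 0"
      using R_less[OF assms] unfolding v
      by (auto simp: Eop_X raise_X linear_0[OF linear_Eop] linear_0[OF linear_raise]
          linear_sum[OF linear_raise] linear_scale[OF linear_raise])
  qed
  then show ?thesis by simp
qed

lemma keys_Eop:
  assumes "t \<in> keys (Eop i j f)"
  obtains r c d where "r < K" "c < M" "d < M" "e i j c d \<noteq> 0" "t \<in> keys (X (c, r) * pd (d, r) f)"
proof (rule ccontr)
  note found = that
  assume no: "\<not> thesis"
  have "e i j c d * lookup (X (c, r) * pd (d, r) f) t = 0" if "r < K" "c < M" "d < M" for r c d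
  proof (rule ccontr)
    assume "e i j c d * lookup (X (c, r) * pd (d, r) f) t \<noteq> 0"
    then show False using found[OF that] no by (simp add: in_keys_iff)
  qed
  then have "lookup (Eop i j f) t = 0"
    unfolding Eop_def lookup_sum lookup_scaleR real_scaleR_def by (intro sum.neutral ballI) auto
  then show False using assms by (simp add: in_keys_iff)
qed

lemma Eop_Sp:
  assumes "i < n" "j < n" "f \<in> Sp \<Lambda>"
  shows "Eop i j f \<in> Sp \<Lambda>"
  unfolding Sp_def
proof (safe)
  fix t assume "t \<in> keys (Eop i j f)"
  then obtain r c d where rcd: "r < K" "c < M" "d < M" "e i j c d \<noteq> 0" "t \<in> keys (X (c, r) * pd (d, r) f)"
    by (rule keys_Eop)
  then obtain s where s: "s \<in> keys f" "lookup s (d, r) > 0" "t = s - single (d, r) 1 + single (c, r) 1"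
    by (elim keys_X_pd)
  have sm: "s \<in> mons \<Lambda>" using s(1) assms(3) by (auto simp: Sp_def)
  have "(d, r) \<in> V" using lookup_outside[OF sm, of d r] s(2) by auto
  then have cV: "(c, r) \<in> V" using e_V rcd assms by blast
  show "t \<in> mons \<Lambda>"
    unfolding mons_def
  proof (safe)
    fix x y assume "(x, y) \<in> keys t"
    then have "(x, y) \<in> keys s \<or> (x, y) = (c, r)"
      unfolding s(3) by (auto simp: in_keys_iff lookup_add lookup_minus lookup_single when_def split: if_splits)
    then show "(x, y) \<in> V" using sm cV by (auto simp: mons_def)
  next
    fix q assume "q < K"
    have "int (cs M q t) = int (cs M q s)"
      unfolding s(3) cs_move[OF s(2)] using rcd by simp
    then show "cs M q t = \<Lambda> q" using sm \<open>q < K\<close> by (simp add: mons_def)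
  qed
next
  fix a assume "a \<in> R"
  then show "raise M a (Eop i j f) = 0" using assms(3) by (simp add: raise_Eop Sp_def linear_0[OF linear_Eop])
qed

definition mwt :: "(nat \<times> nat \<Rightarrow>\<^sub>0 nat) \<Rightarrow> nat \<Rightarrow> int" where
  "mwt t i = (\<Sum>c<M. wt c i * int (colsum c t))"

definition wspace :: "(nat \<Rightarrow> int) \<Rightarrow> vpol set" where
  "wspace \<xi> = {f. \<forall>t\<in>keys f. mwt t = \<xi>}"

lemma subspace_wspace: "subspace (wspace \<xi>)"
  unfolding subspace_def wspace_def
  using keys_add keys_scaleR by (auto dest!: subsetD[OF keys_add] subsetD[OF keys_scaleR])

lemma Eop_diag:
  assumes "i < n" "f \<in> wspace \<xi>"
  shows "Eop i i f = real_of_int (\<xi> i) *\<^sub>R f"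
proof (rule poly_mapping_eqI)
  fix t
  have "lookup (Eop i i f) t = (\<Sum>r<K. \<Sum>d<M. real_of_int (wt d i) * (real (lookup t (d, r)) * lookup f t))"
    unfolding Eop_def lookup_sum lookup_scaleR real_scaleR_def
  proof (intro sum.cong refl)
    fix r d assume "r \<in> {..<K}" "d \<in> {..<M}"
    then have "(\<Sum>c<M. e i i c d * lookup (X (c, r) * pd (d, r) f) t)
      = (\<Sum>c<M. if c = d then real_of_int (wt d i) * lookup (X (d, r) * pd (d, r) f) t else 0)"
      by (intro sum.cong refl) (use e_diag[OF assms(1)] in auto)
    then show "(\<Sum>c<M. e i i c d * lookup (X (c, r) * pd (d, r) f) t) = real_of_int (wt d i) * (real (lookup t (d, r)) * lookup f t)"
      using \<open>d \<in> {..<M}\<close> by (simp add: lookup_X_pd_same)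
  qed
  also have "\<dots> = (\<Sum>d<M. \<Sum>r<K. real_of_int (wt d i) * (real (lookup t (d, r)) * lookup f t))"
    by (rule sum.swap)
  also have "\<dots> = real_of_int (mwt t i) * lookup f t"
    by (simp add: mwt_def colsum_def sum_distrib_left sum_distrib_right mult.assoc)
  also have "\<dots> = real_of_int (\<xi> i) * lookup f t"
    using assms(2) by (cases "t \<in> keys f") (auto simp: wspace_def in_keys_iff)
  finally show "lookup (Eop i i f) t = lookup (real_of_int (\<xi> i) *\<^sub>R f) t" by simp
qed

text \<open>The products of minors in \<open>hw\<close> form a weight basis, and
  \<open>gram_schmidt\<close> graded by weight makes it orthonormal without changing the weights.
  Hence the weights of \<open>Sp \<Lambda>\<close> can be counted on the cone
  \<open>Sig \<Lambda>\<close>.\<close>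

theorem unitary_exists:
  "\<exists>b. unitary_module n Eop (Sig \<Lambda>) b mwt \<and> span (b ` Sig \<Lambda>) = Sp \<Lambda>"
proof -
  have "\<exists>b. orthonormal (Sig \<Lambda>) b \<and> (\<forall>t\<in>Sig \<Lambda>. b t \<in> wspace (mwt t) \<and> b t \<in> span (hw \<Lambda> ` Sig \<Lambda>) \<and> hw \<Lambda> t \<in> span (b ` Sig \<Lambda>))"
  proof (rule gram_schmidt[where W = wspace and \<kappa> = mwt])
    show "finite (Sig \<Lambda>)" by (rule finite_Sig)
    show "subspace (wspace k)" for k by (rule subspace_wspace)
    show "ip f g = 0" if "k \<noteq> k'" "f \<in> wspace k" "g \<in> wspace k'" for k k' f g
      by (rule ip_disjoint) (use that in \<open>auto simp: wspace_def\<close>)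
    show "hw \<Lambda> t \<in> wspace (mwt t)" if "t \<in> Sig \<Lambda>" for t
      using hw(4)[OF that] by (auto simp: wspace_def mwt_def fun_eq_iff)
  qed (rule independent_hw)
  then obtain b where b: "orthonormal (Sig \<Lambda>) b" "\<And>t. t \<in> Sig \<Lambda> \<Longrightarrow> b t \<in> wspace (mwt t)"
    "\<And>t. t \<in> Sig \<Lambda> \<Longrightarrow> b t \<in> span (hw \<Lambda> ` Sig \<Lambda>)" "\<And>t. t \<in> Sig \<Lambda> \<Longrightarrow> hw \<Lambda> t \<in> span (b ` Sig \<Lambda>)" by blast
  have sp: "span (b ` Sig \<Lambda>) = Sp \<Lambda>"
  proof
    show "span (b ` Sig \<Lambda>) \<subseteq> Sp \<Lambda>"
      by (rule span_minimal[OF _ subspace_Sp]) (use b(3) span_hw in blast)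
    show "Sp \<Lambda> \<subseteq> span (b ` Sig \<Lambda>)"
      unfolding span_hw[symmetric] by (rule span_minimal[OF _ subspace_span]) (use b(4) in blast)
  qed
  have "unitary_module n Eop (Sig \<Lambda>) b mwt"
  proof (rule unitary_module.intro)
    show "finite (Sig \<Lambda>)" by (rule finite_Sig)
    show "orthonormal (Sig \<Lambda>) b" by (rule b(1))
    show "Eop i i (b s) = real_of_int (mwt s i) *\<^sub>R b s" if "i < n" "s \<in> Sig \<Lambda>" for i s
      using Eop_diag[OF that(1) b(2)[OF that(2)]] .
    show "mwt s i = 0" if "s \<in> Sig \<Lambda>" "i \<ge> n" for s i using that wt_zero by (simp add: mwt_def)
    show "linear (Eop i j)" for i j by (rule linear_Eop)
    show "ip (Eop i j f) g = ip f (Eop j i g)" if "i < n" "j < n" for i j f g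
      by (rule Eop_adjoint[OF that])
    show "Eop i j (Eop k l f) - Eop k l (Eop i j f) = (if j = k then Eop i l f else 0) - (if l = i then Eop k j f else 0)"
      if "i < n" "j < n" "k < n" "l < n" for i j k l f by (rule Eop_comm[OF that])
    show "Eop i j f \<in> span (b ` Sig \<Lambda>)" if "i < n" "j < n" "f \<in> span (b ` Sig \<Lambda>)" for i j f
      using that Eop_Sp unfolding sp by blast
  qed
  then show ?thesis using sp by blast
qed

definition cov :: "(nat \<Rightarrow> nat) \<Rightarrow> vpol set" where
  "cov \<Lambda> = {f \<in> Sp \<Lambda>. \<forall>i<n. \<forall>j<n. Eop i j f = 0}"

lemma cov_eq_Inv:
  assumes "unitary_module n Eop (Sig \<Lambda>) b mwt" "span (b ` Sig \<Lambda>) = Sp \<Lambda>"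
  shows "unitary_module.Inv n Eop (Sig \<Lambda>) b = cov \<Lambda>"
  unfolding unitary_module.Inv_def[OF assms(1)] cov_def assms(2) ..

theorem dim_cov:
  "real (dim (cov \<Lambda>)) = (\<Sum>w | w permutes {..<n}. real_of_int (sign w) * real (card {t \<in> Sig \<Lambda>. mwt t = wshift w}))"
proof -
  obtain b where b: "unitary_module n Eop (Sig \<Lambda>) b mwt" "span (b ` Sig \<Lambda>) = Sp \<Lambda>"
    using unitary_exists by blast
  show ?thesis using unitary_module.dim_Inv[OF b(1)] unfolding cov_eq_Inv[OF b] .
qed

lemma reynolds_cov:
  assumes "f \<in> Sp \<Lambda>"
  obtains q u where "q \<in> cov \<Lambda>" "\<And>i j. i < n \<Longrightarrow> j < n \<Longrightarrow> u i j \<in> Sp \<Lambda>"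
    "f = q + (\<Sum>i<n. \<Sum>j<n. Eop i j (u i j))"
proof -
  obtain b where b: "unitary_module n Eop (Sig \<Lambda>) b mwt" "span (b ` Sig \<Lambda>) = Sp \<Lambda>"
    using unitary_exists by blast
  show ?thesis
    by (rule unitary_module.reynolds[OF b(1), of f]) (use assms that in \<open>auto simp: b(2) cov_eq_Inv[OF b]\<close>)
qed

lemma subspace_cov: "subspace (cov \<Lambda>)"
  using subspace_Sp[of \<Lambda>] unfolding subspace_def cov_def
  by (auto simp: linear_0[OF linear_Eop] linear_add[OF linear_Eop] linear_scale[OF linear_Eop])

lemma cov_Sp: "f \<in> cov \<Lambda> \<Longrightarrow> f \<in> Sp \<Lambda>"
  by (simp add: cov_def)

lemma cov_mult: "f \<in> cov \<Lambda> \<Longrightarrow> g \<in> cov \<Lambda>' \<Longrightarrow> f * g \<in> cov (\<lambda>r. \<Lambda> r + \<Lambda>' r)"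
  using Sp_mult[of f \<Lambda> g \<Lambda>'] by (simp add: cov_def derivation_mult[OF derivation_Eop])

lemma cov_basis:
  obtains B where "finite B" "B \<subseteq> cov \<Lambda>" "independent B" "cov \<Lambda> \<subseteq> span B" "card B = dim (cov \<Lambda>)"
proof -
  obtain B where B: "B \<subseteq> cov \<Lambda>" "independent B" "cov \<Lambda> \<subseteq> span B" "card B = dim (cov \<Lambda>)"
    using basis_exists[of "cov \<Lambda>"] by blast
  have "B \<subseteq> span (hw \<Lambda> ` Sig \<Lambda>)" using B(1) cov_Sp unfolding span_hw by blast
  then have "finite B" using independent_span_bound[of "hw \<Lambda> ` Sig \<Lambda>" B] finite_Sig B(2) by blast
  then show ?thesis using B that by blast
qed

theorem dim_cov_mono:
  assumes "f \<in> cov \<Lambda>'" "f \<noteq> 0"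
  shows "dim (cov \<Lambda>) \<le> dim (cov (\<lambda>r. \<Lambda> r + \<Lambda>' r))"
proof -
  obtain B where B: "finite B" "B \<subseteq> cov \<Lambda>" "independent B" "card B = dim (cov \<Lambda>)" by (rule cov_basis)
  obtain B' where B': "finite B'" "cov (\<lambda>r. \<Lambda> r + \<Lambda>' r) \<subseteq> span B'" "card B' = dim (cov (\<lambda>r. \<Lambda> r + \<Lambda>' r))"
    by (rule cov_basis)
  have lin: "linear (\<lambda>g. g * f)" by (simp add: linear_iff algebra_simps)
  have inj: "inj (\<lambda>g. g * f)" using assms(2) by (auto intro: injI)
  have "independent ((\<lambda>g. g * f) ` B)"
    using lin B(3) inj by (metis inj_on_subset linear_independent_injective_image subset_UNIV)
  moreover have "(\<lambda>g. g * f) ` B \<subseteq> span B'" using B(2) cov_mult assms(1) B'(2) by blast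
  ultimately have "card ((\<lambda>g. g * f) ` B) \<le> card B'" using independent_span_bound B'(1) by blast
  moreover have "card ((\<lambda>g. g * f) ` B) = card B" using inj by (metis card_image inj_on_subset subset_UNIV)
  ultimately show ?thesis using B(4) B'(3) by simp
qed

end

section \<open>Finite generation and boundedness along a ray of degrees\<close>

lemma dickson:
  fixes sv :: "'p \<Rightarrow> 'x \<Rightarrow> nat"
  assumes "finite S"
  shows "\<exists>G\<subseteq>A. finite G \<and> (\<forall>a\<in>A. \<exists>g\<in>G. \<forall>x\<in>S. sv g x \<le> sv a x)"
  using assms
proof (induction S arbitrary: A)
  case empty
  show ?case
  proof (cases "A = {}")
    case False
    then obtain a where "a \<in> A" by blast
    then show ?thesis by (intro exI[of _ "{a}"]) auto
  qed auto
next
  case (insert y S)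
  obtain G where G: "G \<subseteq> A" "finite G" "\<forall>a\<in>A. \<exists>g\<in>G. \<forall>x\<in>S. sv g x \<le> sv a x"
    using insert.IH[of A] by blast
  have "\<forall>k. \<exists>H\<subseteq>{a \<in> A. sv a y = k}. finite H \<and> (\<forall>a\<in>{a \<in> A. sv a y = k}. \<exists>g\<in>H. \<forall>x\<in>S. sv g x \<le> sv a x)"
    by (rule allI) (rule insert.IH)
  from choice[OF this] obtain H where H': "\<forall>k. H k \<subseteq> {a \<in> A. sv a y = k} \<and> finite (H k) \<and>
      (\<forall>a\<in>{a \<in> A. sv a y = k}. \<exists>g\<in>H k. \<forall>x\<in>S. sv g x \<le> sv a x)" ..
  then have H: "\<And>k. H k \<subseteq> {a \<in> A. sv a y = k}" "\<And>k. finite (H k)"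
    "\<And>k a. a \<in> A \<Longrightarrow> sv a y = k \<Longrightarrow> \<exists>g\<in>H k. \<forall>x\<in>S. sv g x \<le> sv a x"
    by simp_all
  \<comment> \<open>Where the comparison with \<open>G\<close> fails at the new coordinate
    \<open>y\<close>, that coordinate is below \<open>N\<close>; finitely many values remain, each
    with its own finite family \<open>H k\<close>. The inserted 0 covers an empty
    \<open>G\<close>.\<close>
  define N where "N = Max (insert 0 ((\<lambda>g. sv g y) ` G))"
  have N: "sv g y \<le> N" if "g \<in> G" for g unfolding N_def using G(2) that by (intro Max_ge) auto
  have "\<exists>g\<in>G \<union> (\<Union>k\<le>N. H k). \<forall>x\<in>insert y S. sv g x \<le> sv a x" if a: "a \<in> A" for a
  proof -
    obtain g where g: "g \<in> G" "\<forall>x\<in>S. sv g x \<le> sv a x" using G(3) a by blast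
    show ?thesis
    proof (cases "sv g y \<le> sv a y")
      case True
      then show ?thesis using g by auto
    next
      case False
      then have "sv a y \<le> N" using N[OF g(1)] by simp
      moreover obtain h where "h \<in> H (sv a y)" "\<forall>x\<in>S. sv h x \<le> sv a x" using H(3)[OF a refl] by blast
      moreover have "sv h y = sv a y" using H(1) calculation(2) by blast
      ultimately show ?thesis by (intro bexI[of _ h]) auto
    qed
  qed
  moreover have "G \<union> (\<Union>k\<le>N. H k) \<subseteq> A" using G(1) H(1) by blast
  moreover have "finite (G \<union> (\<Union>k\<le>N. H k))" using G(2) H(2) by blast
  ultimately show ?case by blast
qed

locale stable_block = block K M V R n e wt for K M V R n e wt +
  fixes \<Lambda> \<Lambda>' :: "nat \<Rightarrow> nat"
begin

abbreviation L :: "nat \<Rightarrow> nat \<Rightarrow> nat" where "L D \<equiv> \<lambda>r. \<Lambda> r + D * \<Lambda>' r"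
abbreviation N :: "nat \<Rightarrow> nat \<Rightarrow> nat" where "N d \<equiv> \<lambda>r. d * \<Lambda>' r"

text \<open>The part of degree \<open>D\<close> of the graded module generated by \<open>A\<close>
  over the ring with pieces \<open>Sp (N q)\<close>. A generator is stored together with its
  degree.\<close>

definition J :: "(nat \<times> vpol) set \<Rightarrow> nat \<Rightarrow> vpol set" where
  "J A D = span {r * a | r a d. (d, a) \<in> A \<and> d \<le> D \<and> r \<in> Sp (N (D - d))}"

abbreviation full :: "(nat \<times> vpol) set" where "full \<equiv> {(d, a). a \<in> cov (L d)}"

lemma J_mono: "A \<subseteq> B \<Longrightarrow> J A D \<subseteq> J B D"
  unfolding J_def by (rule span_mono) blast

lemma J_mult:
  assumes "s \<in> Sp (N q)" "x \<in> J A D"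
  shows "s * x \<in> J A (D + q)"
  using assms(2) unfolding J_def
proof (induction rule: span_induct_alt)
  case base
  then show ?case by (simp add: span_zero)
next
  case (step c x y)
  then obtain r a d where r: "x = r * a" "(d, a) \<in> A" "d \<le> D" "r \<in> Sp (N (D - d))" by blast
  have "s * r \<in> Sp (\<lambda>t. N q t + N (D - d) t)" using Sp_mult[OF assms(1) r(4)] .
  also have "(\<lambda>t. N q t + N (D - d) t) = N (D + q - d)"
  proof
    fix t
    have "q + (D - d) = D + q - d" using r(3) by simp
    then show "N q t + N (D - d) t = N (D + q - d) t" by (metis add_mult_distrib)
  qed
  finally have sr: "s * r \<in> Sp (N (D + q - d))" .
  have "(s * r) * a \<in> {r * a | r a d. (d, a) \<in> A \<and> d \<le> D + q \<and> r \<in> Sp (N (D + q - d))}"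
    by (intro CollectI exI[of _ "s * r"] exI[of _ a] exI[of _ d]) (use r sr in simp)
  then have "c *\<^sub>R ((s * r) * a) + s * y \<in> span {r * a | r a d. (d, a) \<in> A \<and> d \<le> D + q \<and> r \<in> Sp (N (D + q - d))}"
    using step.IH by (intro span_add span_scale) (auto intro: span_base)
  then show ?case by (simp add: r(1) algebra_simps)
qed

lemma J_finite:
  assumes "f \<in> J B D"
  shows "\<exists>A\<subseteq>B. finite A \<and> f \<in> J A D"
  using assms unfolding J_def[of B]
proof (induction rule: span_induct_alt)
  case base
  then show ?case by (intro exI[of _ "{}"]) (simp add: J_def span_zero)
next
  case (step c x y)
  then obtain r a d where r: "x = r * a" "(d, a) \<in> B" "d \<le> D" "r \<in> Sp (N (D - d))" by blast
  obtain A where A: "A \<subseteq> B" "finite A" "y \<in> J A D" using step.IH by blast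
  have "x \<in> J (insert (d, a) A) D" unfolding J_def using r by (intro span_base) blast
  moreover have "y \<in> J (insert (d, a) A) D" using A(3) J_mono[of A "insert (d, a) A" D] by blast
  ultimately have "c *\<^sub>R x + y \<in> J (insert (d, a) A) D" unfolding J_def by (intro span_add span_scale)
  then show ?case using A r(2) by (intro exI[of _ "insert (d, a) A"]) auto
qed

lemma J_Sp: "A \<subseteq> full \<Longrightarrow> J A D \<subseteq> Sp (L D)"
  unfolding J_def
proof (rule span_minimal[OF _ subspace_Sp], safe)
  fix r a d assume "A \<subseteq> full" "(d, a) \<in> A" and d: "d \<le> D" and r: "r \<in> Sp (N (D - d))"
  then have "a \<in> Sp (L d)" using cov_Sp by blast
  then have "r * a \<in> Sp (\<lambda>t. N (D - d) t + L d t)" using Sp_mult r by blast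
  also have "(\<lambda>t. N (D - d) t + L d t) = L D"
  proof
    fix t
    have "(D - d) * \<Lambda>' t + d * \<Lambda>' t = D * \<Lambda>' t" using d by (simp add: add_mult_distrib[symmetric])
    then show "N (D - d) t + L d t = L D t" by simp
  qed
  finally show "r * a \<in> Sp (L D)" .
qed

lemma cov_J: "a \<in> cov (L D) \<Longrightarrow> a \<in> J full D"
  unfolding J_def
  by (intro span_base CollectI exI[of _ 1] exI[of _ a] exI[of _ D]) (use one_Sp in simp)

text \<open>Three kinds of coordinates: the exponents, the gaps in the interlacing inequalities, and
  the degree along the ray. The last one guarantees that the quotient of two comparable monomials
  has a degree \<open>N (D - D0)\<close>.\<close>

definition slack :: "nat \<times> (nat \<times> nat \<Rightarrow>\<^sub>0 nat) \<Rightarrow> (nat \<times> nat) + (nat \<times> nat) + unit \<Rightarrow> nat" where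
  "slack p x = (case x of Inl v \<Rightarrow> lookup (snd p) v
     | Inr (Inl (a, c)) \<Rightarrow> cs c a (snd p) - cs (Suc c) (Suc a) (snd p) | Inr (Inr _) \<Rightarrow> fst p)"

definition slacks :: "((nat \<times> nat) + (nat \<times> nat) + unit) set" where
  "slacks = Inl ` V \<union> (Inr \<circ> Inl) ` (R \<times> {..<M}) \<union> {Inr (Inr ())}"

lemma finite_slacks: "finite slacks"
proof -
  have "finite V" by (rule finite_subset[of _ "{..<M} \<times> {..<K}"]) (use V_sub in auto)
  moreover have "finite R" by (rule finite_subset[of _ "{..<K}"]) (use R_less in \<open>auto dest: Suc_lessD\<close>)
  ultimately show ?thesis by (simp add: slacks_def)
qed

text \<open>The slacks of the interlacing inequalities turn divisibility inside the cone \<open>Sig\<close> into the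
  componentwise order, so Dickson's lemma applies although the cone is not free.\<close>

lemma slack_diff:
  assumes t0: "t0 \<in> Sig (L D0)" and t: "t \<in> Sig (L D)"
    and le: "\<And>x. x \<in> slacks \<Longrightarrow> slack (D0, t0) x \<le> slack (D, t) x"
  shows "D0 \<le> D" "t = t0 + (t - t0)" "t - t0 \<in> Sig (N (D - D0))"
proof -
  show D: "D0 \<le> D" using le[of "Inr (Inr ())"] by (simp add: slack_def slacks_def)
  have tm: "t \<in> mons (L D)" "t0 \<in> mons (L D0)" using t t0 by (auto simp: Sig_def)
  have lk: "lookup t0 v \<le> lookup t v" for v
  proof (cases "v \<in> V")
    case True
    then show ?thesis using le[of "Inl v"] by (simp add: slack_def slacks_def)
  next
    case False
    then show ?thesis using lookup_outside[OF tm(2)] by (cases v) simp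
  qed
  show "t = t0 + (t - t0)" by (rule poly_mapping_eqI) (use lk in \<open>simp add: lookup_add lookup_minus\<close>)
  show "t - t0 \<in> Sig (N (D - D0))"
    unfolding Sig_def mons_def
  proof (safe)
    fix c r assume "(c, r) \<in> keys (t - t0)"
    then have "(c, r) \<in> keys t" by (auto simp: in_keys_iff lookup_minus)
    then show "(c, r) \<in> V" using tm by (auto simp: mons_def)
  next
    fix r assume "r < K"
    then have "cs M r t = L D r" "cs M r t0 = L D0 r" using tm by (auto simp: mons_def)
    then show "cs M r (t - t0) = N (D - D0) r" using D by (simp add: cs_diff[OF lk] diff_mult_distrib)
  next
    fix a c assume a: "a \<in> R" "c < M"
    then have "cs c a t0 - cs (Suc c) (Suc a) t0 \<le> cs c a t - cs (Suc c) (Suc a) t"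
      using le[of "Inr (Inl (a, c))"] by (simp add: slack_def slacks_def image_iff)
    moreover have "cs (Suc c) (Suc a) t0 \<le> cs c a t0" "cs (Suc c) (Suc a) t \<le> cs c a t"
      using t t0 a by (auto simp: Sig_def)
    moreover have "cs x y t0 \<le> cs x y t" for x y unfolding cs_def by (rule sum_mono) (rule lk)
    ultimately show "cs (Suc c) (Suc a) (t - t0) \<le> cs c a (t - t0)"
      unfolding cs_diff[OF lk] by arith
  qed
qed

text \<open>A Groebner basis argument inside the cone. Dickson's lemma selects finitely many leading
  monomials with their degrees; any other leading monomial differs from one of these by an element
  of the cone, which is itself the leading monomial of a ring element. Reduction then terminates by
  \<open>descent_induct\<close>.\<close>

lemma J_noetherian:
  "\<exists>A\<subseteq>full. finite A \<and> (\<forall>D. J full D \<subseteq> J A D)"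
proof -
  define T where "T = {(D, t). \<exists>g\<in>J full D. lm g t}"
  obtain G where G: "G \<subseteq> T" "finite G" "\<forall>a\<in>T. \<exists>g\<in>G. \<forall>x\<in>slacks. slack g x \<le> slack a x"
    using dickson[OF finite_slacks, of T slack] by blast
  have "\<forall>p\<in>G. \<exists>g. g \<in> J full (fst p) \<and> lm g (snd p)"
  proof
    fix p assume "p \<in> G"
    then have "p \<in> T" using G(1) by blast
    then show "\<exists>g. g \<in> J full (fst p) \<and> lm g (snd p)" unfolding T_def by (cases p) auto
  qed
  from bchoice[OF this] obtain g where g: "\<forall>p\<in>G. g p \<in> J full (fst p) \<and> lm (g p) (snd p)" ..
  have "\<forall>p\<in>G. \<exists>A. A \<subseteq> full \<and> finite A \<and> g p \<in> J A (fst p)"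
  proof
    fix p assume "p \<in> G"
    then have "g p \<in> J full (fst p)" using g by simp
    from J_finite[OF this] show "\<exists>A. A \<subseteq> full \<and> finite A \<and> g p \<in> J A (fst p)" by simp
  qed
  \<comment> \<open>The selected elements \<open>g p\<close> need not be covariants, but each is a
    finite combination of covariants, and these are collected as the generators.\<close>
  from bchoice[OF this] obtain A where A: "\<forall>p\<in>G. A p \<subseteq> full \<and> finite (A p) \<and> g p \<in> J (A p) (fst p)" ..
  define A' where "A' = (\<Union>p\<in>G. A p)"
  have A': "A' \<subseteq> full" "finite A'" using A G(2) unfolding A'_def by (blast, simp)
  have gA: "g p \<in> J A' (fst p)" if "p \<in> G" for p
  proof -
    have "A p \<subseteq> A'" using that by (auto simp: A'_def)
    then show ?thesis using J_mono[of "A p" A' "fst p"] A that by blast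
  qed
  have "f \<in> J full D \<longrightarrow> f \<in> J A' D" if "f \<in> Sp (L D)" for f D
    using that
  proof (rule descent_induct)
    show "0 \<in> J full D \<longrightarrow> 0 \<in> J A' D" by (simp add: J_def span_zero)
    fix f t assume f: "f \<in> Sp (L D)" "lm f t" "t \<in> Sig (L D)"
      and IH: "\<And>g. g \<in> Sp (L D) \<Longrightarrow> (\<And>s. lm g s \<Longrightarrow> mless s t) \<Longrightarrow> g \<in> J full D \<longrightarrow> g \<in> J A' D"
    show "f \<in> J full D \<longrightarrow> f \<in> J A' D"
    proof
      assume fJ: "f \<in> J full D"
      then have "(D, t) \<in> T" using f(2) by (auto simp: T_def)
      then obtain D0 t0 where p: "(D0, t0) \<in> G" "\<And>x. x \<in> slacks \<Longrightarrow> slack (D0, t0) x \<le> slack (D, t) x"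
        by (metis G(3) surj_pair)
      let ?g = "g (D0, t0)"
      have g0: "?g \<in> J full D0" "lm ?g t0" "?g \<in> J A' D0" using bspec[OF g p(1)] gA[OF p(1)] by simp_all
      have "?g \<in> Sp (L D0)" using g0(1) J_Sp[of full D0] by blast
      then have t0: "t0 \<in> Sig (L D0)" using lm_Sp_Sig g0(2) by blast
      note sd = slack_diff[OF t0 f(3) p(2)]
      \<comment> \<open>The multiplier exists because \<open>slack_diff\<close> puts the quotient
        monomial into the cone, not merely among the monomials.\<close>
      let ?s = "hw (N (D - D0)) (t - t0)"
      have s: "?s \<in> Sp (N (D - D0))" "lm ?s (t - t0)" "lookup ?s (t - t0) = 1" using hw[OF sd(3)] by auto
      define y where "y = (1 / lookup ?g t0) *\<^sub>R (?s * ?g)"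
      have "lookup ?g t0 \<noteq> 0" using g0(2) by (simp add: lm_def in_keys_iff)
      have tt: "(t - t0) + t0 = t" using sd(2) by (metis add.commute)
      have ly: "lm (?s * ?g) t" "lookup (?s * ?g) t = lookup ?g t0"
        using lm_mult[OF s(2) g0(2)] s(3) unfolding tt by simp_all
      have keys_y: "keys y = keys (?s * ?g)" using \<open>lookup ?g t0 \<noteq> 0\<close> by (auto simp: y_def in_keys_iff)
      have y: "lm y t" "lookup y t = 1"
        using ly \<open>lookup ?g t0 \<noteq> 0\<close> unfolding lm_def keys_y by (simp_all add: y_def)
      have DD: "D0 + (D - D0) = D" using sd(1) by simp
      have yJ: "y \<in> J full D" "y \<in> J A' D"
        using J_mult[OF s(1) g0(1)] J_mult[OF s(1) g0(3)] unfolding y_def DD by (auto simp: J_def intro: span_scale)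
      let ?f = "f - lookup f t *\<^sub>R y"
      have fJ': "?f \<in> J full D" using fJ yJ(1) unfolding J_def by (intro span_diff span_scale)
      have "?f \<in> J A' D"
      proof (rule IH[rule_format])
        show "?f \<in> Sp (L D)" using fJ' J_Sp[of full D] by blast
        show "mless s t" if "lm ?f s" for s using lm_cancel[OF f(2) y that] .
      qed (rule fJ')
      then have "?f + lookup f t *\<^sub>R y \<in> J A' D" using yJ(2) unfolding J_def by (intro span_add span_scale)
      then show "f \<in> J A' D" by simp
    qed
  qed
  then have "\<forall>D. J full D \<subseteq> J A' D" using J_Sp[of full] by blast
  then show ?thesis using A' by blast
qed

text \<open>A vanishing row degree leaves only constants. This supplies degree 0 of the ray, on
  which the assumption about dimension one is silent.\<close>

lemma cov_zero: "cov (N 0) \<subseteq> span {1}"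
proof
  fix f assume "f \<in> cov (N 0)"
  then have f: "keys f \<subseteq> mons (\<lambda>_. 0)" by (simp add: cov_def Sp_def)
  have "t = 0" if t: "t \<in> mons (\<lambda>_. 0)" for t
  proof (rule poly_mapping_eqI)
    fix v :: "nat \<times> nat"
    obtain c r where v: "v = (c, r)" by (cases v)
    show "lookup t v = lookup 0 v"
    proof (cases "(c, r) \<in> V")
      case True
      then have "c < M" "r < K" using V_sub by auto
      then have "lookup t (c, r) \<le> cs M r t"
        unfolding cs_def by (intro member_le_sum[of _ _ "\<lambda>c. lookup t (c, r)"]) auto
      then show ?thesis using t \<open>r < K\<close> v by (simp add: mons_def)
    next
      case False
      then show ?thesis using lookup_outside[OF t] v by simp
    qed
  qed
  then have "keys f \<subseteq> {0}" using f by blast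
  then have "f = lookup f 0 *\<^sub>R 1"
    by (intro poly_mapping_eqI) (auto simp: lookup_one when_def in_keys_iff)
  then show "f \<in> span {1}" by (metis span_base span_scale singletonI)
qed

text \<open>Hilbert's argument: a covariant is a combination of the generators \<open>a\<close>, and
  applying \<open>reynolds_cov\<close> to its coefficients makes them covariant. In each degree
  \<open>N q\<close> the covariants lie on a line, so every generator contributes at most one
  dimension in degree \<open>D\<close>.\<close>

theorem dim_cov_bounded:
  assumes one: "\<And>d. d \<ge> 1 \<Longrightarrow> dim (cov (N d)) = 1"
  shows "\<exists>B. \<forall>D. dim (cov (L D)) \<le> B"
proof -
  have "\<exists>\<phi>. cov (N q) \<subseteq> span {\<phi>}" for q
  proof (cases "q = 0")
    case True
    then show ?thesis using cov_zero by auto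
  next
    case False
    obtain B where B: "cov (N q) \<subseteq> span B" "card B = dim (cov (N q))" by (rule cov_basis)
    then have "card B = 1" using one[of q] False by simp
    then obtain \<phi> where "B = {\<phi>}" by (rule card_1_singletonE)
    then show ?thesis using B(1) by blast
  qed
  then obtain \<phi> where \<phi>: "\<And>q. cov (N q) \<subseteq> span {\<phi> q}" by metis
  obtain A where A: "A \<subseteq> full" "finite A" "\<And>D. J full D \<subseteq> J A D" using J_noetherian by blast
  have "dim (cov (L D)) \<le> card A" for D
  proof -
    define Y where "Y = span {q * a | q a d. (d, a) \<in> A \<and> d \<le> D \<and> q \<in> cov (N (D - d))}"
    have LD: "(\<lambda>t. N (D - d) t + L d t) = L D" if "d \<le> D" for d
    proof
      fix t
      have "(D - d) * \<Lambda>' t + d * \<Lambda>' t = D * \<Lambda>' t" using that by (simp add: add_mult_distrib[symmetric])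
      then show "N (D - d) t + L d t = L D t" by simp
    qed
    have Ycov: "Y \<subseteq> cov (L D)"
      unfolding Y_def
    proof (rule span_minimal[OF _ subspace_cov], safe)
      fix q a d assume *: "(d, a) \<in> A" "d \<le> D" "q \<in> cov (N (D - d))"
      then have "a \<in> cov (L d)" using A(1) by blast
      from cov_mult[OF *(3) this] show "q * a \<in> cov (L D)" unfolding LD[OF *(2)] .
    qed
    \<comment> \<open>Since \<open>Eop i j\<close> is a derivation that kills the generator
      \<open>a\<close>, multiplying the remainder of a coefficient by \<open>a\<close> again gives
      an image of the operators.\<close>
    have split: "\<exists>y u. y \<in> Y \<and> (\<forall>i<n. \<forall>j<n. u i j \<in> Sp (L D)) \<and> x = y + (\<Sum>i<n. \<Sum>j<n. Eop i j (u i j))"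
      if "x \<in> J A D" for x
      using that unfolding J_def
    proof (induction rule: span_induct_alt)
      case base
      show ?case
        by (intro exI[of _ 0] exI[of _ "\<lambda>_ _. 0"])
          (auto simp: Y_def span_zero linear_0[OF linear_Eop] subspace_0[OF subspace_Sp])
    next
      case (step c x z)
      then obtain r a d where r: "x = r * a" "(d, a) \<in> A" "d \<le> D" "r \<in> Sp (N (D - d))" by blast
      obtain q u where q: "q \<in> cov (N (D - d))" "\<And>i j. i < n \<Longrightarrow> j < n \<Longrightarrow> u i j \<in> Sp (N (D - d))"
        "r = q + (\<Sum>i<n. \<Sum>j<n. Eop i j (u i j))" using reynolds_cov[OF r(4)] by blast
      obtain y v where y: "y \<in> Y" "\<And>i j. i < n \<Longrightarrow> j < n \<Longrightarrow> v i j \<in> Sp (L D)"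
        "z = y + (\<Sum>i<n. \<Sum>j<n. Eop i j (v i j))" using step.IH by blast
      have a: "a \<in> cov (L d)" using A(1) r(2) by blast
      have ua: "u i j * a \<in> Sp (L D)" if "i < n" "j < n" for i j
        using Sp_mult[OF q(2)[OF that] cov_Sp[OF a]] unfolding LD[OF r(3)] .
      have "r * a = q * a + (\<Sum>i<n. \<Sum>j<n. Eop i j (u i j * a))"
        unfolding q(3) using a
        by (simp add: distrib_right sum_distrib_right derivation_mult[OF derivation_Eop] cov_def cong: sum.cong_simp)
      then have e1: "c *\<^sub>R x + z = (c *\<^sub>R (q * a) + y) + (\<Sum>i<n. \<Sum>j<n. Eop i j (c *\<^sub>R (u i j * a) + v i j))"
        unfolding r(1) y(3)
        by (simp add: linear_add[OF linear_Eop] linear_scale[OF linear_Eop] sum.distrib scaleR_sum_right scaleR_add_right)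
      have e2: "c *\<^sub>R (q * a) + y \<in> Y"
      proof -
        have "q * a \<in> Y" unfolding Y_def by (rule span_base) (use q(1) r(2,3) in blast)
        then show ?thesis using y(1) unfolding Y_def by (intro span_add span_scale)
      qed
      have e3: "c *\<^sub>R (u i j * a) + v i j \<in> Sp (L D)" if "i < n" "j < n" for i j
        using ua[OF that] y(2)[OF that] subspace_Sp by (simp add: subspace_add subspace_scale)
      show ?case
        by (intro exI[of _ "c *\<^sub>R (q * a) + y"] exI[of _ "\<lambda>i j. c *\<^sub>R (u i j * a) + v i j"] conjI e1 e2)
          (use e3 in simp)
    qed
    have "cov (L D) \<subseteq> Y"
    proof
      fix F assume F: "F \<in> cov (L D)"
      then have "F \<in> J A D" using cov_J A(3) by blast
      then obtain y u where y: "y \<in> Y" "F = y + (\<Sum>i<n. \<Sum>j<n. Eop i j (u i j))" using split by blast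
      define H where "H = F - y"
      have H: "H \<in> cov (L D)" unfolding H_def using F y(1) Ycov subspace_cov subspace_diff by blast
      \<comment> \<open>The difference \<open>H\<close> is covariant and also a sum of images of the
        operators. By adjointness these are orthogonal, so \<open>H\<close> is zero.\<close>
      have "ip H H = ip H (\<Sum>i<n. \<Sum>j<n. Eop i j (u i j))" using y(2) by (simp add: H_def)
      also have "\<dots> = (\<Sum>i<n. \<Sum>j<n. ip (Eop j i H) (u i j))"
        by (simp add: ip_sum_right Eop_adjoint cong: sum.cong_simp)
      also have "\<dots> = 0" using H by (simp add: cov_def)
      finally have "F = y" by (simp add: ip_self_eq_0 H_def)
      then show "F \<in> Y" using y(1) by simp
    qed
    also have "Y \<subseteq> span ((\<lambda>(d, a). \<phi> (D - d) * a) ` A)"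
      unfolding Y_def
    proof (rule span_minimal[OF _ subspace_span], safe)
      fix q a d assume *: "(d, a) \<in> A" "d \<le> D" "q \<in> cov (N (D - d))"
      then obtain c where "q = c *\<^sub>R \<phi> (D - d)" using \<phi>[of "D - d"] by (auto simp: span_singleton)
      then have "q * a = c *\<^sub>R (\<phi> (D - d) * a)" by simp
      moreover have "\<phi> (D - d) * a \<in> (\<lambda>(d, a). \<phi> (D - d) * a) ` A" using *(1) by force
      ultimately show "q * a \<in> span ((\<lambda>(d, a). \<phi> (D - d) * a) ` A)" by (metis span_base span_scale)
    qed
    finally have "dim (cov (L D)) \<le> card ((\<lambda>(d, a). \<phi> (D - d) * a) ` A)"
      using A(2) by (intro dim_le_card) auto
    also have "\<dots> \<le> card A" using A(2) by (rule card_image_le)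
    finally show ?thesis .
  qed
  then show ?thesis by blast
qed

end

section \<open>Tableaux and interlacing matrices\<close>

definition cum :: "(nat \<Rightarrow> nat \<Rightarrow> nat) \<Rightarrow> nat \<Rightarrow> nat \<Rightarrow> nat" where
  "cum e r c = (\<Sum>c'<c. e r c')"

definition csum :: "nat \<Rightarrow> (nat \<Rightarrow> nat \<Rightarrow> nat) \<Rightarrow> nat \<Rightarrow> nat" where
  "csum k e c = (\<Sum>r<k. e r c)"

text \<open>Gelfand-Tsetlin patterns in difference form: \<open>e r c\<close> is the multiplicity of
  the letter \<open>c\<close> in row \<open>r\<close> of a tableau with letters below
  \<open>m\<close>, and the pattern itself is \<open>cum\<close>.\<close>

definition gtm :: "nat \<Rightarrow> nat \<Rightarrow> (nat \<Rightarrow> nat) \<Rightarrow> (nat \<Rightarrow> nat \<Rightarrow> nat) set" where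
  "gtm k m p = {e. (\<forall>r c. \<not> (r < k \<and> c < m) \<longrightarrow> e r c = 0) \<and> (\<forall>r<k. cum e r m = p r)
     \<and> (\<forall>r c. Suc r < k \<longrightarrow> c < m \<longrightarrow> cum e (Suc r) (Suc c) \<le> cum e r c)}"

lemma cum_0 [simp]: "cum e r 0 = 0"
  and cum_Suc: "cum e r (Suc c) = cum e r c + e r c"
  by (simp_all add: cum_def)

lemma cum_mono: "c \<le> d \<Longrightarrow> cum e r c \<le> cum e r d"
  unfolding cum_def by (rule sum_mono2) auto

lemma finite_gtm: "finite (gtm k m p)"
proof -
  have "e r c \<in> {..\<Sum>r<k. p r}" if e: "e \<in> gtm k m p" and rc: "r < k" "c < m" for e r c
  proof -
    have "e r c \<le> cum e r m" unfolding cum_def by (rule member_le_sum) (use rc in auto)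
    also have "\<dots> = p r" using e rc by (simp add: gtm_def)
    also have "\<dots> \<le> (\<Sum>r<k. p r)" by (rule member_le_sum) (use rc in auto)
    finally show ?thesis by simp
  qed
  then have "(\<lambda>e. \<lambda>x\<in>{..<k} \<times> {..<m}. e (fst x) (snd x)) ` gtm k m p \<subseteq> PiE ({..<k} \<times> {..<m}) (\<lambda>_. {..\<Sum>r<k. p r})"
    by (auto split: if_splits)
  then have "finite ((\<lambda>e. \<lambda>x\<in>{..<k} \<times> {..<m}. e (fst x) (snd x)) ` gtm k m p)"
    by (rule finite_subset) (intro finite_PiE, auto)
  moreover have "inj_on (\<lambda>e. \<lambda>x\<in>{..<k} \<times> {..<m}. e (fst x) (snd x)) (gtm k m p)"
  proof (rule inj_onI)
    fix e f assume ef: "e \<in> gtm k m p" "f \<in> gtm k m p"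
      "(\<lambda>x\<in>{..<k} \<times> {..<m}. e (fst x) (snd x)) = (\<lambda>x\<in>{..<k} \<times> {..<m}. f (fst x) (snd x))"
    show "e = f"
    proof (intro ext)
      fix r c
      show "e r c = f r c"
      proof (cases "r < k \<and> c < m")
        case True
        then show ?thesis using fun_cong[OF ef(3), of "(r, c)"] by simp
      next
        case False
        then show ?thesis using ef(1,2) by (simp add: gtm_def)
      qed
    qed
  qed
  ultimately show ?thesis by (rule finite_imageD)
qed

definition tab_matrix :: "(nat \<Rightarrow> nat) \<Rightarrow> (nat \<times> nat \<Rightarrow> nat) \<Rightarrow> nat \<Rightarrow> nat \<Rightarrow> nat" where
  "tab_matrix p T r c = card {j. j < p r \<and> T (r, j) = c}"

definition matrix_tab :: "(nat \<Rightarrow> nat) \<Rightarrow> (nat \<Rightarrow> nat \<Rightarrow> nat) \<Rightarrow> nat \<times> nat \<Rightarrow> nat" where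
  "matrix_tab p e = (\<lambda>(r, j). if j < p r then LEAST c. j < cum e r (Suc c) else 0)"

lemma cum_tab_matrix: "cum (tab_matrix p T) r c = card {j. j < p r \<and> T (r, j) < c}"
proof (induction c)
  case (Suc c)
  have "{j. j < p r \<and> T (r, j) < Suc c} = {j. j < p r \<and> T (r, j) < c} \<union> {j. j < p r \<and> T (r, j) = c}" by auto
  then show ?case using Suc
    by (simp add: cum_Suc tab_matrix_def, subst card_Un_disjoint) auto
qed simp

lemma down_closed_card:
  assumes "finite A" "\<And>i j. j \<in> A \<Longrightarrow> i \<le> j \<Longrightarrow> i \<in> A"
  shows "A = {..<card A :: nat}"
proof (cases "A = {}")
  case False
  have "A = {..Max A}"
    using assms(2)[OF Max_in[OF assms(1) False]] Max_ge[OF assms(1)] by auto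
  then show ?thesis by (metis card_atMost lessThan_Suc_atMost)
qed simp

lemma ssyt_row: "T \<in> ssyt p n \<Longrightarrow> Suc j < p r \<Longrightarrow> T (r, j) \<le> T (r, Suc j)"
  and ssyt_col: "T \<in> ssyt p n \<Longrightarrow> j < p (Suc r) \<Longrightarrow> T (r, j) < T (Suc r, j)"
  and ssyt_bound: "T \<in> ssyt p n \<Longrightarrow> j < p r \<Longrightarrow> T (r, j) < n"
  and ssyt_outside: "T \<in> ssyt p n \<Longrightarrow> \<not> j < p r \<Longrightarrow> T (r, j) = 0"
  by (simp_all add: ssyt_def cells_def)

lemma ssyt_row_mono:
  assumes T: "T \<in> ssyt p m" and "i \<le> j" "j < p r"
  shows "T (r, i) \<le> T (r, j)"
  using assms(2,3)
proof (induction rule: dec_induct)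
  case (step j)
  then have "T (r, i) \<le> T (r, j)" by simp
  also have "\<dots> \<le> T (r, Suc j)" using ssyt_row[OF T] step.prems by simp
  finally show ?case .
qed simp

text \<open>Rows increase weakly, so the cells with entry below \<open>c\<close> are an initial
  segment of the row, and \<open>cum\<close> is its length.\<close>

lemma ssyt_less_cum:
  assumes T: "T \<in> ssyt p m" and j: "j < p r"
  shows "T (r, j) < c \<longleftrightarrow> j < cum (tab_matrix p T) r c"
proof -
  let ?A = "{j. j < p r \<and> T (r, j) < c}"
  have "?A = {..<card ?A}"
  proof (rule down_closed_card)
    show "finite ?A" by (rule finite_subset[of _ "{..<p r}"]) auto
    show "i \<in> ?A" if "j \<in> ?A" "i \<le> j" for i j
      using that ssyt_row_mono[OF T that(2), of r] by auto
  qed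
  then show ?thesis using j unfolding cum_tab_matrix by blast
qed

lemma matrix_tab_less_cum:
  assumes "e \<in> gtm k m p" "r < k" "j < p r"
  shows "matrix_tab p e (r, j) < c \<longleftrightarrow> j < cum e r c"
proof -
  let ?P = "\<lambda>c. j < cum e r (Suc c)"
  have m: "j < cum e r m" using assms by (simp add: gtm_def)
  then have "m \<noteq> 0" by (cases m) auto
  then have P: "?P (LEAST c. ?P c)" using m by (intro LeastI[of ?P "m - 1"]) simp
  have v: "matrix_tab p e (r, j) = (LEAST c. ?P c)" using assms(3) by (simp add: matrix_tab_def)
  show ?thesis
  proof
    assume "matrix_tab p e (r, j) < c"
    then show "j < cum e r c" using P cum_mono[of "Suc (LEAST c. ?P c)" c e r] unfolding v by simp
  next
    assume c: "j < cum e r c"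
    then obtain c1 where "c = Suc c1" by (cases c) auto
    then show "matrix_tab p e (r, j) < c" using c Least_le[of ?P c1] unfolding v by simp
  qed
qed

text \<open>A row is determined by its multiplicities. Column strictness says that above the cells
  of row \<open>r + 1\<close> with entries at most \<open>c\<close> there are only entries below
  \<open>c\<close>, which compares two initial segments and is interlacing.\<close>

theorem tab_matrix_bij:
  assumes p: "\<And>r. p (Suc r) \<le> p r" and pk: "\<And>r. r \<ge> k \<Longrightarrow> p r = 0"
  shows "bij_betw (tab_matrix p) (ssyt p m) (gtm k m p)"
proof (rule bij_betw_byWitness[where f' = "matrix_tab p"])
  show "tab_matrix p ` ssyt p m \<subseteq> gtm k m p"
  proof safe
    fix T assume T: "T \<in> ssyt p m"
    have Tm: "T (r, j) < m" if "j < p r" for r j using ssyt_bound[OF T that] .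
    show "tab_matrix p T \<in> gtm k m p"
      unfolding gtm_def
    proof (intro CollectI conjI allI impI)
      fix r c assume "\<not> (r < k \<and> c < m)"
      then have "{j. j < p r \<and> T (r, j) = c} = {}" using Tm[of _ r] pk[of r] by (cases "r < k") auto
      then show "tab_matrix p T r c = 0" by (simp add: tab_matrix_def)
    next
      fix r assume "r < k"
      have "{j. j < p r \<and> T (r, j) < m} = {..<p r}" using Tm by auto
      then show "cum (tab_matrix p T) r m = p r" by (simp add: cum_tab_matrix)
    next
      fix r c assume "Suc r < k" "c < m"
      show "cum (tab_matrix p T) (Suc r) (Suc c) \<le> cum (tab_matrix p T) r c"
      proof (rule ccontr)
        let ?j = "cum (tab_matrix p T) r c"
        assume "\<not> ?thesis"
        then have j: "?j < cum (tab_matrix p T) (Suc r) (Suc c)" by simp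
        also have "\<dots> \<le> p (Suc r)" unfolding cum_tab_matrix
          by (rule order_trans[OF card_mono[of "{..<p (Suc r)}"]]) auto
        finally have jp: "?j < p (Suc r)" .
        then have jp': "?j < p r" using p[of r] by simp
        have "T (Suc r, ?j) < Suc c" using ssyt_less_cum[OF T jp] j by simp
        moreover have "\<not> T (r, ?j) < c" using ssyt_less_cum[OF T jp'] by simp
        moreover have "T (r, ?j) < T (Suc r, ?j)" by (rule ssyt_col[OF T jp])
        ultimately show False by simp
      qed
    qed
  qed
  show "\<forall>T\<in>ssyt p m. matrix_tab p (tab_matrix p T) = T"
  proof
    fix T assume T: "T \<in> ssyt p m"
    show "matrix_tab p (tab_matrix p T) = T"
    proof
      fix x :: "nat \<times> nat"
      obtain r j where x: "x = (r, j)" by (cases x)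
      show "matrix_tab p (tab_matrix p T) x = T x"
      proof (cases "j < p r")
        case True
        have "(LEAST c. j < cum (tab_matrix p T) r (Suc c)) = T (r, j)"
        proof (rule Least_equality)
          show "j < cum (tab_matrix p T) r (Suc (T (r, j)))"
            using ssyt_less_cum[OF T True, of "Suc (T (r, j))"] by simp
          show "T (r, j) \<le> c" if "j < cum (tab_matrix p T) r (Suc c)" for c
            using ssyt_less_cum[OF T True, of "Suc c"] that by simp
        qed
        then show ?thesis using True by (simp add: x matrix_tab_def)
      next
        case False
        then show ?thesis using ssyt_outside[OF T False] by (simp add: x matrix_tab_def)
      qed
    qed
  qed
  have lt: "matrix_tab p e (r, j) < c \<longleftrightarrow> j < cum e r c" if "e \<in> gtm k m p" "j < p r" for e r j c
    using matrix_tab_less_cum[OF that(1) _ that(2)] pk[of r] that(2) by (cases "r < k") auto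
  show "matrix_tab p ` gtm k m p \<subseteq> ssyt p m"
  proof safe
    fix e assume e: "e \<in> gtm k m p"
    have rk: "r < k" if "j < p r" for r j using pk[of r] that by (cases "r < k") auto
    have 1: "matrix_tab p e (r, j) < m" if j: "j < p r" for r j
      using lt[OF e j, of m] e rk[OF j] j by (simp add: gtm_def)
    have 2: "matrix_tab p e (r, j) \<le> matrix_tab p e (r, Suc j)" if j: "Suc j < p r" for r j
      using lt[OF e j, of "Suc (matrix_tab p e (r, Suc j))"] lt[OF e, of j r "Suc (matrix_tab p e (r, Suc j))"] j
      by simp
    have 3: "matrix_tab p e (r, j) < matrix_tab p e (Suc r, j)" if j: "j < p (Suc r)" for r j
    proof -
      let ?c = "matrix_tab p e (Suc r, j)"
      have "j < cum e (Suc r) (Suc ?c)" using lt[OF e j, of "Suc ?c"] by simp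
      also have "\<dots> \<le> cum e r ?c" using e rk[OF j] 1[OF j] by (simp add: gtm_def)
      finally have "j < cum e r ?c" .
      then show ?thesis using lt[OF e, of j r ?c] j p[of r] by simp
    qed
    have 4: "matrix_tab p e c = 0" if "c \<notin> cells p" for c
      using that by (cases c) (simp add: matrix_tab_def cells_def)
    show "matrix_tab p e \<in> ssyt p m"
      using 1 2 3 4 by (auto simp: ssyt_def cells_def)
  qed
  show "\<forall>e\<in>gtm k m p. tab_matrix p (matrix_tab p e) = e"
  proof
    fix e assume e: "e \<in> gtm k m p"
    have cum_le: "cum e r c \<le> p r" if "r < k" for r c
    proof -
      have "cum e r c \<le> cum e r m"
      proof (cases "c \<le> m")
        case True
        then show ?thesis by (rule cum_mono)
      next
        case False
        have "cum e r c = cum e r m" unfolding cum_def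
          by (rule sum.mono_neutral_right) (use False e in \<open>auto simp: gtm_def\<close>)
        then show ?thesis by simp
      qed
      then show ?thesis using e that by (simp add: gtm_def)
    qed
    show "tab_matrix p (matrix_tab p e) = e"
    proof (intro ext)
      fix r c
      show "tab_matrix p (matrix_tab p e) r c = e r c"
      proof (cases "r < k")
        case True
        have *: "j < p r \<and> matrix_tab p e (r, j) = c \<longleftrightarrow> cum e r c \<le> j \<and> j < cum e r (Suc c)" for j
        proof (cases "j < p r")
          case True
          have "matrix_tab p e (r, j) = c \<longleftrightarrow> \<not> matrix_tab p e (r, j) < c \<and> matrix_tab p e (r, j) < Suc c"
            by linarith
          then show ?thesis unfolding lt[OF e True] using True by (simp add: not_less)
        next
          case False
          then show ?thesis using cum_le[OF \<open>r < k\<close>, of "Suc c"] by simp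
        qed
        have "{j. j < p r \<and> matrix_tab p e (r, j) = c} = {cum e r c..<cum e r (Suc c)}"
          by (rule set_eqI) (simp only: mem_Collect_eq atLeastLessThan_iff *)
        then show ?thesis by (simp add: tab_matrix_def cum_Suc)
      next
        case False
        then show ?thesis using e pk by (simp add: tab_matrix_def gtm_def)
      qed
    qed
  qed
qed

lemma content_tab_matrix:
  assumes pk: "\<And>r. r \<ge> k \<Longrightarrow> p r = 0"
  shows "content p T c = csum k (tab_matrix p T) c"
proof -
  have eq: "{x \<in> cells p. T x = c} = Sigma {..<k} (\<lambda>r. {j. j < p r \<and> T (r, j) = c})"
  proof -
    have "r < k" if "j < p r" for r j using pk[of r] that by (cases "r < k") auto
    then show ?thesis by (auto simp: cells_def)
  qed
  show ?thesis
    unfolding content_def eq csum_def tab_matrix_def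
    by (rule card_SigmaI) (auto intro: finite_subset[of _ "{..<p _}"])
qed

text \<open>The Bender--Knuth involution, reflecting each entry of one row of the Gelfand--Tsetlin
  pattern inside the interval allowed by its neighbours.\<close>

definition bk_sum :: "nat \<Rightarrow> nat \<Rightarrow> (nat \<Rightarrow> nat \<Rightarrow> nat) \<Rightarrow> nat \<Rightarrow> nat" where
  "bk_sum k c e r = max (cum e r c) (if Suc r < k then cum e (Suc r) (Suc (Suc c)) else 0)
     + (if r = 0 then cum e r (Suc (Suc c)) else min (cum e r (Suc (Suc c))) (cum e (r - 1) c))"

definition bk :: "nat \<Rightarrow> nat \<Rightarrow> (nat \<Rightarrow> nat \<Rightarrow> nat) \<Rightarrow> nat \<Rightarrow> nat \<Rightarrow> nat" where
  "bk k c e = (\<lambda>r. if r < k then (e r)(c := bk_sum k c e r - cum e r (Suc c) - cum e r c,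
      Suc c := cum e r (Suc (Suc c)) - (bk_sum k c e r - cum e r (Suc c))) else e r)"

text \<open>The present value lies in the interval allowed by its neighbours, hence so does its
  mirror image. In particular the truncated subtractions in \<open>bk\<close> are exact.\<close>

lemma bk_bounds:
  assumes e: "e \<in> gtm k m p" and c: "Suc c < m" and r: "r < k"
  shows "cum e r c \<le> bk_sum k c e r - cum e r (Suc c)"
    "bk_sum k c e r - cum e r (Suc c) \<le> cum e r (Suc (Suc c))"
    "Suc r < k \<Longrightarrow> cum e (Suc r) (Suc (Suc c)) \<le> bk_sum k c e r - cum e r (Suc c)"
    "r > 0 \<Longrightarrow> bk_sum k c e r - cum e r (Suc c) \<le> cum e (r - 1) c"
    "cum e r (Suc c) \<le> bk_sum k c e r"
proof -
  have 1: "cum e r c \<le> cum e r (Suc c)" "cum e r (Suc c) \<le> cum e r (Suc (Suc c))" by (simp_all add: cum_mono)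
  have 2: "cum e (Suc r) (Suc (Suc c)) \<le> cum e r (Suc c)" if "Suc r < k" using e c that by (simp add: gtm_def)
  have 3: "cum e r (Suc c) \<le> cum e (r - 1) c" if "r > 0"
    using e c that r by (cases r) (simp_all add: gtm_def)
  define lo where "lo = max (cum e r c) (if Suc r < k then cum e (Suc r) (Suc (Suc c)) else 0)"
  define hi where "hi = (if r = 0 then cum e r (Suc (Suc c)) else min (cum e r (Suc (Suc c))) (cum e (r - 1) c))"
  have s: "bk_sum k c e r = lo + hi" by (simp add: bk_sum_def lo_def hi_def)
  have lo: "lo \<le> cum e r (Suc c)" "cum e r c \<le> lo" "Suc r < k \<Longrightarrow> cum e (Suc r) (Suc (Suc c)) \<le> lo"
    using 1 2 by (auto simp: lo_def)
  have hi: "cum e r (Suc c) \<le> hi" "hi \<le> cum e r (Suc (Suc c))" "r > 0 \<Longrightarrow> hi \<le> cum e (r - 1) c"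
    using 1 3 by (auto simp: hi_def)
  show "cum e r c \<le> bk_sum k c e r - cum e r (Suc c)"
    "bk_sum k c e r - cum e r (Suc c) \<le> cum e r (Suc (Suc c))"
    "Suc r < k \<Longrightarrow> cum e (Suc r) (Suc (Suc c)) \<le> bk_sum k c e r - cum e r (Suc c)"
    "r > 0 \<Longrightarrow> bk_sum k c e r - cum e r (Suc c) \<le> cum e (r - 1) c"
    "cum e r (Suc c) \<le> bk_sum k c e r"
    unfolding s using lo hi by linarith+
qed

lemma cum_bk:
  assumes e: "e \<in> gtm k m p" and c: "Suc c < m"
  shows "cum (bk k c e) r x = (if r < k \<and> x = Suc c then bk_sum k c e r - cum e r (Suc c) else cum e r x)"
proof (cases "r < k")
  case True
  note b = bk_bounds[OF e c True]
  have low: "cum (bk k c e) r y = cum e r y" if "y \<le> c" for y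
    unfolding cum_def bk_def using True that by (intro sum.cong) auto
  have 1: "cum (bk k c e) r (Suc c) = bk_sum k c e r - cum e r (Suc c)"
    using low[of c] b(1) True by (simp add: cum_Suc[of _ _ c] bk_def)
  have 2: "cum (bk k c e) r (Suc (Suc c)) = cum e r (Suc (Suc c))"
    unfolding cum_Suc[of "bk k c e" r "Suc c"] 1 using b(2) True by (simp add: bk_def)
  have high: "cum (bk k c e) r (Suc (Suc c) + d) = cum e r (Suc (Suc c) + d)" for d
  proof (induction d)
    case 0
    then show ?case using 2 by simp
  next
    case (Suc d)
    then show ?case using True by (simp add: cum_Suc bk_def)
  qed
  show ?thesis
  proof (cases "x \<le> Suc c")
    case True
    then show ?thesis using low[of x] 1 \<open>r < k\<close> by (cases "x = Suc c") auto
  next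
    case False
    then obtain d where "x = Suc (Suc c) + d" using le_Suc_ex[of "Suc (Suc c)" x] by auto
    then show ?thesis using high[of d] by simp
  qed
qed (simp add: cum_def bk_def)

lemma bk_sum_bk:
  assumes e: "e \<in> gtm k m p" and c: "Suc c < m"
  shows "bk_sum k c (bk k c e) r = bk_sum k c e r"
  unfolding bk_sum_def cum_bk[OF assms] by simp

lemma bk_gtm:
  assumes e: "e \<in> gtm k m p" and c: "Suc c < m"
  shows "bk k c e \<in> gtm k m p"
  unfolding gtm_def
proof (intro CollectI conjI allI impI)
  fix r x assume "\<not> (r < k \<and> x < m)"
  then show "bk k c e r x = 0" using e c by (auto simp: bk_def gtm_def)
next
  fix r assume "r < k"
  then show "cum (bk k c e) r m = p r" using e c unfolding cum_bk[OF assms] by (simp add: gtm_def)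
next
  fix r x assume r: "Suc r < k" and x: "x < m"
  have base: "cum e (Suc r) (Suc x) \<le> cum e r x" using e r x by (simp add: gtm_def)
  show "cum (bk k c e) (Suc r) (Suc x) \<le> cum (bk k c e) r x"
    unfolding cum_bk[OF assms]
    using base r bk_bounds(4)[OF e c, of "Suc r"] bk_bounds(3)[OF e c, of r] by auto
qed

lemma bk_bk:
  assumes e: "e \<in> gtm k m p" and c: "Suc c < m"
  shows "bk k c (bk k c e) = e"
proof (intro ext)
  fix r x
  have "cum (bk k c (bk k c e)) r y = cum e r y" for y
    unfolding cum_bk[OF bk_gtm[OF assms] c] cum_bk[OF assms] bk_sum_bk[OF assms]
    using bk_bounds(5)[OF e c, of r] by auto
  then show "bk k c (bk k c e) r x = e r x" by (metis add_left_cancel cum_Suc)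
qed

text \<open>The lower end in row \<open>r\<close> is the maximum and the upper end in row
  \<open>r + 1\<close> the minimum of the same two numbers, and maximum plus minimum is their sum.
  Summed over all rows, the reflection therefore exchanges the two column sums.\<close>

lemma sum_bk_sum:
  "(\<Sum>r<k. bk_sum k c e r) = (\<Sum>r<k. cum e r c + cum e r (Suc (Suc c)))"
proof (cases k)
  case (Suc k')
  let ?lo = "\<lambda>r. max (cum e r c) (if Suc r < k then cum e (Suc r) (Suc (Suc c)) else 0)"
  let ?hi = "\<lambda>r. if r = 0 then cum e r (Suc (Suc c)) else min (cum e r (Suc (Suc c))) (cum e (r - 1) c)"
  have "(\<Sum>r<k. bk_sum k c e r) = (\<Sum>r<k. ?lo r) + (\<Sum>r<k. ?hi r)"
    by (simp add: bk_sum_def sum.distrib)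
  also have "(\<Sum>r<k. ?lo r) = (\<Sum>r<k'. ?lo r) + cum e k' c" by (simp add: Suc)
  also have "(\<Sum>r<k. ?hi r) = cum e 0 (Suc (Suc c)) + (\<Sum>r<k'. ?hi (Suc r))"
    unfolding Suc sum.lessThan_Suc_shift by simp
  also have "(\<Sum>r<k'. ?lo r) + cum e k' c + (cum e 0 (Suc (Suc c)) + (\<Sum>r<k'. ?hi (Suc r)))
     = (\<Sum>r<k'. ?lo r + ?hi (Suc r)) + cum e k' c + cum e 0 (Suc (Suc c))"
    by (simp add: sum.distrib)
  also have "(\<Sum>r<k'. ?lo r + ?hi (Suc r)) = (\<Sum>r<k'. cum e r c + cum e (Suc r) (Suc (Suc c)))"
    by (intro sum.cong refl) (auto simp: Suc max_def min_def)
  also have "\<dots> + cum e k' c + cum e 0 (Suc (Suc c))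
      = ((\<Sum>r<k'. cum e r c) + cum e k' c) + (cum e 0 (Suc (Suc c)) + (\<Sum>r<k'. cum e (Suc r) (Suc (Suc c))))"
    by (simp add: sum.distrib)
  also have "\<dots> = (\<Sum>r<k. cum e r c) + (\<Sum>r<k. cum e r (Suc (Suc c)))"
    unfolding Suc sum.lessThan_Suc_shift[of "\<lambda>r. cum e r (Suc (Suc c))"] by simp
  finally show ?thesis by (simp add: sum.distrib)
qed simp

lemma csum_cum: "int (csum k e c) = (\<Sum>r<k. int (cum e r (Suc c))) - (\<Sum>r<k. int (cum e r c))"
  by (simp add: csum_def cum_Suc sum.distrib)

lemma csum_bk:
  assumes e: "e \<in> gtm k m p" and c: "Suc c < m"
  shows "csum k (bk k c e) = csum k e \<circ> transpose c (Suc c)"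
proof
  fix x
  have mid: "(\<Sum>r<k. int (cum (bk k c e) r (Suc c))) = (\<Sum>r<k. int (cum e r c)) + (\<Sum>r<k. int (cum e r (Suc (Suc c)))) - (\<Sum>r<k. int (cum e r (Suc c)))"
  proof -
    have "(\<Sum>r<k. int (cum (bk k c e) r (Suc c))) = (\<Sum>r<k. int (bk_sum k c e r) - int (cum e r (Suc c)))"
      by (intro sum.cong refl) (use bk_bounds(5)[OF e c] in \<open>simp add: cum_bk[OF assms] of_nat_diff\<close>)
    also have "\<dots> = int (\<Sum>r<k. bk_sum k c e r) - (\<Sum>r<k. int (cum e r (Suc c)))"
      by (simp add: sum_subtractf)
    finally show ?thesis unfolding sum_bk_sum by (simp add: sum.distrib)
  qed
  have oth: "(\<Sum>r<k. int (cum (bk k c e) r y)) = (\<Sum>r<k. int (cum e r y))" if "y \<noteq> Suc c" for y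
    using that by (simp add: cum_bk[OF assms])
  have "int (csum k (bk k c e) x) = int ((csum k e \<circ> transpose c (Suc c)) x)"
  proof (cases "x = c \<or> x = Suc c")
    case True
    then show ?thesis using mid oth[of c] oth[of "Suc (Suc c)"] by (auto simp: csum_cum)
  next
    case False
    then show ?thesis using oth[of x] oth[of "Suc x"] by (simp add: csum_cum transpose_def)
  qed
  then show "csum k (bk k c e) x = (csum k e \<circ> transpose c (Suc c)) x" by simp
qed

text \<open>Symmetry of Schur polynomials. Invariance is closed under composition of permutations,
  and the involution \<open>bk\<close> provides it for adjacent transpositions.\<close>

theorem gtm_symmetric:
  assumes "\<sigma> permutes {..<m}"
  shows "card {e \<in> gtm k m p. P (csum k e \<circ> \<sigma>)} = card {e \<in> gtm k m p. P (csum k e)}"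
proof -
  define S where "S = (\<lambda>\<sigma>. \<forall>P. card {e \<in> gtm k m p. P (csum k e \<circ> \<sigma>)} = card {e \<in> gtm k m p. P (csum k e)})"
  have comp: "S (\<sigma> \<circ> \<tau>)" if "S \<sigma>" "S \<tau>" for \<sigma> \<tau>
    unfolding S_def
  proof
    fix P
    have "card {e \<in> gtm k m p. P (csum k e \<circ> (\<sigma> \<circ> \<tau>))} = card {e \<in> gtm k m p. P (csum k e \<circ> \<tau>)}"
      using spec[OF that(1)[unfolded S_def], of "\<lambda>x. P (x \<circ> \<tau>)"] by (simp only: comp_assoc)
    also have "\<dots> = card {e \<in> gtm k m p. P (csum k e)}" using that(2) unfolding S_def by simp
    finally show "card {e \<in> gtm k m p. P (csum k e \<circ> (\<sigma> \<circ> \<tau>))} = card {e \<in> gtm k m p. P (csum k e)}" .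
  qed
  have adj: "S (transpose c (Suc c))" if "Suc c < m" for c
    unfolding S_def
  proof
    fix P
    have "bij_betw (bk k c) {e \<in> gtm k m p. P (csum k e \<circ> transpose c (Suc c))} {e \<in> gtm k m p. P (csum k e)}"
      by (rule bij_betw_byWitness[where f' = "bk k c"])
        (use that in \<open>auto simp: bk_bk bk_gtm csum_bk comp_assoc\<close>)
    then show "card {e \<in> gtm k m p. P (csum k e \<circ> transpose c (Suc c))} = card {e \<in> gtm k m p. P (csum k e)}"
      by (rule bij_betw_same_card)
  qed
  have S_id: "S id" by (simp add: S_def)
  have tr: "S (transpose a (Suc a + d))" if "Suc a + d < m" for a d
    using that
  proof (induction d)
    case 0
    then show ?case using adj by simp
  next
    case (Suc d)
    let ?b = "Suc a + d"
    \<comment> \<open>A longer transposition is a shorter one conjugated by an adjacent one.\<close>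
    have eq: "transpose a (Suc ?b) = transpose ?b (Suc ?b) \<circ> (transpose a ?b \<circ> transpose ?b (Suc ?b))"
      by (auto simp: fun_eq_iff transpose_def)
    have "Suc a + Suc d = Suc ?b" by simp
    show ?case unfolding \<open>Suc a + Suc d = Suc ?b\<close> eq
      by (intro comp adj Suc.IH) (use Suc.prems in auto)
  qed
  have tr': "S (transpose a b)" if "a < m" "b < m" for a b
  proof (cases a b rule: linorder_cases)
    case less
    then show ?thesis using tr[of a "b - Suc a"] that by simp
  next
    case equal
    then show ?thesis using S_id by simp
  next
    case greater
    then show ?thesis using tr[of b "a - Suc b"] that by (simp add: transpose_commute)
  qed
  have "S \<sigma>" using assms finite_lessThan
  proof (induction rule: permutes_induct)
    case id
    then show ?case by (rule S_id)
  next
    case (swap a b p)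
    then show ?case by (intro comp tr') auto
  qed
  then show ?thesis unfolding S_def by blast
qed

section \<open>Straightening an antisymmetric function along a tableau\<close>

definition alternating :: "nat \<Rightarrow> ((nat \<Rightarrow> int) \<Rightarrow> real) \<Rightarrow> bool" where
  "alternating n D \<longleftrightarrow> (\<forall>x y. (\<forall>i<n. x i = y i) \<longrightarrow> D x = D y)
     \<and> (\<forall>x i j. i < j \<longrightarrow> j < n \<longrightarrow> D (x \<circ> transpose i j) = - D x)"

lemma alternating_cong: "alternating n D \<Longrightarrow> (\<And>i. i < n \<Longrightarrow> x i = y i) \<Longrightarrow> D x = D y"
  unfolding alternating_def by blast

text \<open>The last coordinate is determined by the total. Unless every \<open>x i\<close> takes
  its maximal value, it falls into exactly one of the intervals, and exchanging it with the
  coordinate of that interval reverses the sign of \<open>D\<close>. In the exceptional case it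
  equals \<open>Nu n\<close>, which lies in no interval, and this single term survives.\<close>

lemma alternating_interlacing:
  fixes Nu :: "nat \<Rightarrow> int"
  assumes D: "alternating (Suc n) D" and dec: "\<And>i. i < n \<Longrightarrow> Nu (Suc i) < Nu i"
  shows "(\<Sum>x\<in>PiE {..<n} (\<lambda>i. {Nu (Suc i)<..Nu i}). D (\<lambda>i. if i < n then x i else (\<Sum>i\<le>n. Nu i) - (\<Sum>i<n. x i))) = D Nu"
proof -
  let ?T = "PiE {..<n} (\<lambda>i. {Nu (Suc i)<..Nu i})"
  define L where "L = (\<lambda>x. (\<Sum>i\<le>n. Nu i) - (\<Sum>i<n. x i))"
  define ev where "ev = (\<lambda>x i. if i < n then x i else L x)"
  have mono: "Nu j \<le> Nu i" if "i \<le> j" "j \<le> n" for i j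
    using that
  proof (induction rule: dec_induct)
    case (step q)
    then show ?case using dec[of q] by simp
  qed simp
  define x0 where "x0 = restrict Nu {..<n}"
  have x0: "x0 \<in> ?T" using dec by (auto simp: x0_def)
  have Lx0: "L x0 = Nu n" by (simp add: L_def x0_def lessThan_Suc_atMost[symmetric])
  have fin: "finite ?T" by (intro finite_PiE) auto
  have Lgt: "L x > Nu n" if x: "x \<in> ?T" "x \<noteq> x0" for x
  proof -
    obtain i where i: "i < n" "x i \<noteq> Nu i"
    proof (rule ccontr)
      assume no: "\<not> thesis"
      have "x = x0"
      proof
        fix i
        show "x i = x0 i"
          using no that x(1) by (cases "i < n") (auto simp: x0_def PiE_def extensional_def)
      qed
      then show False using x(2) by simp
    qed
    have "(\<Sum>i<n. x i) < (\<Sum>i<n. Nu i)"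
      by (rule sum_strict_mono_ex1) (use x(1) i in \<open>auto simp: PiE_iff intro!: bexI[of _ i] order.not_eq_order_implies_strict\<close>)
    then show ?thesis by (simp add: L_def lessThan_Suc_atMost[symmetric])
  qed
  have Lle: "L x \<le> Nu 0" if x: "x \<in> ?T" for x
  proof -
    have "(\<Sum>i<n. Nu (Suc i)) \<le> (\<Sum>i<n. x i)"
      by (rule sum_mono) (use x in \<open>auto simp: PiE_iff intro: less_imp_le\<close>)
    moreover have "(\<Sum>i\<le>n. Nu i) = Nu 0 + (\<Sum>i<n. Nu (Suc i))"
      by (simp add: lessThan_Suc_atMost[symmetric] sum.lessThan_Suc_shift del: sum.lessThan_Suc)
    ultimately show ?thesis by (simp add: L_def)
  qed
  have slot: "\<exists>i<n. Nu (Suc i) < y \<and> y \<le> Nu i" if y: "Nu n < y" "y \<le> Nu 0" for y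
  proof -
    have "\<exists>i<n. (\<forall>j\<le>i. \<not> Nu j < y) \<and> Nu (Suc i) < y"
      using ex_least_nat_less[of "\<lambda>j. Nu j < y" n] y by auto
    then show ?thesis by (meson le_refl not_less)
  qed
  have uniq: "i = j" if "i < n" "j < n" "Nu (Suc i) < y" "y \<le> Nu i" "Nu (Suc j) < y" "y \<le> Nu j" for i j y
    using that mono[of "Suc i" j] mono[of "Suc j" i] by (cases i j rule: linorder_cases) auto
  define \<iota> where "\<iota> = (\<lambda>x. SOME i. i < n \<and> Nu (Suc i) < L x \<and> L x \<le> Nu i)"
  have \<iota>: "\<iota> x < n" "Nu (Suc (\<iota> x)) < L x" "L x \<le> Nu (\<iota> x)" if x: "x \<in> ?T" "x \<noteq> x0" for x
    using someI_ex[OF slot[OF Lgt[OF x] Lle[OF x(1)]]] unfolding \<iota>_def by blast+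
  define \<phi> where "\<phi> = (\<lambda>x. x(\<iota> x := L x))"
  \<comment> \<open>After the exchange the new last coordinate lies in the same interval, so the
    interval index is preserved and the map is an involution.\<close>
  have main: "\<phi> x \<in> ?T - {x0} \<and> \<phi> (\<phi> x) = x \<and> D (ev (\<phi> x)) = - D (ev x)" if "x \<in> ?T - {x0}" for x
  proof -
    have x: "x \<in> ?T" "x \<noteq> x0" using that by auto
    let ?i = "\<iota> x"
    have xi: "Nu (Suc ?i) < x ?i" "x ?i \<le> Nu ?i" using x(1) \<iota>(1)[OF x] by (auto simp: PiE_iff)
    have "\<phi> x i = undefined" if "i \<notin> {..<n}" for i
      using that x(1) \<iota>(1)[OF x] by (auto simp: \<phi>_def PiE_def extensional_def)
    then have \<phi>T: "\<phi> x \<in> ?T"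
      using x(1) \<iota>[OF x] by (auto simp: PiE_iff \<phi>_def extensional_def)
    have "(\<Sum>i<n. \<phi> x i) = (\<Sum>i<n. x i) + (L x - x ?i)"
    proof -
      have "(\<Sum>i<n. \<phi> x i) = (\<Sum>i<n. x i + (if i = ?i then L x - x ?i else 0))"
        by (intro sum.cong refl) (simp add: \<phi>_def)
      then show ?thesis using \<iota>(1)[OF x] by (simp add: sum.distrib)
    qed
    then have L\<phi>: "L (\<phi> x) = x ?i" by (simp add: L_def)
    have \<phi>0: "\<phi> x \<noteq> x0"
    proof
      assume "\<phi> x = x0"
      then have "x ?i = Nu n" using L\<phi> Lx0 by simp
      then show False using xi mono[of "Suc ?i" n] \<iota>(1)[OF x] by simp
    qed
    have "\<iota> (\<phi> x) = ?i"
      using \<iota>[OF \<phi>T \<phi>0] \<iota>(1)[OF x] xi uniq unfolding L\<phi> by blast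
    then have inv: "\<phi> (\<phi> x) = x" by (simp add: \<phi>_def[of] L\<phi>[unfolded \<phi>_def] fun_eq_iff)
    have \<phi>v: "\<phi> x i = (if i = ?i then L x else x i)" for i by (simp add: \<phi>_def)
    have "D (ev (\<phi> x)) = D (ev x \<circ> transpose ?i n)"
      by (rule alternating_cong[OF D]) (use \<iota>(1)[OF x] in \<open>auto simp: ev_def L\<phi> transpose_def \<phi>v\<close>)
    also have "\<dots> = - D (ev x)" using D \<iota>(1)[OF x] unfolding alternating_def by blast
    finally show ?thesis using \<phi>T \<phi>0 inv by blast
  qed
  have "(\<Sum>x\<in>?T - {x0}. D (ev x)) = 0"
    by (rule sum_eq_neg_self, rule sum.reindex_bij_witness[of _ \<phi> \<phi>]) (use main in auto)
  then have "(\<Sum>x\<in>?T. D (ev x)) = D (ev x0)"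
    using sum.remove[OF fin x0, of "\<lambda>x. D (ev x)"] by simp
  also have "\<dots> = D Nu"
  proof (rule alternating_cong[OF D])
    have "x0 i = Nu i" if "i < n" for i using that by (simp add: x0_def)
    then show "ev x0 i = Nu i" if "i < Suc n" for i using that Lx0 by (auto simp: ev_def less_Suc_eq)
  qed
  finally show ?thesis unfolding ev_def L_def .
qed

lemma gtm_vanish:
  assumes "e \<in> gtm k m q" "c \<le> r" "r < k" "c \<le> m"
  shows "cum e r c = 0"
  using assms(2-)
proof (induction r arbitrary: c)
  case (Suc r)
  show ?case
  proof (cases c)
    case (Suc c')
    have "cum e (Suc r) (Suc c') \<le> cum e r c'" using assms(1) Suc.prems Suc by (simp add: gtm_def)
    also have "\<dots> = 0" using Suc.IH[of c'] Suc.prems Suc by simp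
    finally show ?thesis by (simp add: Suc)
  qed simp
qed simp

text \<open>A dual form of the identity that the staircase alternant times a Schur polynomial is the
  alternant of the shifted shape. Induction on the number of letters: removing the largest letter
  leaves a tableau of interlacing shape \<open>\<kappa>\<close>, and the sum over
  \<open>\<kappa>\<close> collapses by \<open>alternating_interlacing\<close>.\<close>

theorem alternating_gtm:
  assumes "alternating n D" "\<And>r. p (Suc r) \<le> p r" "\<And>r. r \<ge> n \<Longrightarrow> p r = 0" "n \<le> k"
  shows "(\<Sum>e\<in>gtm k n p. D (\<lambda>i. int (csum k e i) + (int n - 1 - int i))) = D (\<lambda>i. int (p i) + (int n - 1 - int i))"
  using assms
proof (induction n arbitrary: p D)
  case 0
  have "gtm k 0 p = {\<lambda>_ _. 0}" using 0(3) by (auto simp: gtm_def fun_eq_iff)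
  then show ?case using 0(1) by (simp add: alternating_def)
next
  case (Suc n)
  define Kap where "Kap = {\<kappa>. (\<forall>r\<ge>n. \<kappa> r = 0) \<and> (\<forall>r<n. p (Suc r) \<le> \<kappa> r \<and> \<kappa> r \<le> p r)}"
  define up where "up = (\<lambda>(\<kappa> :: nat \<Rightarrow> nat, e' :: nat \<Rightarrow> nat \<Rightarrow> nat). \<lambda>r c. if c = n then p r - \<kappa> r else e' r c)"
  define dn where "dn = (\<lambda>e :: nat \<Rightarrow> nat \<Rightarrow> nat. (\<lambda>r. cum e r n, \<lambda>r c. if c < n then e r c else 0))"
  define last where "last = (\<lambda>\<kappa>. (\<Sum>r\<le>n. int (p r)) - (\<Sum>r<n. int (\<kappa> r)))"
  \<comment> \<open>The coordinate of the removed letter is frozen at its content. The shift by 1 is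
    the difference between the staircases for \<open>n + 1\<close> and \<open>n\<close>
    letters.\<close>
  define D' where "D' = (\<lambda>\<kappa> x. D (\<lambda>i. if i < n then x i + 1 else last \<kappa>))"
  have nk: "n < k" using Suc.prems(4) by simp
  have cumcut: "cum (\<lambda>r c. if c < n then e r c else 0) r c = cum e r c" if "c \<le> n" for e r c
    unfolding cum_def using that by (intro sum.cong) auto
  have \<kappa>le: "\<kappa> r \<le> p r" if "\<kappa> \<in> Kap" for \<kappa> r using that by (cases "r < n") (auto simp: Kap_def)
  have dn: "dn e \<in> Sigma Kap (gtm k n)" and updn: "up (dn e) = e" if e: "e \<in> gtm k (Suc n) p" for e
  proof -
    have 1: "cum e r n = 0" if "r \<ge> n" for r
    proof (cases "r < k")
      case True
      then show ?thesis using gtm_vanish[OF e that True] by simp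
    next
      case False
      then show ?thesis using e by (simp add: cum_def gtm_def)
    qed
    have row: "cum e r (Suc n) = p r" if "r < k" for r using e that by (simp add: gtm_def)
    have 2: "cum e r n \<le> p r" if "r < k" for r using row[OF that] by (simp add: cum_Suc)
    have 3: "p (Suc r) \<le> cum e r n" if "r < n" for r
    proof -
      have "Suc r < k" using that nk by simp
      then have "cum e (Suc r) (Suc n) \<le> cum e r n" using e unfolding gtm_def by blast
      then show ?thesis using row[of "Suc r"] that nk by simp
    qed
    have "(\<lambda>r. cum e r n) \<in> Kap" using 1 2 3 nk by (simp add: Kap_def)
    moreover have "(\<lambda>r c. if c < n then e r c else 0) \<in> gtm k n (\<lambda>r. cum e r n)"
      unfolding gtm_def
    proof (intro CollectI conjI allI impI)
      fix r c assume "\<not> (r < k \<and> c < n)"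
      then show "(if c < n then e r c else 0) = 0" using e by (auto simp: gtm_def)
    next
      fix r c assume "Suc r < k" "c < n"
      then show "cum (\<lambda>r c. if c < n then e r c else 0) (Suc r) (Suc c) \<le> cum (\<lambda>r c. if c < n then e r c else 0) r c"
        using e by (simp add: cumcut gtm_def)
    qed (simp add: cumcut)
    ultimately show "dn e \<in> Sigma Kap (gtm k n)" by (simp add: dn_def)
    show "up (dn e) = e"
    proof (intro ext)
      fix r c
      consider "c < n" | "c = n" "r < k" | "c = n" "\<not> r < k" | "c > n" by linarith
      then show "up (dn e) r c = e r c"
      proof cases
        case 2
        then show ?thesis using row[of r] by (simp add: up_def dn_def cum_Suc)
      next
        case 3
        then show ?thesis using e Suc.prems(3)[of r] nk by (simp add: up_def dn_def gtm_def)
      next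
        case 4
        then show ?thesis using e by (simp add: up_def dn_def gtm_def)
      qed (simp add: up_def dn_def)
    qed
  qed
  have up: "up x \<in> gtm k (Suc n) p" and dnup: "dn (up x) = x" 
    and val: "D (\<lambda>i. int (csum k (up x) i) + (int (Suc n) - 1 - int i)) = D' (fst x) (\<lambda>i. int (csum k (snd x) i) + (int n - 1 - int i))"
    if x: "x \<in> Sigma Kap (gtm k n)" for x
  proof -
    obtain \<kappa> e where xe: "x = (\<kappa>, e)" by (cases x)
    have \<kappa>: "\<kappa> \<in> Kap" and e: "e \<in> gtm k n \<kappa>" using x xe by auto
    have c1: "cum (up x) r c = cum e r c" if "c \<le> n" for r c
      unfolding cum_def xe up_def using that by (intro sum.cong) auto
    have en: "cum e r n = \<kappa> r" if "r < k" for r using e that by (simp add: gtm_def)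
    have c2: "cum (up x) r (Suc n) = p r" if "r < k" for r
      using c1[of n r] en[OF that] \<kappa>le[OF \<kappa>, of r] by (simp add: cum_Suc xe up_def)
    show "up x \<in> gtm k (Suc n) p"
      unfolding gtm_def
    proof (intro CollectI conjI allI impI)
      fix r c assume "\<not> (r < k \<and> c < Suc n)"
      then show "up x r c = 0" using e Suc.prems(3)[of r] nk by (auto simp: xe up_def gtm_def)
    next
      fix r c assume r: "Suc r < k" and "c < Suc n"
      then consider "c < n" | "c = n" by linarith
      then show "cum (up x) (Suc r) (Suc c) \<le> cum (up x) r c"
      proof cases
        case 1
        then show ?thesis using e r by (simp add: c1 gtm_def)
      next
        case 2
        have "p (Suc r) \<le> \<kappa> r"
          using \<kappa> Suc.prems(3)[of "Suc r"] by (cases "r < n") (auto simp: Kap_def)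
        then show ?thesis using 2 c2[OF r] c1[of n r] en[of r] r by simp
      qed
    qed (rule c2)
    have \<kappa>0: "\<kappa> r = 0" if "r \<ge> n" for r using \<kappa> that by (simp add: Kap_def)
    have "cum (up x) r n = \<kappa> r" for r
    proof (cases "r < k")
      case True
      then show ?thesis using c1[of n r] en by simp
    next
      case False
      then have "cum e r n = 0" using e by (simp add: cum_def gtm_def)
      then show ?thesis using False \<kappa>0[of r] nk c1[of n r] by simp
    qed
    then have f1: "(\<lambda>r. cum (up x) r n) = \<kappa>" by (rule ext)
    have f2: "(\<lambda>r c. if c < n then up x r c else 0) = e"
      by (intro ext) (use e in \<open>auto simp: xe up_def gtm_def\<close>)
    have "dn (up x) = (\<kappa>, e)" unfolding dn_def f1 f2 ..
    then show "dn (up x) = x" by (simp only: xe)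
    have "csum k (up x) i = csum k e i" if "i < n" for i using that by (simp add: csum_def xe up_def)
    moreover have "int (csum k (up x) n) = last \<kappa>"
    proof -
      have "int (csum k (up x) n) = (\<Sum>r<k. int (p r)) - (\<Sum>r<k. int (\<kappa> r))"
        using \<kappa>le[OF \<kappa>] by (simp add: csum_def xe up_def of_nat_diff sum_subtractf)
      also have "(\<Sum>r<k. int (p r)) = (\<Sum>r\<le>n. int (p r))"
        by (rule sum.mono_neutral_right) (use nk Suc.prems(3) in auto)
      also have "(\<Sum>r<k. int (\<kappa> r)) = (\<Sum>r<n. int (\<kappa> r))"
        by (rule sum.mono_neutral_right) (use nk \<kappa>0 in auto)
      finally show ?thesis by (simp add: last_def)
    qed
    ultimately show "D (\<lambda>i. int (csum k (up x) i) + (int (Suc n) - 1 - int i)) = D' (fst x) (\<lambda>i. int (csum k (snd x) i) + (int n - 1 - int i))"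
      unfolding D'_def xe by (intro alternating_cong[OF Suc.prems(1)]) (auto simp: less_Suc_eq)
  qed
  define Nu where "Nu = (\<lambda>i. int (p i) + (int n - int i))"
  have finK: "finite Kap"
  proof (rule finite_subset)
    show "Kap \<subseteq> (\<lambda>f i. if i < n then f i else 0) ` PiE {..<n} (\<lambda>i. {..p i})"
    proof
      fix \<kappa> assume "\<kappa> \<in> Kap"
      then have "\<kappa> = (\<lambda>i. if i < n then restrict \<kappa> {..<n} i else 0)" "restrict \<kappa> {..<n} \<in> PiE {..<n} (\<lambda>i. {..p i})"
        by (auto simp: Kap_def fun_eq_iff)
      then show "\<kappa> \<in> (\<lambda>f i. if i < n then f i else 0) ` PiE {..<n} (\<lambda>i. {..p i})" by (rule image_eqI)
    qed
  qed (intro finite_imageI finite_PiE, auto)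
  have "(\<Sum>e\<in>gtm k (Suc n) p. D (\<lambda>i. int (csum k e i) + (int (Suc n) - 1 - int i)))
     = (\<Sum>x\<in>Sigma Kap (gtm k n). D' (fst x) (\<lambda>i. int (csum k (snd x) i) + (int n - 1 - int i)))"
  proof (rule sum.reindex_bij_witness[of _ up dn])
    fix e assume e: "e \<in> gtm k (Suc n) p"
    show "up (dn e) = e" "dn e \<in> Sigma Kap (gtm k n)" using dn[OF e] updn[OF e] by auto
    show "D' (fst (dn e)) (\<lambda>i. int (csum k (snd (dn e)) i) + (int n - 1 - int i)) = D (\<lambda>i. int (csum k e i) + (int (Suc n) - 1 - int i))"
      using val[OF dn[OF e]] updn[OF e] by simp
  next
    fix x assume x: "x \<in> Sigma Kap (gtm k n)"
    show "dn (up x) = x" "up x \<in> gtm k (Suc n) p" by (rule dnup[OF x], rule up[OF x])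
  qed
  also have "\<dots> = (\<Sum>\<kappa>\<in>Kap. \<Sum>e\<in>gtm k n \<kappa>. D' \<kappa> (\<lambda>i. int (csum k e i) + (int n - 1 - int i)))"
    by (subst sum.Sigma) (auto simp: finK finite_gtm split_def)
  also have "\<dots> = (\<Sum>\<kappa>\<in>Kap. D' \<kappa> (\<lambda>i. int (\<kappa> i) + (int n - 1 - int i)))"
  proof (rule sum.cong[OF refl])
    fix \<kappa> assume \<kappa>: "\<kappa> \<in> Kap"
    have alt: "alternating n (D' \<kappa>)"
      unfolding alternating_def
    proof (intro conjI allI impI)
      fix x y :: "nat \<Rightarrow> int" assume "\<forall>i<n. x i = y i"
      then show "D' \<kappa> x = D' \<kappa> y" unfolding D'_def by (intro alternating_cong[OF Suc.prems(1)]) auto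
    next
      fix x :: "nat \<Rightarrow> int" and i j assume ij: "i < j" "j < n"
      have "(\<lambda>q. if q < n then (x \<circ> transpose i j) q + 1 else last \<kappa>) = (\<lambda>q. if q < n then x q + 1 else last \<kappa>) \<circ> transpose i j"
        using ij by (auto simp: fun_eq_iff transpose_def)
      then show "D' \<kappa> (x \<circ> transpose i j) = - D' \<kappa> x"
        unfolding D'_def using Suc.prems(1) ij unfolding alternating_def by auto
    qed
    show "(\<Sum>e\<in>gtm k n \<kappa>. D' \<kappa> (\<lambda>i. int (csum k e i) + (int n - 1 - int i))) = D' \<kappa> (\<lambda>i. int (\<kappa> i) + (int n - 1 - int i))"
    proof (rule Suc.IH[OF alt])
      show "\<kappa> (Suc r) \<le> \<kappa> r" for r
      proof (cases "Suc r < n")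
        case True
        then have "\<kappa> (Suc r) \<le> p (Suc r)" "p (Suc r) \<le> \<kappa> r" using \<kappa> by (auto simp: Kap_def)
        then show ?thesis by simp
      next
        case False
        then show ?thesis using \<kappa> by (simp add: Kap_def)
      qed
    qed (use \<kappa> nk in \<open>auto simp: Kap_def\<close>)
  qed
  \<comment> \<open>Adding the staircase turns the weak interlacing of \<open>\<kappa>\<close> with
    \<open>p\<close> into disjoint half-open intervals.\<close>
  also have "\<dots> = (\<Sum>x\<in>PiE {..<n} (\<lambda>i. {Nu (Suc i)<..Nu i}). D (\<lambda>i. if i < n then x i else (\<Sum>i\<le>n. Nu i) - (\<Sum>i<n. x i)))"
  proof (rule sum.reindex_bij_witness[where i = "\<lambda>x i. if i < n then nat (x i - (int n - int i)) else 0"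
        and j = "\<lambda>\<kappa>. \<lambda>i\<in>{..<n}. int (\<kappa> i) + (int n - int i)"])
    fix \<kappa> assume \<kappa>: "\<kappa> \<in> Kap"
    show "(\<lambda>i. if i < n then nat ((\<lambda>i\<in>{..<n}. int (\<kappa> i) + (int n - int i)) i - (int n - int i)) else 0) = \<kappa>"
      using \<kappa> by (auto simp: fun_eq_iff Kap_def)
    show "(\<lambda>i\<in>{..<n}. int (\<kappa> i) + (int n - int i)) \<in> PiE {..<n} (\<lambda>i. {Nu (Suc i)<..Nu i})"
      using \<kappa> by (auto simp: Nu_def Kap_def le_less_Suc_eq)
    have "(\<Sum>i\<le>n. Nu i) = (\<Sum>i\<le>n. int (p i)) + (\<Sum>i<n. int n - int i)"
      by (simp add: Nu_def sum.distrib lessThan_Suc_atMost[symmetric])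
    then have "(\<Sum>i\<le>n. Nu i) - (\<Sum>i<n. (\<lambda>i\<in>{..<n}. int (\<kappa> i) + (int n - int i)) i) = last \<kappa>"
      by (simp add: last_def sum.distrib)
    then show "D (\<lambda>i. if i < n then (\<lambda>i\<in>{..<n}. int (\<kappa> i) + (int n - int i)) i
        else (\<Sum>i\<le>n. Nu i) - (\<Sum>i<n. (\<lambda>i\<in>{..<n}. int (\<kappa> i) + (int n - int i)) i))
      = D' \<kappa> (\<lambda>i. int (\<kappa> i) + (int n - 1 - int i))"
      unfolding D'_def by (intro alternating_cong[OF Suc.prems(1)]) auto
  next
    fix x assume x: "x \<in> PiE {..<n} (\<lambda>i. {Nu (Suc i)<..Nu i})"
    have b: "int (p (Suc i)) + (int n - int i) \<le> x i" "x i \<le> int (p i) + (int n - int i)" if "i < n" for i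
      using x that by (auto simp: Nu_def PiE_iff Ball_def)
    show "(\<lambda>i\<in>{..<n}. int (if i < n then nat (x i - (int n - int i)) else 0) + (int n - int i)) = x"
    proof
      fix i
      show "(\<lambda>i\<in>{..<n}. int (if i < n then nat (x i - (int n - int i)) else 0) + (int n - int i)) i = x i"
        using b[of i] x by (cases "i < n") (auto simp: PiE_def extensional_def)
    qed
    show "(\<lambda>i. if i < n then nat (x i - (int n - int i)) else 0) \<in> Kap"
      using b by (fastforce simp: Kap_def)
  qed
  also have "\<dots> = D Nu"
    by (rule alternating_interlacing[OF Suc.prems(1)]) (use Suc.prems(2) in \<open>simp add: Nu_def le_imp_less_Suc add_mono_thms_linordered_field\<close>)
  also have "Nu = (\<lambda>i. int (p i) + (int (Suc n) - 1 - int i))" by (simp add: Nu_def)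
  finally show ?case .
qed

section \<open>Plethystic tableaux\<close>

text \<open>Each element is numbered by how many elements precede it.\<close>

lemma strict_order_enumeration:
  assumes A: "finite A" and irr: "\<And>x. x \<in> A \<Longrightarrow> \<not> prec x x"
    and tr: "\<And>x y z. x \<in> A \<Longrightarrow> y \<in> A \<Longrightarrow> z \<in> A \<Longrightarrow> prec x y \<Longrightarrow> prec y z \<Longrightarrow> prec x z"
    and tot: "\<And>x y. x \<in> A \<Longrightarrow> y \<in> A \<Longrightarrow> x \<noteq> y \<Longrightarrow> prec x y \<or> prec y x"
  obtains \<tau> where "bij_betw \<tau> {..<card A} A"
    "\<And>c d. c < card A \<Longrightarrow> d < card A \<Longrightarrow> prec (\<tau> c) (\<tau> d) \<longleftrightarrow> c < d"
proof -
  define rank where "rank = (\<lambda>x. card {y \<in> A. prec y x})"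
  have mono: "rank x < rank y" if "x \<in> A" "y \<in> A" "prec x y" for x y
    unfolding rank_def
  proof (rule psubset_card_mono)
    show "{z \<in> A. prec z x} \<subset> {z \<in> A. prec z y}"
    proof (rule psubsetI)
      show "{z \<in> A. prec z x} \<subseteq> {z \<in> A. prec z y}" using tr[OF _ that(1,2) _ that(3)] by blast
      have "x \<in> {z \<in> A. prec z y}" "x \<notin> {z \<in> A. prec z x}" using that irr by auto
      then show "{z \<in> A. prec z x} \<noteq> {z \<in> A. prec z y}" by metis
    qed
  qed (use A in simp)
  have inj: "inj_on rank A"
  proof (rule inj_onI)
    fix x y assume "x \<in> A" "y \<in> A" "rank x = rank y"
    then show "x = y" using tot[of x y] mono[of x y] mono[of y x] by auto
  qed
  have "rank ` A \<subseteq> {..<card A}"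
  proof safe
    fix x assume x: "x \<in> A"
    have "{y \<in> A. prec y x} \<subset> A" using irr[OF x] x by blast
    then show "rank x < card A" unfolding rank_def using A by (rule psubset_card_mono[rotated])
  qed
  moreover have "card (rank ` A) = card {..<card A}" using card_image[OF inj] by simp
  ultimately have im: "rank ` A = {..<card A}" by (intro card_subset_eq) auto
  then have bij: "bij_betw rank A {..<card A}" using inj by (simp add: bij_betw_def)
  define \<tau> where "\<tau> = inv_into A rank"
  have b: "bij_betw \<tau> {..<card A} A" unfolding \<tau>_def using bij by (rule bij_betw_inv_into)
  have r: "rank (\<tau> c) = c" "\<tau> c \<in> A" if "c < card A" for c
    unfolding \<tau>_def using that im by (auto intro: f_inv_into_f inv_into_into)
  have "prec (\<tau> c) (\<tau> d) \<longleftrightarrow> c < d" if "c < card A" "d < card A" for c d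
  proof
    assume "prec (\<tau> c) (\<tau> d)"
    then show "c < d" using mono[of "\<tau> c" "\<tau> d"] r that by simp
  next
    assume cd: "c < d"
    then have "\<tau> c \<noteq> \<tau> d" using r(1)[OF that(1)] r(1)[OF that(2)] by auto
    moreover have "\<not> prec (\<tau> d) (\<tau> c)" using mono[of "\<tau> d" "\<tau> c"] r that cd by auto
    ultimately show "prec (\<tau> c) (\<tau> d)" using tot[of "\<tau> c" "\<tau> d"] r that by auto
  qed
  then show ?thesis using that b by blast
qed

lemma partition_support:
  assumes "is_partition p"
  shows "{i. p i \<noteq> 0} = {..<plength p}" and "finite (cells p)" and "p (Suc r) \<le> p r" and "plength p \<le> i \<Longrightarrow> p i = 0"
proof -
  show s: "{i. p i \<noteq> 0} = {..<plength p}"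
    unfolding plength_def
  proof (rule down_closed_card)
    show "i \<in> {i. p i \<noteq> 0}" if "j \<in> {i. p i \<noteq> 0}" "i \<le> j" for i j
    proof -
      have "p j \<le> p i" using assms that(2) by (simp add: is_partition_def)
      then show ?thesis using that(1) by auto
    qed
  qed (use assms in \<open>simp add: is_partition_def\<close>)
  have "cells p = Sigma {i. p i \<noteq> 0} (\<lambda>i. {..<p i})" by (auto simp: cells_def)
  then show "finite (cells p)" using s by simp
  show "p (Suc r) \<le> p r" using assms by (simp add: is_partition_def)
  show "p i = 0" if "plength p \<le> i"
  proof -
    have "i \<notin> {..<plength p}" using that by simp
    then have "i \<notin> {i. p i \<noteq> 0}" unfolding s .
    then show ?thesis by simp
  qed
qed

lemma finite_ssyt:
  assumes "is_partition p"
  shows "finite (ssyt p n)"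
proof -
  have "bij_betw (tab_matrix p) (ssyt p n) (gtm (plength p) n p)"
    by (rule tab_matrix_bij) (use partition_support[OF assms] in auto)
  then show ?thesis using finite_gtm bij_betw_finite by blast
qed

lemma reading_word_inj:
  assumes p: "is_partition p" and T: "T \<in> ssyt p n" and U: "U \<in> ssyt p n" and eq: "reading_word p T = reading_word p U"
  shows "T = U"
proof
  fix x :: "nat \<times> nat"
  obtain i j where x: "x = (i, j)" by (cases x)
  have "map (\<lambda>i. map (\<lambda>j. T (i, j)) [0..<p i]) [0..<plength p] = map (\<lambda>i. map (\<lambda>j. U (i, j)) [0..<p i]) [0..<plength p]"
    using eq unfolding reading_word_def by (rule concat_injective) (auto simp: zip_map_map set_zip)
  then have rows: "map (\<lambda>j. T (i, j)) [0..<p i] = map (\<lambda>j. U (i, j)) [0..<p i]" if "i < plength p" for i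
    using that by simp
  show "T x = U x"
  proof (cases "j < p i")
    case True
    then have "i < plength p" using partition_support(4)[OF p, of i] by (cases "i < plength p") auto
    then show ?thesis using rows[of i] True x by simp
  next
    case False
    then show ?thesis using ssyt_outside[OF T False] ssyt_outside[OF U False] x by simp
  qed
qed

lemma ssyt_enumeration:
  assumes "is_partition mu"
  obtains \<tau> where "bij_betw \<tau> {..<card (ssyt mu n)} (ssyt mu n)"
    "\<And>c d. c < card (ssyt mu n) \<Longrightarrow> d < card (ssyt mu n) \<Longrightarrow> tab_less mu (\<tau> c) (\<tau> d) \<longleftrightarrow> c < d"
proof (rule strict_order_enumeration[of "ssyt mu n" "tab_less mu"])
  let ?r = "{(a, b). a < (b :: nat)}"
  show "finite (ssyt mu n)" by (rule finite_ssyt[OF assms])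
  show "\<not> tab_less mu T T" for T unfolding tab_less_def by (rule lexord_irreflexive) auto
  have "trans ?r" by (auto simp: trans_def)
  then show "tab_less mu T W" if "tab_less mu T U" "tab_less mu U W" for T U W
    using that unfolding tab_less_def by (metis lexord_trans)
  show "tab_less mu T U \<or> tab_less mu U T" if "T \<in> ssyt mu n" "U \<in> ssyt mu n" "T \<noteq> U" for T U
  proof -
    have "reading_word mu T \<noteq> reading_word mu U" using reading_word_inj[OF assms that(1,2)] that(3) by blast
    moreover have "total (lexord ?r)" by (rule total_lexord) (auto simp: total_on_def)
    ultimately show ?thesis unfolding tab_less_def total_on_def by blast
  qed
qed (use that in blast)

section \<open>Plethystic tableaux as ordinary tableaux over numbered letters\<close>

definition fill :: "(nat \<Rightarrow> nat) \<Rightarrow> (nat \<Rightarrow> (nat \<times> nat \<Rightarrow> nat)) \<Rightarrow> (nat \<times> nat \<Rightarrow> nat) \<Rightarrow> nat \<times> nat \<Rightarrow> (nat \<times> nat \<Rightarrow> nat)" where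
  "fill lam \<tau> T = (\<lambda>x. if x \<in> cells lam then \<tau> (T x) else (\<lambda>_. 0))"

lemma fill_bij:
  assumes lam: "\<And>r. lam (Suc r) \<le> lam r" and \<tau>: "bij_betw \<tau> {..<m} (ssyt mu n)"
    and less: "\<And>c d. c < m \<Longrightarrow> d < m \<Longrightarrow> tab_less mu (\<tau> c) (\<tau> d) \<longleftrightarrow> c < d"
  shows "bij_betw (fill lam \<tau>) (ssyt lam m) (pleth_tableaux lam mu n)"
proof -
  have le: "tab_le mu (\<tau> c) (\<tau> d) \<longleftrightarrow> c \<le> d" if "c < m" "d < m" for c d
    using less[OF that] that bij_betw_imp_inj_on[OF \<tau>] by (auto simp: tab_le_def inj_on_def le_less)
  define \<sigma> where "\<sigma> = inv_into {..<m} \<tau>"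
  have \<sigma>: "\<tau> (\<sigma> U) = U" "\<sigma> U < m" if "U \<in> ssyt mu n" for U
    using that \<tau> unfolding \<sigma>_def bij_betw_def by (auto simp: f_inv_into_f) (metis inv_into_into lessThan_iff)
  have \<sigma>\<tau>: "\<sigma> (\<tau> c) = c" if "c < m" for c
    using that bij_betw_imp_inj_on[OF \<tau>] by (simp add: \<sigma>_def)
  have \<tau>S: "\<tau> c \<in> ssyt mu n" if "c < m" for c using that \<tau> by (auto simp: bij_betw_def)
  have cell: "(i, j) \<in> cells lam \<longleftrightarrow> j < lam i" for i j by (simp add: cells_def)
  define un where "un = (\<lambda>F x. if x \<in> cells lam then \<sigma> (F x) else 0)"
  show ?thesis
  proof (rule bij_betw_byWitness[where f' = un])
    show "\<forall>T\<in>ssyt lam m. un (fill lam \<tau> T) = T"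
    proof (intro ballI ext)
      fix T x assume T: "T \<in> ssyt lam m"
      then show "un (fill lam \<tau> T) x = T x"
        using \<sigma>\<tau>[of "T x"] by (cases x) (auto simp: un_def fill_def ssyt_def)
    qed
    show "\<forall>F\<in>pleth_tableaux lam mu n. fill lam \<tau> (un F) = F"
    proof (intro ballI ext)
      fix F x y assume F: "F \<in> pleth_tableaux lam mu n"
      then show "fill lam \<tau> (un F) x y = F x y"
        using \<sigma>(1)[of "F x"] by (cases x) (auto simp: un_def fill_def pleth_tableaux_def)
    qed
    show "fill lam \<tau> ` ssyt lam m \<subseteq> pleth_tableaux lam mu n"
    proof safe
      fix T assume T: "T \<in> ssyt lam m"
      note b = ssyt_bound[OF T]
      have "tab_le mu (\<tau> (T (i, j))) (\<tau> (T (i, Suc j)))" if "Suc j < lam i" for i j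
        using le b[of j i] b[of "Suc j" i] ssyt_row[OF T that] that by simp
      moreover have "tab_less mu (\<tau> (T (i, j))) (\<tau> (T (Suc i, j)))" if "j < lam (Suc i)" for i j
        using less b[of j i] b[of j "Suc i"] ssyt_col[OF T that] that lam[of i] by simp
      moreover have "\<tau> (T c) \<in> ssyt mu n" if "c \<in> cells lam" for c
        using that b \<tau>S by (cases c) (simp add: cell)
      moreover have "j < lam i" if "j < lam (Suc i)" for i j using that lam[of i] by simp
      ultimately show "fill lam \<tau> T \<in> pleth_tableaux lam mu n"
        unfolding pleth_tableaux_def fill_def by (simp add: cell)
    qed
    show "un ` pleth_tableaux lam mu n \<subseteq> ssyt lam m"
    proof safe
      fix F assume F: "F \<in> pleth_tableaux lam mu n"
      have FS: "F (i, j) \<in> ssyt mu n" if "j < lam i" for i j using F that by (simp add: pleth_tableaux_def cell)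
      have "\<sigma> (F (i, j)) \<le> \<sigma> (F (i, Suc j))" if "Suc j < lam i" for i j
      proof -
        have j: "j < lam i" using that by simp
        have "tab_le mu (F (i, j)) (F (i, Suc j))" using F that by (simp add: pleth_tableaux_def)
        then show ?thesis using le[OF \<sigma>(2)[OF FS[OF j]] \<sigma>(2)[OF FS[OF that]]] \<sigma>(1)[OF FS[OF j]] \<sigma>(1)[OF FS[OF that]] by simp
      qed
      moreover have "\<sigma> (F (i, j)) < \<sigma> (F (Suc i, j))" if "j < lam (Suc i)" for i j
      proof -
        have j: "j < lam i" using that lam[of i] by simp
        have "tab_less mu (F (i, j)) (F (Suc i, j))" using F that by (simp add: pleth_tableaux_def)
        then show ?thesis using less[OF \<sigma>(2)[OF FS[OF j]] \<sigma>(2)[OF FS[OF that]]] \<sigma>(1)[OF FS[OF j]] \<sigma>(1)[OF FS[OF that]] by simp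
      qed
      moreover have "\<sigma> (F c) < m" if "c \<in> cells lam" for c using that FS \<sigma>(2) by (cases c) (simp add: cell)
      moreover have "j < lam i" if "j < lam (Suc i)" for i j using that lam[of i] by simp
      ultimately show "un F \<in> ssyt lam m"
        unfolding ssyt_def un_def by (simp add: cell)
    qed
  qed
qed

lemma pweight_fill:
  assumes "finite (cells lam)" "T \<in> ssyt lam m"
  shows "pweight lam mu (fill lam \<tau> T) i = (\<Sum>c<m. content lam T c * content mu (\<tau> c) i)"
proof -
  have T: "T ` cells lam \<subseteq> {..<m}" using assms(2) by (auto simp: ssyt_def)
  have "pweight lam mu (fill lam \<tau> T) i = (\<Sum>x\<in>cells lam. content mu (\<tau> (T x)) i)"
    unfolding pweight_def fill_def by (intro sum.cong) auto
  also have "\<dots> = (\<Sum>c<m. \<Sum>x\<in>{x \<in> cells lam. T x = c}. content mu (\<tau> (T x)) i)"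
    by (rule sum.group[symmetric]) (use assms T in auto)
  also have "\<dots> = (\<Sum>c<m. content lam T c * content mu (\<tau> c) i)"
    by (intro sum.cong refl) (simp add: content_def)
  finally show ?thesis .
qed

lemma pleth_count:
  assumes lam: "is_partition lam" and k: "plength lam \<le> k" and \<tau>: "bij_betw \<tau> {..<m} (ssyt mu n)"
    and less: "\<And>c d. c < m \<Longrightarrow> d < m \<Longrightarrow> tab_less mu (\<tau> c) (\<tau> d) \<longleftrightarrow> c < d"
  shows "card {F \<in> pleth_tableaux lam mu n. P (pweight lam mu F)}
    = card {e \<in> gtm k m lam. P (\<lambda>i. \<Sum>c<m. csum k e c * content mu (\<tau> c) i)}"
proof -
  note ps = partition_support[OF lam]
  have z: "lam r = 0" if "r \<ge> k" for r using ps(4) k that by simp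
  have b1: "bij_betw (fill lam \<tau>) (ssyt lam m) (pleth_tableaux lam mu n)"
    by (rule fill_bij[of lam \<tau> m mu n, OF ps(3) \<tau> less])
  have b2: "bij_betw (tab_matrix lam) (ssyt lam m) (gtm k m lam)"
    by (rule tab_matrix_bij[of lam k m, OF ps(3) z])
  have w: "pweight lam mu (fill lam \<tau> T) = (\<lambda>i. \<Sum>c<m. csum k (tab_matrix lam T) c * content mu (\<tau> c) i)" if "T \<in> ssyt lam m" for T
    using pweight_fill[OF ps(2) that] content_tab_matrix[of k lam T, OF z] by (simp add: fun_eq_iff)
  have "card {F \<in> pleth_tableaux lam mu n. P (pweight lam mu F)} = card {T \<in> ssyt lam m. P (pweight lam mu (fill lam \<tau> T))}"
  proof (rule bij_betw_same_card[symmetric])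
    show "bij_betw (fill lam \<tau>) {T \<in> ssyt lam m. P (pweight lam mu (fill lam \<tau> T))} {F \<in> pleth_tableaux lam mu n. P (pweight lam mu F)}"
      using b1 unfolding bij_betw_def inj_on_def by auto
  qed
  also have "\<dots> = card {T \<in> ssyt lam m. P (\<lambda>i. \<Sum>c<m. csum k (tab_matrix lam T) c * content mu (\<tau> c) i)}"
    by (intro arg_cong[of _ _ card] Collect_cong) (use w in auto)
  also have "\<dots> = card {e \<in> gtm k m lam. P (\<lambda>i. \<Sum>c<m. csum k e c * content mu (\<tau> c) i)}"
  proof (rule bij_betw_same_card)
    show "bij_betw (tab_matrix lam) {T \<in> ssyt lam m. P (\<lambda>i. \<Sum>c<m. csum k (tab_matrix lam T) c * content mu (\<tau> c) i)}
      {e \<in> gtm k m lam. P (\<lambda>i. \<Sum>c<m. csum k e c * content mu (\<tau> c) i)}"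
      using b2 unfolding bij_betw_def inj_on_def by auto
  qed
  finally show ?thesis .
qed

text \<open>Symmetry is used twice. For the inner shape it yields a permutation
  \<open>\<phi>\<close> of the letters that realizes the permutation \<open>s\<close> of the
  variables on contents; for the outer shape it absorbs \<open>\<phi>\<close>.\<close>

lemma pweight_symmetric:
  assumes lam: "is_partition lam" and mu: "is_partition mu" and s: "s permutes {..<n}"
  shows "card {F \<in> pleth_tableaux lam mu n. P (pweight lam mu F \<circ> s)} = card {F \<in> pleth_tableaux lam mu n. P (pweight lam mu F)}"
proof -
  define m where "m = card (ssyt mu n)"
  define k where "k = plength lam"
  obtain \<tau> where \<tau>: "bij_betw \<tau> {..<m} (ssyt mu n)"
    and less: "\<And>c d. c < m \<Longrightarrow> d < m \<Longrightarrow> tab_less mu (\<tau> c) (\<tau> d) \<longleftrightarrow> c < d"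
    unfolding m_def using ssyt_enumeration[OF mu, of n] by blast
  note ps = partition_support[OF mu]
  have fib: "card {c \<in> {..<m}. content mu (\<tau> c) = b} = card {e \<in> gtm (plength mu) n mu. csum (plength mu) e = b}"
    and fibs: "card {c \<in> {..<m}. content mu (\<tau> c) \<circ> s = b} = card {e \<in> gtm (plength mu) n mu. csum (plength mu) e \<circ> s = b}" for b
  proof -
    have bij: "bij_betw (tab_matrix mu \<circ> \<tau>) {..<m} (gtm (plength mu) n mu)"
      by (rule bij_betw_trans[OF \<tau> tab_matrix_bij]) (use ps in auto)
    have c: "content mu U = csum (plength mu) (tab_matrix mu U)" for U
      using content_tab_matrix[of "plength mu" mu U] ps(4) by (simp add: fun_eq_iff)
    show "card {c \<in> {..<m}. content mu (\<tau> c) = b} = card {e \<in> gtm (plength mu) n mu. csum (plength mu) e = b}"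
      by (rule bij_betw_same_card[of "tab_matrix mu \<circ> \<tau>"]) (use bij in \<open>auto simp: bij_betw_def inj_on_def c\<close>)
    show "card {c \<in> {..<m}. content mu (\<tau> c) \<circ> s = b} = card {e \<in> gtm (plength mu) n mu. csum (plength mu) e \<circ> s = b}"
      by (rule bij_betw_same_card[of "tab_matrix mu \<circ> \<tau>"]) (use bij in \<open>auto simp: bij_betw_def inj_on_def c\<close>)
  qed
  \<comment> \<open>Equality of fibre sizes is equality of multisets, and from that a permutation of
    the letters can be extracted.\<close>
  have ms: "image_mset (\<lambda>c. content mu (\<tau> c) \<circ> s) (mset_set {..<m}) = image_mset (\<lambda>c. content mu (\<tau> c)) (mset_set {..<m})"
  proof (rule multiset_eqI)
    fix b
    show "count (image_mset (\<lambda>c. content mu (\<tau> c) \<circ> s) (mset_set {..<m})) b = count (image_mset (\<lambda>c. content mu (\<tau> c)) (mset_set {..<m})) b"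
      using fib[of b] fibs[of b] gtm_symmetric[OF s, of "plength mu" mu "\<lambda>x. x = b"]
      by (simp add: count_image_mset_eq_card_vimage)
  qed
  obtain \<phi> where \<phi>: "\<phi> permutes {..<m}" "\<forall>c\<in>{..<m}. content mu (\<tau> c) \<circ> s = content mu (\<tau> (\<phi> c))"
    by (rule image_mset_eq_implies_permutes[OF finite_lessThan ms], rule that)
  have swap: "(\<lambda>i. \<Sum>c<m. x c * content mu (\<tau> c) i) \<circ> s = (\<lambda>i. \<Sum>c<m. (x \<circ> inv \<phi>) c * content mu (\<tau> c) i)" for x :: "nat \<Rightarrow> nat"
  proof
    fix i
    have "((\<lambda>i. \<Sum>c<m. x c * content mu (\<tau> c) i) \<circ> s) i = (\<Sum>c<m. x c * content mu (\<tau> (\<phi> c)) i)"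
    proof -
      have "content mu (\<tau> c) (s i) = content mu (\<tau> (\<phi> c)) i" if "c < m" for c
        using fun_cong[OF bspec[OF \<phi>(2)], of c i] that by simp
      then show ?thesis by simp
    qed
    also have "\<dots> = (\<Sum>c<m. (x \<circ> inv \<phi>) (\<phi> c) * content mu (\<tau> (\<phi> c)) i)"
      using permutes_inverses(2)[OF \<phi>(1)] by simp
    also have "\<dots> = (\<Sum>c<m. (x \<circ> inv \<phi>) c * content mu (\<tau> c) i)"
      using sum.permute[OF \<phi>(1), of "\<lambda>c. (x \<circ> inv \<phi>) c * content mu (\<tau> c) i"] by (simp add: comp_def)
    finally show "((\<lambda>i. \<Sum>c<m. x c * content mu (\<tau> c) i) \<circ> s) i = (\<Sum>c<m. (x \<circ> inv \<phi>) c * content mu (\<tau> c) i)" .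
  qed
  define Q where "Q = (\<lambda>x :: nat \<Rightarrow> nat. P (\<lambda>i. \<Sum>c<m. x c * content mu (\<tau> c) i))"
  have "card {F \<in> pleth_tableaux lam mu n. P (pweight lam mu F \<circ> s)} = card {e \<in> gtm k m lam. Q (csum k e \<circ> inv \<phi>)}"
    using pleth_count[OF lam _ \<tau> less, of k "\<lambda>x. P (x \<circ> s)"] by (simp add: k_def Q_def swap)
  also have "\<dots> = card {e \<in> gtm k m lam. Q (csum k e)}"
    by (rule gtm_symmetric[OF permutes_inv[OF \<phi>(1)]])
  also have "\<dots> = card {F \<in> pleth_tableaux lam mu n. P (pweight lam mu F)}"
    using pleth_count[OF lam _ \<tau> less, of k P] by (simp add: k_def Q_def)
  finally show ?thesis .
qed

section \<open>The coefficient in a free number of variables, and its stability\<close>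

definition plethn :: "nat \<Rightarrow> (nat \<Rightarrow> nat) \<Rightarrow> (nat \<Rightarrow> nat) \<Rightarrow> (nat \<Rightarrow> nat) \<Rightarrow> int" where
  "plethn n lam mu nu = (\<Sum>w\<in>{w. w permutes {..<n}}. sign w * int (card {F \<in> pleth_tableaux lam mu n.
            \<forall>i. pweight lam mu F i + staircase n (w i) = nu i + staircase n i}))"

lemma pweight_outside:
  assumes "F \<in> pleth_tableaux lam mu n" "n \<le> i"
  shows "pweight lam mu F i = 0"
  unfolding pweight_def
proof (rule sum.neutral, rule ballI)
  fix c assume "c \<in> cells lam"
  then have "F c \<in> ssyt mu n" using assms(1) by (simp add: pleth_tableaux_def)
  then have e: "{x \<in> cells mu. F c x = i} = {}" using assms(2) by (force simp: ssyt_def)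
  show "content mu (F c) i = 0" unfolding content_def e by simp
qed

text \<open>Since \<open>nu n = 0\<close>, the equation at index \<open>n\<close> forces both
  \<open>w n = n\<close> and weight zero for the new letter, which leaves the configurations in
  \<open>n\<close> variables.\<close>

lemma plethn_Suc:
  assumes lam: "is_partition lam" and mu: "is_partition mu" and nu: "nu n = 0"
  shows "plethn (Suc n) lam mu nu = plethn n lam mu nu"
proof -
  let ?A = "\<lambda>n w. {F \<in> pleth_tableaux lam mu n. \<forall>i. pweight lam mu F i + staircase n (w i) = nu i + staircase n i}"
  have sub: "F \<in> pleth_tableaux lam mu (Suc n)" if "F \<in> pleth_tableaux lam mu n" for F
    using that unfolding pleth_tableaux_def ssyt_def by force
  have shrink: "F \<in> pleth_tableaux lam mu n" if F: "F \<in> pleth_tableaux lam mu (Suc n)" "pweight lam mu F n = 0" for F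
  proof -
    have "F c \<in> ssyt mu n" if c: "c \<in> cells lam" for c
    proof -
      have S: "F c \<in> ssyt mu (Suc n)" using F(1) c by (simp add: pleth_tableaux_def)
      have "content mu (F c) n = 0"
        using F(2) c partition_support(2)[OF lam] unfolding pweight_def by simp
      then have "{x \<in> cells mu. F c x = n} = {}"
        unfolding content_def using partition_support(2)[OF mu] by simp
      then show ?thesis using S unfolding ssyt_def by (force simp: less_Suc_eq)
    qed
    then show ?thesis using F(1) by (simp add: pleth_tableaux_def)
  qed
  have AA: "?A (Suc n) w = ?A n w" if w: "w permutes {..<n}" for w
  proof -
    have wn: "w i = i" if "i \<ge> n" for i using w that by (simp add: permutes_def)
    have wl: "w i < n" if "i < n" for i using permutes_less[OF w that] .
    have eq: "pweight lam mu F i + staircase (Suc n) (w i) = nu i + staircase (Suc n) i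
      \<longleftrightarrow> pweight lam mu F i + staircase n (w i) = nu i + staircase n i" for F i
    proof (cases "i < n")
      case True
      then have "staircase (Suc n) (w i) = Suc (staircase n (w i))" "staircase (Suc n) i = Suc (staircase n i)"
        using wl[OF True] by (auto simp: staircase_def)
      then show ?thesis by simp
    qed (simp add: wn)
    have p0: "pweight lam mu F n = 0" if "\<forall>i. pweight lam mu F i + staircase n (w i) = nu i + staircase n i" for F
      using that[rule_format, of n] wn[of n] nu by simp
    show ?thesis unfolding eq using sub shrink p0 by blast
  qed
  have A0: "?A (Suc n) w = {}" if w: "w permutes {..<Suc n}" "\<not> w permutes {..<n}" for w
  proof -
    have "w n \<noteq> n"
    proof
      assume "w n = n"
      have "w permutes {..<n}"
      proof (rule permutes_superset[OF w(1)])
        show "\<And>x. x \<in> {..<Suc n} - {..<n} \<Longrightarrow> w x = x" using \<open>w n = n\<close> by (auto simp: less_Suc_eq)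
      qed
      then show False using w(2) by blast
    qed
    then have "w n < n" using permutes_less[OF w(1), of n] by simp
    then have "staircase (Suc n) (w n) > 0" "staircase (Suc n) n = 0" by (auto simp: staircase_def)
    then have "pweight lam mu F n + staircase (Suc n) (w n) \<noteq> nu n + staircase (Suc n) n" for F
      using nu by simp
    then show ?thesis by blast
  qed
  have "plethn (Suc n) lam mu nu = (\<Sum>w\<in>{w. w permutes {..<n}}. sign w * int (card (?A (Suc n) w)))"
    unfolding plethn_def
  proof (rule sum.mono_neutral_right)
    show "{w. w permutes {..<n}} \<subseteq> {w. w permutes {..<Suc n}}" by (auto intro: permutes_subset)
    show "\<forall>w\<in>{w. w permutes {..<Suc n}} - {w. w permutes {..<n}}. sign w * int (card (?A (Suc n) w)) = 0"
    proof
      fix w assume "w \<in> {w. w permutes {..<Suc n}} - {w. w permutes {..<n}}"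
      then have "?A (Suc n) w = {}" by (intro A0) auto
      then show "sign w * int (card (?A (Suc n) w)) = 0" by (simp only: card.empty of_nat_0 mult_zero_right)
    qed
  qed simp
  also have "\<dots> = plethn n lam mu nu"
    unfolding plethn_def by (intro sum.cong refl) (use AA in simp)
  finally show ?thesis .
qed

lemma plethn_stable:
  assumes "is_partition lam" "is_partition mu" "is_partition nu" "plength nu \<le> n" "n \<le> N"
  shows "plethn N lam mu nu = plethn n lam mu nu"
  using assms(5)
proof (induction rule: dec_induct)
  case (step N)
  then show ?case using plethn_Suc[OF assms(1,2), of nu N] partition_support(4)[OF assms(3), of N] assms(4) by simp
qed simp

lemma pleth_coeff_plethn:
  assumes "is_partition lam" "is_partition mu" "is_partition nu" "plength mu \<le> n" "plength nu \<le> n"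
  shows "pleth_coeff lam mu nu = plethn n lam mu nu"
proof -
  have "pleth_coeff lam mu nu = plethn (max (plength mu) (plength nu)) lam mu nu"
    unfolding pleth_coeff_def plethn_def Let_def atLeast0LessThan ..
  then show ?thesis using plethn_stable[OF assms(1-3), of "max (plength mu) (plength nu)" n] assms(4,5) by simp
qed

text \<open>The alternant with the shape \<open>nu\<close> inserted is a value of the antisymmetric
  function \<open>D\<close>; \<open>alternating_gtm\<close> expands that value over tableaux of
  shape \<open>nu\<close>. What results is the alternating weight count of a tensor product with a
  dual, in the form of \<open>dim_Inv\<close>.\<close>

theorem plethn_pairs:
  assumes lam: "is_partition lam" and mu: "is_partition mu" and nu: "is_partition nu" "plength nu \<le> n"
  shows "real_of_int (plethn n lam mu nu) = (\<Sum>w | w permutes {..<n}. real_of_int (sign w)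
    * real (card {(F, e) \<in> pleth_tableaux lam mu n \<times> gtm n n nu. \<forall>i<n. int (pweight lam mu F i) - int (csum n e i) = wshift w i}))"
proof -
  let ?P = "pleth_tableaux lam mu n"
  define c where "c = (\<lambda>x w. card {F \<in> ?P. \<forall>i<n. int (pweight lam mu F i) = x i - (int n - 1 - int (w i))})"
  define D where "D = (\<lambda>x. \<Sum>w | w permutes {..<n}. real_of_int (sign w) * real (c x w))"
  have z: "nu i = 0" if "i \<ge> n" for i using partition_support(4)[OF nu(1)] nu(2) that by simp
  have finP: "finite ?P"
  proof -
    obtain \<tau> where \<tau>: "bij_betw \<tau> {..<card (ssyt mu n)} (ssyt mu n)"
      "\<And>c d. c < card (ssyt mu n) \<Longrightarrow> d < card (ssyt mu n) \<Longrightarrow> tab_less mu (\<tau> c) (\<tau> d) \<longleftrightarrow> c < d"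
      by (rule ssyt_enumeration[OF mu, of n], rule that)
    show ?thesis using fill_bij[of lam \<tau> "card (ssyt mu n)" mu n, OF partition_support(3)[OF lam] \<tau>] finite_ssyt[OF lam] bij_betw_finite by blast
  qed
  \<comment> \<open>Antisymmetry of \<open>D\<close> is symmetry of the weights of plethystic
    tableaux combined with the sign of the transposition.\<close>
  have alt: "alternating n D"
    unfolding alternating_def
  proof (intro conjI allI impI)
    fix x y :: "nat \<Rightarrow> int" assume "\<forall>i<n. x i = y i"
    then have "c x w = c y w" for w unfolding c_def by (intro arg_cong[of _ _ card] Collect_cong) auto
    then show "D x = D y" by (simp add: D_def)
  next
    fix x :: "nat \<Rightarrow> int" and i j assume ij: "i < j" "j < n"
    let ?t = "transpose i j"
    have t: "?t permutes {..<n}" using ij by (intro permutes_swap_id) auto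
    have ct: "c (x \<circ> ?t) w = c x (w \<circ> ?t)" for w
    proof -
      have "c (x \<circ> ?t) w = card {F \<in> ?P. \<forall>q<n. int ((pweight lam mu F \<circ> ?t) q) = x q - (int n - 1 - int ((w \<circ> ?t) q))}"
        unfolding c_def
      proof (intro arg_cong[of _ _ card] Collect_cong conj_cong refl)
        fix F
        show "(\<forall>q<n. int (pweight lam mu F q) = (x \<circ> ?t) q - (int n - 1 - int (w q)))
          = (\<forall>q<n. int ((pweight lam mu F \<circ> ?t) q) = x q - (int n - 1 - int ((w \<circ> ?t) q)))" (is "?l = ?r")
        proof
          assume ?l
          show ?r
          proof (intro allI impI)
            fix q assume "q < n"
            then have "?t q < n" using permutes_less[OF t] by blast
            from \<open>?l\<close>[rule_format, OF this] show "int ((pweight lam mu F \<circ> ?t) q) = x q - (int n - 1 - int ((w \<circ> ?t) q))" by simp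
          qed
        next
          assume ?r
          show ?l
          proof (intro allI impI)
            fix q assume "q < n"
            then have "?t q < n" using permutes_less[OF t] by blast
            from \<open>?r\<close>[rule_format, OF this] show "int (pweight lam mu F q) = (x \<circ> ?t) q - (int n - 1 - int (w q))" by simp
          qed
        qed
      qed
      also have "\<dots> = c x (w \<circ> ?t)"
        unfolding c_def by (rule pweight_symmetric[OF lam mu t])
      finally show ?thesis .
    qed
    have "D (x \<circ> ?t) = (\<Sum>w | w permutes {..<n}. - (real_of_int (sign w) * real (c x w)))"
      unfolding D_def
    proof (rule sum.reindex_bij_witness[of _ "\<lambda>w. w \<circ> ?t" "\<lambda>w. w \<circ> ?t"])
      fix w assume "w \<in> {w. w permutes {..<n}}"
      then have w: "w permutes {..<n}" by simp
      have s: "w \<circ> ?t permutes {..<n}" "sign (w \<circ> ?t) = - sign w" using sign_swap[OF w, of i j] ij by auto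
      show "w \<circ> ?t \<circ> ?t = w" "w \<circ> ?t \<circ> ?t = w" by (simp_all add: comp_assoc)
      show "w \<circ> ?t \<in> {w. w permutes {..<n}}" "w \<circ> ?t \<in> {w. w permutes {..<n}}" using s by simp_all
      show "- (real_of_int (sign (w \<circ> ?t)) * real (c x (w \<circ> ?t))) = real_of_int (sign w) * real (c (x \<circ> ?t) w)"
        using s(2) ct by simp
    qed
    then show "D (x \<circ> ?t) = - D x" by (simp add: D_def sum_negf)
  qed
  have "real_of_int (plethn n lam mu nu) = D (\<lambda>i. int (nu i) + (int n - 1 - int i))"
    unfolding plethn_def D_def of_int_sum
  proof (intro sum.cong refl)
    fix w assume "w \<in> {w. w permutes {..<n}}"
    then have w: "w permutes {..<n}" by simp
    have "{F \<in> ?P. \<forall>i. pweight lam mu F i + staircase n (w i) = nu i + staircase n i}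
      = {F \<in> ?P. \<forall>i<n. int (pweight lam mu F i) = int (nu i) + (int n - 1 - int i) - (int n - 1 - int (w i))}"
    proof (rule Collect_cong, rule conj_cong[OF refl])
      fix F assume F: "F \<in> ?P"
      have "pweight lam mu F i + staircase n (w i) = nu i + staircase n i
        \<longleftrightarrow> (i < n \<longrightarrow> int (pweight lam mu F i) = int (nu i) + (int n - 1 - int i) - (int n - 1 - int (w i)))" for i
      proof (cases "i < n")
        case True
        then have "int (staircase n i) = int n - 1 - int i" "int (staircase n (w i)) = int n - 1 - int (w i)"
          using permutes_less[OF w True] by (auto simp: staircase_def)
        then show ?thesis using True by linarith
      next
        case False
        then have "w i = i" using w by (simp add: permutes_def)
        then show ?thesis using False z[of i] pweight_outside[OF F, of i] by simp
      qed
      then show "(\<forall>i. pweight lam mu F i + staircase n (w i) = nu i + staircase n i)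
        = (\<forall>i<n. int (pweight lam mu F i) = int (nu i) + (int n - 1 - int i) - (int n - 1 - int (w i)))" by blast
    qed
    then show "real_of_int (sign w * int (card {F \<in> ?P. \<forall>i. pweight lam mu F i + staircase n (w i) = nu i + staircase n i}))
      = real_of_int (sign w) * real (c (\<lambda>i. int (nu i) + (int n - 1 - int i)) w)"
      by (simp add: c_def)
  qed
  also have "\<dots> = (\<Sum>e\<in>gtm n n nu. D (\<lambda>i. int (csum n e i) + (int n - 1 - int i)))"
    by (rule alternating_gtm[of n D nu n, OF alt partition_support(3)[OF nu(1)] z order_refl, symmetric])
  also have "\<dots> = (\<Sum>w | w permutes {..<n}. real_of_int (sign w) * (\<Sum>e\<in>gtm n n nu. real (c (\<lambda>i. int (csum n e i) + (int n - 1 - int i)) w)))"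
    unfolding D_def sum_distrib_left by (rule sum.swap)
  also have "\<dots> = (\<Sum>w | w permutes {..<n}. real_of_int (sign w)
    * real (card {(F, e) \<in> ?P \<times> gtm n n nu. \<forall>i<n. int (pweight lam mu F i) - int (csum n e i) = wshift w i}))"
  proof (intro sum.cong refl arg_cong2[of _ _ _ _ "(*)"])
    fix w
    let ?S = "\<lambda>e. {F \<in> ?P. \<forall>i<n. int (pweight lam mu F i) = int (csum n e i) + (int n - 1 - int i) - (int n - 1 - int (w i))}"
    have "{(F, e) \<in> ?P \<times> gtm n n nu. \<forall>i<n. int (pweight lam mu F i) - int (csum n e i) = wshift w i}
      = (\<lambda>(e, F). (F, e)) ` Sigma (gtm n n nu) ?S"
      by (force simp: wshift_def algebra_simps image_iff)
    moreover have "inj_on (\<lambda>(e, F). (F, e)) (Sigma (gtm n n nu) ?S)" by (auto simp: inj_on_def)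
    ultimately have "card {(F, e) \<in> ?P \<times> gtm n n nu. \<forall>i<n. int (pweight lam mu F i) - int (csum n e i) = wshift w i} = card (Sigma (gtm n n nu) ?S)"
      by (simp add: card_image)
    also have "\<dots> = (\<Sum>e\<in>gtm n n nu. card (?S e))"
      by (rule card_SigmaI) (use finite_gtm finP in auto)
    finally show "(\<Sum>e\<in>gtm n n nu. real (c (\<lambda>i. int (csum n e i) + (int n - 1 - int i)) w))
      = real (card {(F, e) \<in> ?P \<times> gtm n n nu. \<forall>i<n. int (pweight lam mu F i) - int (csum n e i) = wshift w i})"
      by (simp add: c_def)
  qed
  finally show ?thesis .
qed

section \<open>The plethysm coefficient as a dimension\<close>

lemma bij_betw_Collect_iff:
  assumes "bij_betw f A B" and "\<And>a. a \<in> A \<Longrightarrow> P a \<longleftrightarrow> Q (f a)"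
  shows "bij_betw f {a \<in> A. P a} {b \<in> B. Q b}"
proof -
  have "f ` {a \<in> A. P a} = {b \<in> B. Q b}"
    unfolding bij_betw_imp_surj_on[OF assms(1), symmetric] using assms(2) by auto
  then show ?thesis
    using inj_on_subset[OF bij_betw_imp_inj_on[OF assms(1)], of "{a \<in> A. P a}"] by (auto simp: bij_betw_def)
qed

lemma card_pairs:
  assumes "finite A" "finite G"
  shows "card {(a, e) \<in> A \<times> G. R a e} = (\<Sum>e\<in>G. card {a \<in> A. R a e})"
proof -
  have "bij_betw (\<lambda>(e, a). (a, e)) (Sigma G (\<lambda>e. {a \<in> A. R a e})) {(a, e) \<in> A \<times> G. R a e}"
    by (rule bij_betw_byWitness[where f' = "\<lambda>(a, e). (e, a)"]) auto
  then have "card {(a, e) \<in> A \<times> G. R a e} = card (Sigma G (\<lambda>e. {a \<in> A. R a e}))"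
    by (rule bij_betw_same_card[symmetric])
  then show ?thesis using assms by (simp add: card_SigmaI)
qed

section \<open>Matrix representations and two-block shapes\<close>

lemma col_rep_sum:
  assumes "col_rep n m e wt" "col_rep n m' e' wt'"
  shows "col_rep n (m + m')
    (\<lambda>i j c d. if c < m \<and> d < m then e i j c d else if m \<le> c \<and> m \<le> d then e' i j (c - m) (d - m) else 0)
    (\<lambda>c i. if c < m then wt c i else wt' (c - m) i)" (is "col_rep n _ ?e ?wt")
proof -
  interpret A: col_rep n m e wt by fact
  interpret B: col_rep n m' e' wt' by fact
  show ?thesis
  proof
    fix i j c d assume "i < n" "j < n" "c < m + m'" "d < m + m'"
    then show "?e i j c d = ?e j i d c" using A.e_sym B.e_sym by auto
  next
    fix i c d assume "i < n" "c < m + m'" "d < m + m'"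
    then show "?e i i c d = (if c = d then real_of_int (?wt c i) else 0)"
      using A.e_diag B.e_diag by auto
  next
    fix c i assume "c < m + m'" "n \<le> i"
    then show "?wt c i = 0" using A.wt_zero B.wt_zero by auto
  next
    fix i j k l c d assume ij: "i < n" "j < n" "k < n" "l < n" and cd: "c < m + m'" "d < m + m'"
    have split: "(\<Sum>x<m + m'. f x) = (\<Sum>x<m. f x) + (\<Sum>x<m'. f (m + x))" for f :: "nat \<Rightarrow> real"
      by (induction m') (simp_all add: add.assoc)
    consider "c < m" "d < m" | "m \<le> c" "m \<le> d" | "c < m" "m \<le> d" | "m \<le> c" "d < m" by linarith
    then show "(\<Sum>x<m + m'. ?e i j c x * ?e k l x d) - (\<Sum>x<m + m'. ?e k l c x * ?e i j x d)
      = (if j = k then ?e i l c d else 0) - (if l = i then ?e k j c d else 0)"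
    proof cases
      case 1
      then show ?thesis unfolding split using A.e_comm[OF ij, of c d] by simp
    next
      case 2
      then show ?thesis unfolding split using B.e_comm[OF ij, of "c - m" "d - m"] cd by simp
    qed (simp_all add: split)
  qed
qed

lemma col_rep_std:
  "col_rep n n (\<lambda>i j c d. if c = i \<and> d = j then 1 else 0) (\<lambda>c i. if c = i then 1 else 0)"
proof
  fix i j k l c d assume *: "i < n" "j < n" "k < n" "l < n" "c < n" "d < n"
  have "(\<Sum>x<n. (if c = i \<and> x = j then 1 else 0) * (if x = k \<and> d = l then 1 else 0)) = (if c = i \<and> j = k \<and> d = l then 1 else (0 :: real))"
    if "j < n" for i j k l
  proof -
    have "(\<Sum>x<n. (if c = i \<and> x = j then 1 else 0) * (if x = k \<and> d = l then 1 else 0))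
      = (\<Sum>x<n. if x = j then if c = i \<and> j = k \<and> d = l then 1 else (0 :: real) else 0)"
      by (intro sum.cong refl) auto
    then show ?thesis using that by simp
  qed
  then show "(\<Sum>x<n. (if c = i \<and> x = j then 1 else 0) * (if x = k \<and> d = l then 1 else 0))
     - (\<Sum>x<n. (if c = k \<and> x = l then 1 else 0) * (if x = i \<and> d = j then 1 else 0))
    = (if j = k then if c = i \<and> d = l then 1 else 0 else 0) - (if l = i then if c = k \<and> d = j then 1 else (0 :: real) else 0)"
    using * by simp
qed auto

text \<open>The dual acts by the negative transpose, and by \<open>e_sym\<close> the transpose of
  \<open>e i j\<close> is \<open>e j i\<close>.\<close>

lemma col_rep_dual:
  assumes "col_rep n m e wt"
  shows "col_rep n m (\<lambda>i j c d. - e j i c d) (\<lambda>c i. - wt c i)"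
proof -
  interpret A: col_rep n m e wt by fact
  show ?thesis
  proof
    fix i j k l c d assume "i < n" "j < n" "k < n" "l < n" "c < m" "d < m"
    then show "(\<Sum>x<m. - e j i c x * - e l k x d) - (\<Sum>x<m. - e l k c x * - e j i x d)
      = (if j = k then - e l i c d else 0) - (if l = i then - e j k c d else 0)"
      using A.e_comm[of j i l k c d] by (auto split: if_splits)
  qed (use A.e_sym A.e_diag A.wt_zero in auto)
qed

text \<open>A block-diagonal matrix of variables: \<open>k\<close> rows and \<open>m\<close>
  columns, then \<open>k'\<close> rows and \<open>m'\<close> columns.\<close>

definition V2 :: "nat \<Rightarrow> nat \<Rightarrow> nat \<Rightarrow> nat \<Rightarrow> (nat \<times> nat) set" where
  "V2 k m k' m' = {(c, r). c < m \<and> r < k} \<union> {(c, r). m \<le> c \<and> c < m + m' \<and> k \<le> r \<and> r < k + k'}"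

text \<open>The row \<open>k - 1\<close> is left out, so that the last row of the first block is not
  linked to the first row of the second.\<close>

definition R2 :: "nat \<Rightarrow> nat \<Rightarrow> nat set" where
  "R2 k k' = {a. Suc a < k} \<union> {a. k \<le> a \<and> Suc a < k + k'}"

definition join :: "nat \<Rightarrow> (nat \<Rightarrow> nat) \<Rightarrow> (nat \<Rightarrow> nat) \<Rightarrow> nat \<Rightarrow> nat" where
  "join k p q r = (if r < k then p r else q (r - k))"

lemma shape2: "shape (k + k') (m + m') (V2 k m k' m') (R2 k k')"
  by standard (auto simp: V2_def R2_def)

definition upper :: "nat \<Rightarrow> (nat \<times> nat \<Rightarrow>\<^sub>0 nat) \<Rightarrow> nat \<Rightarrow> nat \<Rightarrow> nat" where
  "upper k t = (\<lambda>r c. if r < k then lookup t (c, r) else 0)"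

definition lower2 :: "nat \<Rightarrow> nat \<Rightarrow> (nat \<times> nat \<Rightarrow>\<^sub>0 nat) \<Rightarrow> nat \<Rightarrow> nat \<Rightarrow> nat" where
  "lower2 k m t = (\<lambda>r c. lookup t (m + c, k + r))"

context
  fixes k m k' m' :: nat
begin

interpretation sh: shape "k + k'" "m + m'" "V2 k m k' m'" "R2 k k'" by (rule shape2)

text \<open>No inequality links the blocks, so the cone is a product of two sets of patterns. The
  columns of the other block only add inequalities between complete rows or empty partial
  sums.\<close>

lemma Sig_join_bij:
  assumes p: "\<And>r. p (Suc r) \<le> p r" and q: "\<And>r. q (Suc r) \<le> q r"
  shows "bij_betw (\<lambda>t. (upper k t, lower2 k m t)) (sh.Sig (join k p q)) (gtm k m p \<times> gtm k' m' q)"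
proof -
  define val where "val = (\<lambda>(e :: nat \<Rightarrow> nat \<Rightarrow> nat, f :: nat \<Rightarrow> nat \<Rightarrow> nat) c r.
    if r < k then e r c else if m \<le> c then f (r - k) (c - m) else 0)"
  define mk where "mk = (\<lambda>x. \<Sum>v\<in>{..<m + m'} \<times> {..<k + k'}. single v (val x (fst v) (snd v)))"
  have cs_up: "cs c r t = cum (upper k t) r c" if "r < k" for t c r
    using that by (simp add: cs_def cum_def upper_def)
  have split: "(\<Sum>x<c. f x) = (\<Sum>x<min c m. f x) + (\<Sum>x<c - m. f (m + x))" for f :: "nat \<Rightarrow> nat" and c
  proof (cases "c \<le> m")
    case False
    then obtain d where "c = m + d" using le_Suc_ex[of m c] by auto
    then have "c = m + d" .
    have "(\<Sum>x<m + d. f x) = (\<Sum>x<m. f x) + (\<Sum>x<d. f (m + x))" by (induction d) (simp_all add: add.assoc)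
    then show ?thesis using \<open>c = m + d\<close> by simp
  qed simp
  \<comment> \<open>Truncated subtraction is intended: up to column \<open>m\<close> the second
    block has contributed nothing.\<close>
  have cs_lo: "cs c (k + r) t = cum (lower2 k m t) r (c - m)" if t: "\<And>v. v \<notin> V2 k m k' m' \<Longrightarrow> lookup t v = 0" for t c r
  proof -
    have "(\<Sum>x<min c m. lookup t (x, k + r)) = 0" by (rule sum.neutral) (use t in \<open>auto simp: V2_def\<close>)
    then show ?thesis unfolding cs_def split[of _ c] by (simp add: cum_def lower2_def)
  qed
  have cum_cut: "cum (upper k t) r c = cum (upper k t) r m" if t: "\<And>v. v \<notin> V2 k m k' m' \<Longrightarrow> lookup t v = 0" and "r < k" "m \<le> c" for t r c
    unfolding cum_def by (rule sum.mono_neutral_right) (use t that in \<open>auto simp: upper_def V2_def\<close>)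
  have main: "t \<in> sh.Sig (join k p q) \<longleftrightarrow> upper k t \<in> gtm k m p \<and> lower2 k m t \<in> gtm k' m' q"
    if t: "\<And>v. v \<notin> V2 k m k' m' \<Longrightarrow> lookup t v = 0" for t
  proof
    assume S: "t \<in> sh.Sig (join k p q)"
    then have row: "\<And>r. r < k + k' \<Longrightarrow> cs (m + m') r t = join k p q r"
      and int: "\<And>a c. a \<in> R2 k k' \<Longrightarrow> c < m + m' \<Longrightarrow> cs (Suc c) (Suc a) t \<le> cs c a t"
      by (auto simp: sh.Sig_def sh.mons_def)
    have "upper k t \<in> gtm k m p"
      unfolding gtm_def
    proof (intro CollectI conjI allI impI)
      fix r c assume "\<not> (r < k \<and> c < m)"
      then show "upper k t r c = 0" using t[of "(c, r)"] by (auto simp: upper_def V2_def)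
    next
      fix r assume r: "r < k"
      then show "cum (upper k t) r m = p r"
        using row[of r] cum_cut[OF t r, of "m + m'"] by (simp add: join_def cs_up)
    next
      fix r c assume "Suc r < k" "c < m"
      then show "cum (upper k t) (Suc r) (Suc c) \<le> cum (upper k t) r c"
        using int[of r c] by (simp add: R2_def cs_up)
    qed
    moreover have "lower2 k m t \<in> gtm k' m' q"
      unfolding gtm_def
    proof (intro CollectI conjI allI impI)
      fix r c assume "\<not> (r < k' \<and> c < m')"
      then show "lower2 k m t r c = 0" using t[of "(m + c, k + r)"] by (auto simp: lower2_def V2_def)
    next
      fix r assume r: "r < k'"
      then show "cum (lower2 k m t) r m' = q r"
        using row[of "k + r"] cs_lo[OF t, of "m + m'" r] by (simp add: join_def)
    next
      fix r c assume "Suc r < k'" "c < m'"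
      then show "cum (lower2 k m t) (Suc r) (Suc c) \<le> cum (lower2 k m t) r c"
        using int[of "k + r" "m + c"] cs_lo[OF t, of "Suc (m + c)" "Suc r"] cs_lo[OF t, of "m + c" r]
        by (simp add: R2_def Suc_diff_le)
    qed
    ultimately show "upper k t \<in> gtm k m p \<and> lower2 k m t \<in> gtm k' m' q" ..
  next
    assume "upper k t \<in> gtm k m p \<and> lower2 k m t \<in> gtm k' m' q"
    then have u: "upper k t \<in> gtm k m p" and l: "lower2 k m t \<in> gtm k' m' q" by auto
    show "t \<in> sh.Sig (join k p q)"
      unfolding sh.Sig_def sh.mons_def
    proof (intro CollectI conjI ballI allI impI)
      show "keys t \<subseteq> V2 k m k' m'" using t by (auto simp: in_keys_iff)
    next
      fix r assume "r < k + k'"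
      show "cs (m + m') r t = join k p q r"
      proof (cases "r < k")
        case True
        then show ?thesis using u cum_cut[OF t True, of "m + m'"] by (simp add: cs_up join_def gtm_def)
      next
        case False
        then obtain r' where "r = k + r'" using le_Suc_ex[of k r] by auto
        then show ?thesis using l cs_lo[OF t, of "m + m'" r'] \<open>r < k + k'\<close> by (simp add: join_def gtm_def)
      qed
    next
      fix a c assume a: "a \<in> R2 k k'" and c: "c < m + m'"
      show "cs (Suc c) (Suc a) t \<le> cs c a t"
      proof (cases "Suc a < k")
        case True
        show ?thesis
        proof (cases "c < m")
          case c': True
          then show ?thesis using u True by (simp add: cs_up gtm_def)
        next
          case False
          \<comment> \<open>Past the last column of the first block both partial sums are complete,
            and the inequality becomes the monotonicity of \<open>p\<close>.\<close>
          then have "cs (Suc c) (Suc a) t = p (Suc a)" "cs c a t = p a"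
            using u True cum_cut[OF t, of "Suc a" "Suc c"] cum_cut[OF t, of a c] by (simp_all add: cs_up gtm_def)
          then show ?thesis using p by simp
        qed
      next
        case False
        then have "k \<le> a" "Suc a < k + k'" using a by (auto simp: R2_def)
        then obtain r where r: "a = k + r" "Suc r < k'" using le_Suc_ex[of k a] by auto
        show ?thesis
        proof (cases "c < m")
          case True
          then show ?thesis using cs_lo[OF t, of "Suc c" "Suc r"] r(1) by simp
        next
          case False
          then have "cs (Suc c) (k + Suc r) t = cum (lower2 k m t) (Suc r) (Suc (c - m))" "cs c (k + r) t = cum (lower2 k m t) r (c - m)"
            using cs_lo[OF t, of "Suc c" "Suc r"] cs_lo[OF t, of c r] by (simp_all add: Suc_diff_le)
          then show ?thesis using l r c False by (simp add: gtm_def)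
        qed
      qed
    qed
  qed
  have outside: "lookup t v = 0" if "t \<in> sh.Sig (join k p q)" "v \<notin> V2 k m k' m'" for t v
    using that by (auto simp: sh.Sig_def sh.mons_def in_keys_iff)
  have lookup_mk: "lookup (mk x) (c, r) = (if c < m + m' \<and> r < k + k' then val x c r else 0)" for x c r
  proof -
    have "lookup (mk x) (c, r) = (\<Sum>v\<in>{..<m + m'} \<times> {..<k + k'}. if v = (c, r) then val x c r else 0)"
      unfolding mk_def lookup_sum by (intro sum.cong refl) (auto simp: lookup_single when_def)
    then show ?thesis by auto
  qed
  have valG: "val (e, f) c r = 0" if "e \<in> gtm k m p" "f \<in> gtm k' m' q" "(c, r) \<notin> V2 k m k' m'" for e f c r
  proof -
    have e: "\<not> (r < k \<and> c < m) \<Longrightarrow> e r c = 0" using that(1) by (simp add: gtm_def)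
    have f: "\<not> (r - k < k' \<and> c - m < m') \<Longrightarrow> f (r - k) (c - m) = 0" using that(2) by (simp add: gtm_def)
    show ?thesis
    proof (cases "r < k")
      case True
      then show ?thesis using e that(3) by (simp add: val_def V2_def)
    next
      case False
      show ?thesis
      proof (cases "m \<le> c")
        case True
        have "\<not> (r - k < k' \<and> c - m < m')" using that(3) False True by (auto simp: V2_def)
        then show ?thesis using f False True by (simp add: val_def)
      qed (use False in \<open>simp add: val_def\<close>)
    qed
  qed
  have mk: "lookup (mk (e, f)) (c, r) = val (e, f) c r" if "e \<in> gtm k m p" "f \<in> gtm k' m' q" for e f c r
    using valG[OF that, of c r] unfolding lookup_mk by (auto simp: V2_def)
  show ?thesis
  proof (rule bij_betw_byWitness[where f' = mk])
    show "\<forall>t\<in>sh.Sig (join k p q). mk (upper k t, lower2 k m t) = t"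
    proof (intro ballI poly_mapping_eqI)
      fix t and v :: "nat \<times> nat" assume t: "t \<in> sh.Sig (join k p q)"
      obtain c r where v: "v = (c, r)" by (cases v)
      have ul: "upper k t \<in> gtm k m p" "lower2 k m t \<in> gtm k' m' q" using main[OF outside[OF t]] t by auto
      show "lookup (mk (upper k t, lower2 k m t)) v = lookup t v"
        unfolding v mk[OF ul] using outside[OF t, of "(c, r)"]
        by (auto simp: val_def upper_def lower2_def V2_def)
    qed
    have ul: "upper k (mk (e, f)) = e" "lower2 k m (mk (e, f)) = f" if "e \<in> gtm k m p" "f \<in> gtm k' m' q" for e f
      using that by (auto simp: fun_eq_iff upper_def lower2_def mk val_def gtm_def)
    then show "\<forall>x\<in>gtm k m p \<times> gtm k' m' q. (upper k (mk x), lower2 k m (mk x)) = x" by auto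
    show "(\<lambda>t. (upper k t, lower2 k m t)) ` sh.Sig (join k p q) \<subseteq> gtm k m p \<times> gtm k' m' q"
      using main[OF outside] by blast
    show "mk ` (gtm k m p \<times> gtm k' m' q) \<subseteq> sh.Sig (join k p q)"
    proof safe
      fix e f assume ef: "e \<in> gtm k m p" "f \<in> gtm k' m' q"
      have "lookup (mk (e, f)) v = 0" if "v \<notin> V2 k m k' m'" for v
        using valG[OF ef] mk[OF ef] that by (cases v) simp
      then show "mk (e, f) \<in> sh.Sig (join k p q)" using main[of "mk (e, f)"] ul[OF ef] ef by simp
    qed
  qed
qed

lemma colsum_join:
  assumes "t \<in> sh.Sig (join k p q)"
  shows "c < m \<Longrightarrow> sh.colsum c t = csum k (upper k t) c"
    and "sh.colsum (m + d) t = csum k' (lower2 k m t) d"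
proof -
  have t: "lookup t v = 0" if "v \<notin> V2 k m k' m'" for v
    using that assms by (auto simp: sh.Sig_def sh.mons_def in_keys_iff)
  have split: "(\<Sum>r<k + k'. f r) = (\<Sum>r<k. f r) + (\<Sum>r<k'. f (k + r))" for f :: "nat \<Rightarrow> nat"
    by (induction k') (simp_all add: add.assoc)
  show "sh.colsum c t = csum k (upper k t) c" if "c < m"
  proof -
    have "(\<Sum>r<k'. lookup t (c, k + r)) = 0" using t that by (intro sum.neutral) (auto simp: V2_def)
    then show ?thesis by (simp add: sh.colsum_def split csum_def upper_def)
  qed
  have "(\<Sum>r<k. lookup t (m + d, r)) = 0" using t by (intro sum.neutral) (auto simp: V2_def)
  then show "sh.colsum (m + d) t = csum k' (lower2 k m t) d"
    by (simp add: sh.colsum_def split csum_def lower2_def)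
qed

end

text \<open>A unitary model of the Schur module \<open>S\<^sup>\<mu>(V)\<close> whose weight basis is indexed like the tableaux.\<close>

lemma schur_col_rep:
  assumes mu: "is_partition mu" and \<tau>: "bij_betw \<tau> {..<m} (ssyt mu n)"
  shows "\<exists>e. col_rep n m e (\<lambda>c i. int (content mu (\<tau> c) i))"
proof -
  define l where "l = plength mu"
  let ?e = "\<lambda>i j c d :: nat. if c = i \<and> d = j then 1 else (0 :: real)"
  let ?wt = "\<lambda>c i :: nat. if c = i then 1 else (0 :: int)"
  \<comment> \<open>An empty second block specializes the construction to a single Schur module over
    the standard representation on the columns.\<close>
  interpret U: block "l + 0" "n + 0" "V2 l n 0 0" "R2 l 0" n ?e ?wt
  proof (intro block.intro shape2 block_axioms.intro)
    show "col_rep n (n + 0) ?e ?wt" using col_rep_std by simp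
  qed (auto simp: V2_def split: if_splits)
  let ?\<Lambda> = "join l mu (\<lambda>_. 0)"
  note ps = partition_support[OF mu]
  have z: "\<And>r. l \<le> r \<Longrightarrow> mu r = 0" using ps(4) by (simp add: l_def)
  have b1: "bij_betw (tab_matrix mu) (ssyt mu n) (gtm l n mu)"
    by (rule tab_matrix_bij) (use ps(3) z in auto)
  have b2: "bij_betw (\<lambda>t. (upper l t, lower2 l n t)) (U.Sig ?\<Lambda>) (gtm l n mu \<times> gtm 0 0 (\<lambda>_. 0))"
    by (rule Sig_join_bij) (use ps(3) in auto)
  have g0: "gtm 0 0 (\<lambda>_. 0) = {\<lambda>_ _. 0}" by (auto simp: gtm_def fun_eq_iff)
  have b3: "bij_betw (upper l) (U.Sig ?\<Lambda>) (gtm l n mu)"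
  proof -
    have "bij_betw fst (gtm l n mu \<times> gtm 0 0 (\<lambda>_. 0)) (gtm l n mu)"
      unfolding g0 by (rule bij_betw_byWitness[where f' = "\<lambda>e. (e, \<lambda>_ _. 0)"]) auto
    from bij_betw_trans[OF b2 this] show ?thesis by (simp add: comp_def)
  qed
  \<comment> \<open>The basis is renumbered by the chosen enumeration of tableaux, so that the
    columns of the next ring are the letters of the outer tableaux.\<close>
  define \<rho> where "\<rho> = inv_into (U.Sig ?\<Lambda>) (upper l) \<circ> (tab_matrix mu \<circ> \<tau>)"
  have \<rho>: "bij_betw \<rho> {..<m} (U.Sig ?\<Lambda>)"
    unfolding \<rho>_def by (rule bij_betw_trans[OF bij_betw_trans[OF \<tau> b1] bij_betw_inv_into[OF b3]])
  have up: "upper l (\<rho> c) = tab_matrix mu (\<tau> c)" if "c < m" for c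
  proof -
    have "tab_matrix mu (\<tau> c) \<in> upper l ` U.Sig ?\<Lambda>"
      using bij_betwE[OF b1, rule_format, OF bij_betwE[OF \<tau>, rule_format]] that bij_betw_imp_surj_on[OF b3] by simp
    then show ?thesis by (simp add: \<rho>_def f_inv_into_f)
  qed
  have \<rho>S: "\<rho> c \<in> U.Sig ?\<Lambda>" if "c < m" for c using \<rho> that by (auto simp: bij_betw_def)
  have mwt: "U.mwt (\<rho> c) i = int (content mu (\<tau> c) i)" if c: "c < m" and i: "i < n" for c i
  proof -
    have "U.mwt (\<rho> c) i = (\<Sum>d<n. if d = i then int (U.colsum i (\<rho> c)) else 0)"
      unfolding U.mwt_def by (intro sum.cong) auto
    also have "\<dots> = int (csum l (upper l (\<rho> c)) i)"
      using i colsum_join(1)[OF \<rho>S[OF c] i] by simp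
    also have "\<dots> = int (content mu (\<tau> c) i)"
      using up[OF c] content_tab_matrix[of l mu "\<tau> c" i, OF z] by simp
    finally show ?thesis .
  qed
  obtain b where b: "unitary_module n U.Eop (U.Sig ?\<Lambda>) b U.mwt" using U.unitary_exists by blast
  interpret W: unitary_module n U.Eop "U.Sig ?\<Lambda>" b U.mwt by (rule b)
  have reindex: "(\<Sum>x\<in>U.Sig ?\<Lambda>. f x) = (\<Sum>x<m. f (\<rho> x))" for f :: "_ \<Rightarrow> real"
    using sum.reindex_bij_betw[OF \<rho>, of f] by simp
  have inj: "\<rho> c = \<rho> d \<longleftrightarrow> c = d" if "c < m" "d < m" for c d
    using bij_betw_imp_inj_on[OF \<rho>] that by (auto simp: inj_on_def)
  have "col_rep n m (\<lambda>i j c d. ip (b (\<rho> c)) (U.Eop i j (b (\<rho> d)))) (\<lambda>c i. int (content mu (\<tau> c) i))"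
  proof
    fix i j c d assume "i < n" "j < n"
    then show "ip (b (\<rho> c)) (U.Eop i j (b (\<rho> d))) = ip (b (\<rho> d)) (U.Eop j i (b (\<rho> c)))"
      by (rule W.matrix_sym)
  next
    fix i c d assume "i < n" "c < m" "d < m"
    then show "ip (b (\<rho> c)) (U.Eop i i (b (\<rho> d))) = (if c = d then real_of_int (int (content mu (\<tau> c) i)) else 0)"
      using W.matrix_diag[of i "\<rho> c" "\<rho> d"] \<rho>S inj mwt by simp
  next
    fix i j k l c d assume "i < n" "j < n" "k < n" "l < n" "c < m" "d < m"
    then show "(\<Sum>x<m. ip (b (\<rho> c)) (U.Eop i j (b (\<rho> x))) * ip (b (\<rho> x)) (U.Eop k l (b (\<rho> d))))
       - (\<Sum>x<m. ip (b (\<rho> c)) (U.Eop k l (b (\<rho> x))) * ip (b (\<rho> x)) (U.Eop i j (b (\<rho> d))))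
      = (if j = k then ip (b (\<rho> c)) (U.Eop i l (b (\<rho> d))) else 0) - (if l = i then ip (b (\<rho> c)) (U.Eop k j (b (\<rho> d))) else 0)"
      using W.matrix_comm[of i j k l "\<rho> c" "\<rho> d"] \<rho>S unfolding reindex by simp
  next
    fix c i assume "c < m" "n \<le> i"
    then have "\<tau> c \<in> ssyt mu n" using \<tau> by (auto simp: bij_betw_def)
    then have e: "{x \<in> cells mu. \<tau> c x = i} = {}" using \<open>n \<le> i\<close> by (force simp: ssyt_def)
    show "int (content mu (\<tau> c) i) = 0" unfolding content_def e by simp
  qed
  then show ?thesis by blast
qed

text \<open>Pairing \<open>S\<^sup>\<lambda>(S\<^sup>\<mu>(V))\<close> with the dual of \<open>S\<^sup>\<nu>(V)\<close> turns the multiplicity into a dimension of invariants.\<close>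

theorem plethysm_block:
  assumes mu: "is_partition mu"
  shows "\<exists>m e wt. block (k + n) (m + n) (V2 k m n n) (R2 k n) n e wt \<and>
    (\<forall>lam nu. is_partition lam \<longrightarrow> is_partition nu \<longrightarrow> plength lam \<le> k \<longrightarrow> plength nu \<le> n \<longrightarrow>
      int (dim (block.cov (k + n) (m + n) (V2 k m n n) (R2 k n) n e (join k lam nu))) = plethn n lam mu nu)"
proof -
  define m where "m = card (ssyt mu n)"
  obtain \<tau> where \<tau>: "bij_betw \<tau> {..<m} (ssyt mu n)"
    and less: "\<And>c d. c < m \<Longrightarrow> d < m \<Longrightarrow> tab_less mu (\<tau> c) (\<tau> d) \<longleftrightarrow> c < d"
    unfolding m_def using ssyt_enumeration[OF mu, of n] by blast
  obtain e where e: "col_rep n m e (\<lambda>c i. int (content mu (\<tau> c) i))" using schur_col_rep[OF mu \<tau>] by blast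
  \<comment> \<open>The first \<open>m\<close> columns carry the Schur module of \<open>mu\<close>,
    the last \<open>n\<close> the dual of the standard representation. The matrices depend only on
    \<open>mu\<close> and \<open>n\<close>, so a single block serves all \<open>lam\<close> and
    \<open>nu\<close> of bounded length.\<close>
  let ?e = "\<lambda>i j c d. if c < m \<and> d < m then e i j c d
    else if m \<le> c \<and> m \<le> d then - (if c - m = j \<and> d - m = i then 1 else 0) else 0"
  let ?wt = "\<lambda>c i. if c < m then int (content mu (\<tau> c) i) else - (if c - m = i then 1 else 0)"
  have rep: "col_rep n (m + n) ?e ?wt"
    by (rule col_rep_sum[OF e col_rep_dual[OF col_rep_std]])
  have blk: "block (k + n) (m + n) (V2 k m n n) (R2 k n) n ?e ?wt"
    by (intro block.intro shape2 rep block_axioms.intro) (auto simp: V2_def split: if_splits)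
  interpret B: block "k + n" "m + n" "V2 k m n n" "R2 k n" n ?e ?wt by (rule blk)
  have "int (dim (B.cov (join k lam nu))) = plethn n lam mu nu"
    if lam: "is_partition lam" and nu: "is_partition nu" and kl: "plength lam \<le> k" and nl: "plength nu \<le> n" for lam nu
  proof -
    let ?G = "gtm n n nu" and ?P = "pleth_tableaux lam mu n" and ?S = "B.Sig (join k lam nu)"
    let ?x = "\<lambda>e i. \<Sum>c<m. csum k e c * content mu (\<tau> c) i"
    have bij: "bij_betw (\<lambda>t. (upper k t, lower2 k m t)) ?S (gtm k m lam \<times> ?G)"
      by (rule Sig_join_bij) (use partition_support(3)[OF lam] partition_support(3)[OF nu] in auto)
    \<comment> \<open>The minus sign comes from the dual columns; this is the weight of a pair in
      \<open>plethn_pairs\<close>.\<close>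
    have mwt: "B.mwt t i = int (?x (upper k t) i) - int (csum n (lower2 k m t) i)" if t: "t \<in> ?S" and i: "i < n" for t i
    proof -
      have split: "(\<Sum>x<m + n. f x) = (\<Sum>x<m. f x) + (\<Sum>x<n. f (m + x))" for f :: "nat \<Rightarrow> int" and n
        by (induction n) (simp_all add: add.assoc)
      have "(\<Sum>d<n. ?wt (m + d) i * int (B.colsum (m + d) t)) = (\<Sum>d<n. if d = i then - int (csum n (lower2 k m t) i) else 0)"
        by (intro sum.cong refl) (auto simp: colsum_join(2)[OF t])
      then have "(\<Sum>d<n. ?wt (m + d) i * int (B.colsum (m + d) t)) = - int (csum n (lower2 k m t) i)" using i by simp
      moreover have "(\<Sum>c<m. ?wt c i * int (B.colsum c t)) = int (?x (upper k t) i)"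
        unfolding of_nat_sum by (intro sum.cong refl) (simp add: colsum_join(1)[OF t] mult.commute)
      ultimately show ?thesis unfolding B.mwt_def split by simp
    qed
    have mwt0: "B.mwt t i = 0" if "i \<ge> n" for t i using that B.wt_zero by (simp add: B.mwt_def)
    have finP: "finite ?P"
      using fill_bij[of lam \<tau> m mu n, OF partition_support(3)[OF lam] \<tau> less] finite_ssyt[OF lam, of m] bij_betw_finite by blast
    have "card {t \<in> ?S. B.mwt t = wshift w}
      = card {(F, f) \<in> ?P \<times> ?G. \<forall>i<n. int (pweight lam mu F i) - int (csum n f i) = wshift w i}" if w: "w permutes {..<n}" for w
    proof -
      have w0: "wshift w i = 0" if "i \<ge> n" for i using w that by (simp add: permutes_def wshift_def)
      have *: "B.mwt t = wshift w \<longleftrightarrow> (\<forall>i<n. int (?x (upper k t) i) - int (csum n (lower2 k m t) i) = wshift w i)" if "t \<in> ?S" for t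
      proof
        assume "\<forall>i<n. int (?x (upper k t) i) - int (csum n (lower2 k m t) i) = wshift w i"
        then have "B.mwt t i = wshift w i" for i
          using mwt[OF that, of i] mwt0[of i t] w0[of i] by (cases "i < n") simp_all
        then show "B.mwt t = wshift w" by (rule ext)
      qed (use mwt[OF that] in simp)
      have "bij_betw (\<lambda>t. (upper k t, lower2 k m t)) {t \<in> ?S. B.mwt t = wshift w}
        {(x, f) \<in> gtm k m lam \<times> ?G. \<forall>i<n. int (?x x i) - int (csum n f i) = wshift w i}"
        using bij_betw_Collect_iff[OF bij, of "\<lambda>t. B.mwt t = wshift w" "\<lambda>(x, f). \<forall>i<n. int (?x x i) - int (csum n f i) = wshift w i"] *
        by (simp add: case_prod_unfold mem_Times_iff conj_assoc)
      then have "card {t \<in> ?S. B.mwt t = wshift w} = card {(x, f) \<in> gtm k m lam \<times> ?G. \<forall>i<n. int (?x x i) - int (csum n f i) = wshift w i}"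
        by (rule bij_betw_same_card)
      also have "\<dots> = (\<Sum>f\<in>?G. card {x \<in> gtm k m lam. \<forall>i<n. int (?x x i) - int (csum n f i) = wshift w i})"
        by (rule card_pairs) (rule finite_gtm)+
      also have "\<dots> = (\<Sum>f\<in>?G. card {F \<in> ?P. \<forall>i<n. int (pweight lam mu F i) - int (csum n f i) = wshift w i})"
        using pleth_count[OF lam kl \<tau> less, of "\<lambda>x. \<forall>i<n. int (x i) - int (csum n _ i) = wshift w i"] by (intro sum.cong refl) simp
      also have "\<dots> = card {(F, f) \<in> ?P \<times> ?G. \<forall>i<n. int (pweight lam mu F i) - int (csum n f i) = wshift w i}"
        by (rule card_pairs[symmetric]) (use finP finite_gtm in auto)
      finally show ?thesis .
    qed
    then have "real (dim (B.cov (join k lam nu))) = real_of_int (plethn n lam mu nu)"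
      unfolding B.dim_cov plethn_pairs[OF lam mu nu nl] by (intro sum.cong refl) simp
    then show ?thesis by linarith
  qed
  then show ?thesis using blk by blast
qed

section \<open>Conclusion along the ray of partitions\<close>

lemma is_partition_add:
  assumes "is_partition p" "is_partition q"
  shows "is_partition (\<lambda>i. p i + d * q i)"
proof -
  have "finite {i. p i + d * q i \<noteq> 0}"
    by (rule finite_subset[of _ "{i. p i \<noteq> 0} \<union> {i. q i \<noteq> 0}"]) (use assms in \<open>auto simp: is_partition_def\<close>)
  then show ?thesis using assms by (auto simp: is_partition_def add_mono)
qed

lemma plength_le:
  assumes "\<And>i. i \<ge> n \<Longrightarrow> p i = 0"
  shows "plength p \<le> n"
proof -
  have "{i. p i \<noteq> 0} \<subseteq> {..<n}"
  proof
    fix i assume "i \<in> {i. p i \<noteq> 0}"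
    then show "i \<in> {..<n}" using assms[of i] by (cases "n \<le> i") auto
  qed
  from card_mono[OF _ this] show ?thesis by (simp add: plength_def)
qed

lemma plength_add:
  assumes "is_partition p" "is_partition q" "plength p \<le> n" "plength q \<le> n"
  shows "plength (\<lambda>i. p i + d * q i) \<le> n"
  by (rule plength_le) (use partition_support(4)[OF assms(1)] partition_support(4)[OF assms(2)] assms(3,4) in simp)

text \<open>A bounded sequence of natural numbers attains its maximum, and a monotone one cannot
  leave it again.\<close>

lemma bounded_mono_eventually_const:
  fixes g :: "nat \<Rightarrow> nat"
  assumes "mono g" "\<And>d. g d \<le> B"
  shows "\<exists>D. \<forall>d\<ge>D. g d = g D"
proof -
  have fin: "finite (range g)" by (rule finite_subset[of _ "{..B}"]) (use assms(2) in auto)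
  have "Max (range g) \<in> range g" by (rule Max_in[OF fin]) simp
  then obtain D where D: "Max (range g) = g D" by (rule rangeE)
  have "g d = g D" if "D \<le> d" for d
    using monoD[OF assms(1) that] Max_ge[OF fin, of "g d"] D by simp
  then show ?thesis by blast
qed

theorem theorem4p5:
  fixes lam mu nu alpha gamma :: "nat \<Rightarrow> nat"
  assumes "is_partition lam" and "is_partition mu" and "is_partition nu"
    and "is_partition alpha" and "is_partition gamma"
    and "psize lam * psize mu = psize nu"
    and "\<forall>d::nat. d \<ge> 1 \<longrightarrow>
           pleth_coeff (\<lambda>i. d * alpha i) mu (\<lambda>i. d * gamma i) = 1"
  shows "mono (\<lambda>d::nat. pleth_coeff (\<lambda>i. lam i + d * alpha i) mu (\<lambda>i. nu i + d * gamma i))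
    \<and> (\<exists>D::nat. \<forall>d\<ge>D. pleth_coeff (\<lambda>i. lam i + d * alpha i) mu (\<lambda>i. nu i + d * gamma i)
                       = pleth_coeff (\<lambda>i. lam i + D * alpha i) mu (\<lambda>i. nu i + D * gamma i))"
proof -
  \<comment> \<open>The sums bound the lengths of all the partitions on the ray, for every
    \<open>d\<close>, and \<open>n\<close> also bounds the length of \<open>mu\<close>. Hence one
    block of variables hosts the whole sequence.\<close>
  define k where "k = plength lam + plength alpha"
  define n where "n = plength mu + plength nu + plength gamma"
  obtain m e wt where blk: "block (k + n) (m + n) (V2 k m n n) (R2 k n) n e wt"
    and dims: "\<And>lam nu. is_partition lam \<Longrightarrow> is_partition nu \<Longrightarrow> plength lam \<le> k \<Longrightarrow> plength nu \<le> n \<Longrightarrow>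
      int (dim (block.cov (k + n) (m + n) (V2 k m n n) (R2 k n) n e (join k lam nu))) = plethn n lam mu nu"
    using plethysm_block[OF assms(2), of k n] by blast
  let ?L = "join k lam nu" and ?L' = "join k alpha gamma"
  interpret B: stable_block "k + n" "m + n" "V2 k m n n" "R2 k n" n e wt ?L ?L'
    unfolding stable_block_def by (rule blk)
  have coeff: "pleth_coeff p mu q = int (dim (B.cov (join k p q)))"
    if "is_partition p" "is_partition q" "plength p \<le> k" "plength q \<le> n" for p q
    using dims[OF that] pleth_coeff_plethn[OF that(1) assms(2) that(2), of n] that(4) by (simp add: n_def)
  have zero: "is_partition (\<lambda>_. 0)" "plength (\<lambda>_. 0) \<le> j" for j by (simp_all add: is_partition_def plength_def)
  have jL: "join k (\<lambda>i. lam i + d * alpha i) (\<lambda>i. nu i + d * gamma i) = (\<lambda>r. ?L r + d * ?L' r)" for d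
    by (auto simp: join_def fun_eq_iff)
  have jN: "join k (\<lambda>i. d * alpha i) (\<lambda>i. d * gamma i) = (\<lambda>r. d * ?L' r)" for d
    by (auto simp: join_def fun_eq_iff)
  define g where "g = (\<lambda>d. dim (B.cov (\<lambda>r. ?L r + d * ?L' r)))"
  have g: "pleth_coeff (\<lambda>i. lam i + d * alpha i) mu (\<lambda>i. nu i + d * gamma i) = int (g d)" for d
    unfolding g_def jL[symmetric]
    by (rule coeff) (use assms in \<open>auto intro!: is_partition_add plength_add simp: k_def n_def\<close>)
  have one: "dim (B.cov (\<lambda>r. d * ?L' r)) = 1" if "d \<ge> 1" for d
  proof -
    have "is_partition (\<lambda>i. d * alpha i)" "is_partition (\<lambda>i. d * gamma i)"
      using is_partition_add[OF zero(1) assms(4), of d] is_partition_add[OF zero(1) assms(5), of d] by simp_all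
    moreover have "plength (\<lambda>i. d * alpha i) \<le> k" "plength (\<lambda>i. d * gamma i) \<le> n"
      using plength_add[OF zero(1) assms(4) zero(2), of k d] plength_add[OF zero(1) assms(5) zero(2), of n d]
      by (simp_all add: k_def n_def)
    ultimately have "pleth_coeff (\<lambda>i. d * alpha i) mu (\<lambda>i. d * gamma i) = int (dim (B.cov (\<lambda>r. d * ?L' r)))"
      unfolding jN[symmetric] by (rule coeff)
    then show ?thesis using assms(7) that by simp
  qed
  \<comment> \<open>The hypothesis at \<open>d = 1\<close> supplies a nonzero covariant of degree
    \<open>?L'\<close>, by which all pieces are multiplied.\<close>
  have "\<not> B.cov ?L' \<subseteq> {0}"
  proof
    assume "B.cov ?L' \<subseteq> {0}"
    then have "dim (B.cov ?L') = 0" using dim_le_card[of "B.cov ?L'" "{}"] by simp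
    then show False using one[of 1] by simp
  qed
  then obtain f where f: "f \<in> B.cov ?L'" "f \<noteq> 0" by blast
  have "g d \<le> g (Suc d)" for d
  proof -
    have "(\<lambda>r. ?L r + d * ?L' r + ?L' r) = (\<lambda>r. ?L r + Suc d * ?L' r)" by (simp add: fun_eq_iff)
    then show ?thesis using B.dim_cov_mono[OF f, of "\<lambda>r. ?L r + d * ?L' r"] by (simp add: g_def)
  qed
  then have mono: "mono g" by (simp add: mono_iff_le_Suc)
  obtain b where b: "\<And>d. g d \<le> b" using B.dim_cov_bounded[OF one] unfolding g_def by blast
  show ?thesis
    unfolding g using bounded_mono_eventually_const[OF mono b] mono by (auto simp: mono_def)
qed

end
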